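(* Let $G_0\in\mathbb{Q}[x,y]$ be a non-constant homogeneous polynomial (for the standard grading). Then for all sufficiently large primes $p$ the following holds, where $G_p\in\mathbb{F}_p[x,y]$ denotes the reduction of $G_0$ modulo $p$. If $\operatorname{fpt}(G_p)\neq \operatorname{lct}(G_0)$, then the minimal denominator of the rational number $\operatorname{fpt}(G_p)$ is of the form $kp^e$, where $e\ge 1$ and $k$ divides the multiplicity of some linear factor (over $\mathbb{C}$) of $G_0$. In particular, writing $\operatorname{fpt}(G_p)=a/b$ in lowest terms, $p$ divides $b$.
   Context: For a polynomial $g$ with $g(0,0)=0$ over a field of characteristic $p>0$ in variables $x,y$, the $F$-pure threshold (at the origin) is $\operatorname{fpt}(g)=\inf\{a/p^e : a,e\in\mathbb{N},\ g^a\in\langle x^{p^e},y^{p^e}\rangle\}$; it is known to be a positive rational number in $[0,1]$. For a polynomial $g$ over a field of characteristic zero vanishing at the origin, $\operatorname{lct}(g)$ is the usual log canonical threshold of $g$ at the origin, defined via a log resolution; for homogeneous $G_0\in\mathbb{Q}[x,y]$ one has $\operatorname{lct}(G_0)=\lim_{p\to\infty}\operatorname{fpt}(G_p)$. The reduction $G_p$ is obtained by reducing the coefficients of $G_0$ modulo $p$, which makes sense for all primes $p$ not dividing any denominator of a coefficient of $G_0$. *)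

theory Defs
  imports
    "HOL-Number_Theory.Residues"
    "HOL-Algebra.UnivPoly"
    "HOL-Computational_Algebra.Computational_Algebra"
    "HOL-Computational_Algebra.Field_as_Ring"
    Complex_Main
begin

text \<open>
  In \<open>'a poly poly\<close> the inner variable is \<open>x\<close> and the outer one is \<open>y\<close>, so that
  the coefficient of \<open>x^i y^j\<close> in \<open>g\<close> is \<open>coeff2 g i j\<close>.
\<close>

definition coeff2 :: "'a::zero poly poly \<Rightarrow> nat \<Rightarrow> nat \<Rightarrow> 'a" where
  "coeff2 g i j = Polynomial.coeff (Polynomial.coeff g j) i"

definition var_x :: "'a::comm_semiring_1 poly poly" where
  "var_x = [:[:0, 1:]:]"

definition var_y :: "'a::comm_semiring_1 poly poly" where
  "var_y = [:0, 1:]"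

definition const2 :: "'a::zero \<Rightarrow> 'a poly poly" where
  "const2 c = [:[:c:]:]"

definition map_poly2 :: "('a::zero \<Rightarrow> 'b::zero) \<Rightarrow> 'a poly poly \<Rightarrow> 'b poly poly" where
  "map_poly2 h g = map_poly (map_poly h) g"

definition homogeneous2 :: "'a::zero poly poly \<Rightarrow> bool" where
  "homogeneous2 g \<longleftrightarrow> (\<exists>d. \<forall>i j. coeff2 g i j \<noteq> 0 \<longrightarrow> i + j = d)"

definition constant2 :: "'a::zero poly poly \<Rightarrow> bool" where
  "constant2 g \<longleftrightarrow> (\<exists>c. g = const2 c)"

definition linear_form :: "'a::comm_semiring_1 poly poly \<Rightarrow> bool" where
  "linear_form l \<longleftrightarrow>
     (\<exists>a b. (a, b) \<noteq> (0, 0) \<and> l = const2 a * var_x + const2 b * var_y)"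

definition subst2 :: "'a::comm_ring_1 poly poly \<Rightarrow> 'a poly poly \<Rightarrow> 'a poly poly \<Rightarrow> 'a poly poly" where
  "subst2 g X Y = poly (map_poly (\<lambda>q. poly (map_poly const2 q) X) g) Y"

definition dx :: "'a::idom poly poly \<Rightarrow> 'a poly poly" where
  "dx g = map_poly pderiv g"

definition dy :: "'a::idom poly poly \<Rightarrow> 'a poly poly" where
  "dy g = pderiv g"

definition jacobian :: "'a::idom poly poly \<Rightarrow> 'a poly poly \<Rightarrow> 'a poly poly" where
  "jacobian X Y = dx X * dy Y - dy X * dx Y"

text \<open>
  Every proper birational morphism from a smooth surface to a neighbourhood of the origin of
  \<open>\<complex>\<^sup>2\<close> that is an isomorphism away from the origin is a finite composition of blow-ups of
  closed points lying over the origin.  A point infinitely near to the origin is encoded by the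
  list of successive tangent directions leading to it: \<open>Some c\<close> is the direction \<open>[1 : c]\<close> and
  \<open>None\<close> the direction \<open>[0 : 1]\<close> on the exceptional curve of the blow-up of the current point.
  Each such point carries the affine coordinates, centred at it, of the usual blow-up charts
  \<open>(u, v) \<mapsto> (u, u (v + c))\<close> and \<open>(u, v) \<mapsto> (u v, v)\<close>.
\<close>

type_synonym inf_near = "complex option list"

fun blowup_chart :: "complex option \<Rightarrow> complex poly poly \<Rightarrow> complex poly poly" where
  "blowup_chart (Some c) g = subst2 g var_x (var_x * (var_y + const2 c))"
| "blowup_chart None g = subst2 g (var_x * var_y) var_y"

definition pullback :: "inf_near \<Rightarrow> complex poly poly \<Rightarrow> complex poly poly" where
  "pullback w g = fold blowup_chart w g"

definition jac :: "inf_near \<Rightarrow> complex poly poly" where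
  "jac w = jacobian (pullback w var_x) (pullback w var_y)"

text \<open>
  The exceptional curve of the blow-up of the point \<open>w\<close> has the equation \<open>u = 0\<close> in the chart
  \<open>w @ [Some 0]\<close>.  Along it, \<open>exc_ord w g\<close> is the order of the pullback of \<open>g\<close>, and
  \<open>exc_discr w\<close> is the coefficient of the relative canonical divisor, which is the divisor of
  the Jacobian determinant.
\<close>

definition exc_ord :: "inf_near \<Rightarrow> complex poly poly \<Rightarrow> nat" where
  "exc_ord w g = multiplicity var_x (pullback (w @ [Some 0]) g)"

definition exc_discr :: "inf_near \<Rightarrow> nat" where
  "exc_discr w = multiplicity var_x (jac (w @ [Some 0]))"

text \<open>
  The divisor of \<open>h\<close> has simple normal crossing support at the origin: up to a unit of the local
  ring of the plane at the origin, \<open>h\<close> is a monomial in a regular system of parameters.  Clearing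
  denominators, the parameters and the units can be taken to be polynomials.
\<close>

definition snc_at_origin :: "complex poly poly \<Rightarrow> bool" where
  "snc_at_origin h \<longleftrightarrow>
     (\<exists>z1 z2 s t a b. coeff2 z1 0 0 = 0 \<and> coeff2 z2 0 0 = 0 \<and>
        coeff2 (jacobian z1 z2) 0 0 \<noteq> 0 \<and>
        coeff2 s 0 0 \<noteq> 0 \<and> coeff2 t 0 0 \<noteq> 0 \<and>
        s * h = t * z1 ^ a * z2 ^ b)"

text \<open>
  A composition of blow-ups is given by the set \<open>T\<close> of the infinitely near points that are blown
  up; the points over the origin of the resulting surface are \<open>points_over T\<close>.  It is a
  log resolution of \<open>g\<close> if at each of these points the union of the exceptional locus (the zero
  set of the Jacobian determinant) and the zero set of the pullback of \<open>g\<close> has simple normal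
  crossings.
\<close>

definition blowup_cluster :: "inf_near set \<Rightarrow> bool" where
  "blowup_cluster T \<longleftrightarrow> finite T \<and> (\<forall>w c. w @ [c] \<in> T \<longrightarrow> w \<in> T)"

definition points_over :: "inf_near set \<Rightarrow> inf_near set" where
  "points_over T = {w. w \<notin> T \<and> (w = [] \<or> butlast w \<in> T)}"

definition log_resolution :: "complex poly poly \<Rightarrow> inf_near set \<Rightarrow> bool" where
  "log_resolution g T \<longleftrightarrow>
     blowup_cluster T \<and> (\<forall>w\<in>points_over T. snc_at_origin (pullback w g * jac w))"

text \<open>
  The minimum of \<open>(k\<^sub>E + 1) / ord\<^sub>E g\<close> over the prime divisors \<open>E\<close> of the resolution whose image
  contains the origin and that occur in the divisor of \<open>g\<close>.  These are the exceptional curves and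
  the strict transforms of the components of \<open>g = 0\<close> through the origin; the latter have
  \<open>k\<^sub>E = 0\<close>.
\<close>

definition lct_via :: "complex poly poly \<Rightarrow> inf_near set \<Rightarrow> real" where
  "lct_via g T = Min
     ((\<lambda>w. real (exc_discr w + 1) / real (exc_ord w g)) ` T \<union>
      {1 / real (multiplicity q g) | q. Factorial_Ring.irreducible q \<and> q dvd g \<and> coeff2 q 0 0 = 0})"

text \<open>
  The value does not depend on the log resolution.  Only meaningful for \<open>g \<noteq> 0\<close> vanishing at
  the origin.
\<close>

definition lct :: "complex poly poly \<Rightarrow> real" where
  "lct g = (THE c. \<exists>T. log_resolution g T \<and> c = lct_via g T)"

text \<open>
  For a field \<open>R\<close>, the ring \<open>R[x,y]\<close> is \<open>UP (UP R)\<close>, again with \<open>x\<close> the inner and \<open>y\<close> the outer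
  variable.
\<close>

definition UP2 :: "('a, 'm) ring_scheme \<Rightarrow> (nat \<Rightarrow> 'a, nat \<Rightarrow> nat \<Rightarrow> 'a) up_ring" where
  "UP2 R = UP (UP R)"

definition UP2_x :: "('a, 'm) ring_scheme \<Rightarrow> nat \<Rightarrow> nat \<Rightarrow> 'a" where
  "UP2_x R = up_ring.monom (UP2 R) (up_ring.monom (UP R) \<one>\<^bsub>R\<^esub> 1) 0"

definition UP2_y :: "('a, 'm) ring_scheme \<Rightarrow> nat \<Rightarrow> nat \<Rightarrow> 'a" where
  "UP2_y R = up_ring.monom (UP2 R) \<one>\<^bsub>UP R\<^esub> 1"

definition fpt :: "nat \<Rightarrow> ('a, 'm) ring_scheme \<Rightarrow> (nat \<Rightarrow> nat \<Rightarrow> 'a) \<Rightarrow> real" where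
  "fpt p R g = Inf {real a / real (p ^ e) | a e :: nat.
     g [^]\<^bsub>UP2 R\<^esub> a \<in>
       genideal (UP2 R) {UP2_x R [^]\<^bsub>UP2 R\<^esub> (p ^ e), UP2_y R [^]\<^bsub>UP2 R\<^esub> (p ^ e)}}"

text \<open>Only meaningful if \<open>p\<close> does not divide the denominator of \<open>r\<close>.\<close>

definition red_rat :: "nat \<Rightarrow> rat \<Rightarrow> int" where
  "red_rat p r = (let R = residue_ring (int p); (n, d) = quotient_of r in
     (n mod int p) \<otimes>\<^bsub>R\<^esub> inv\<^bsub>R\<^esub> (d mod int p))"

text \<open>
  Elements of \<open>UP (UP R)\<close> are coefficient functions, the exponent of \<open>y\<close> being the first argument.
\<close>

definition reduction :: "nat \<Rightarrow> rat poly poly \<Rightarrow> nat \<Rightarrow> nat \<Rightarrow> int" where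
  "reduction p G = (\<lambda>j i. red_rat p (coeff2 G i j))"

end

theory Submission
  imports Defs
begin

text \<open>
  A form \<open>G\<close> of degree \<open>d\<close> is determined by \<open>f(x) = G(x, 1)\<close>, and \<open>G\<close> lies in
  \<open>I\<^sub>q = \<langle>x\<^sup>q, y\<^sup>q\<rangle>\<close> modulo \<open>p\<close> exactly if the coefficients of \<open>f\<close> in the band \<open>d - q < i < q\<close>
  vanish modulo \<open>p\<close> (\<open>in_frob\<close>).  Write \<open>G = y\<^sup>m\<^sup>0 \<Prod> P\<^sup>m\<^sup>P\<close> up to a constant, with distinct irreducible
  forms \<open>P\<close> over the rationals, let \<open>M\<close> be the largest exponent, and consider all products
  \<open>F = y\<^sup>b\<^sup>0 \<Prod> P\<^sup>b\<^sup>P\<close> with independent exponents.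

  The key step (\<open>exps_in_frob_lower\<close>) says that if \<open>F \<in> I\<^sub>q\<close>, where \<open>q > 1\<close> is a power of \<open>p\<close> and the
  degree of \<open>F\<close> is below \<open>2 q\<close> by a constant that depends on \<open>d\<close> only, then \<open>F\<close> stays in \<open>I\<^sub>q\<close> when
  every exponent that is prime to \<open>p\<close> is lowered by one.  Indeed derivations preserve \<open>I\<^sub>q\<close>, so \<open>F\<close> and
  its partial derivatives lie in \<open>I\<^sub>q\<close>.  They are multiples of the product \<open>h\<close> with the lowered
  exponents, and the cofactors have no common zero on the projective line, because the forms \<open>P\<close> remain
  squarefree and coprime modulo large \<open>p\<close>.  So \<open>h\<close> times all forms of a certain bounded degree lies in
  \<open>I\<^sub>q\<close>, and as the socle of the quotient by \<open>I\<^sub>q\<close> sits in degree \<open>2 q - 2\<close>, this forces \<open>h \<in> I\<^sub>q\<close>.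

  Iteration makes all exponents divisible by \<open>p\<close>, and then a \<open>p\<close>-th root can be taken: membership
  descends from \<open>p\<^sup>e\<^sup>+\<^sup>k\<close> to \<open>p\<^sup>e\<close> with the exponents divided by \<open>p\<^sup>k\<close> and rounded down
  (\<open>exps_in_frob_descend\<close>).  Hence, if the F-pure threshold \<open>t\<close> is less than \<open>2 / d\<close>, then it is decided
  on one level \<open>p\<^sup>e\<close> by finitely many exponent vectors, and equals \<open>n / (m\<^sub>i p\<^sup>e)\<close> for one of the
  multiplicities \<open>m\<^sub>i\<close> (\<open>Inf_thresholds_rational\<close>).  Descending all the way to \<open>q = 1\<close> gives
  \<open>t \<ge> min (1 / M) ((2 - C / p) / d)\<close> (\<open>thresholds_lower\<close>), while clearly
  \<open>t \<le> min (2 / d) (1 / M)\<close>.  If \<open>M > d / 2\<close>, these bounds agree for large \<open>p\<close>.  Otherwise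
  \<open>t \<noteq> 2 / d\<close> is so close to \<open>2 / d\<close> that its denominator cannot divide \<open>m\<^sub>i \<le> d\<close>, so \<open>p\<close> must
  divide it (\<open>Inf_thresholds_dichotomy\<close>).

  It remains to see that the log canonical threshold is \<open>min (2 / d) (1 / M)\<close> (\<open>lct_homogenize\<close>).
  The blow-up of the origin is a log resolution with \<open>(k\<^sub>E + 1) / ord\<^sub>E G = 2 / d\<close>; afterwards \<open>G\<close> and
  the Jacobian are monomials up to units at every infinitely near point, and the inequality
  \<open>k\<^sub>E + 1 \<ge> min (2 / d) (1 / M) ord\<^sub>E G\<close> passes to all further exceptional curves.
\<close>

section \<open>Integer polynomials modulo a prime\<close>

lemma dvd_diff_cong: "(d::int) dvd a - b \<Longrightarrow> d dvd a \<longleftrightarrow> d dvd b"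
  using dvd_diff_right_iff[of d a b] dvd_add[of d "a - b" b] by auto

text \<open>
  The field with \<open>p\<close> elements cannot be a type that depends on the variable \<open>p\<close>.  Polynomials over it
  are therefore represented by integer polynomials up to congruence.
\<close>

locale prime_modulus =
  fixes p :: nat
  assumes prime_p: "prime p"
begin

definition pcong :: "int poly \<Rightarrow> int poly \<Rightarrow> bool" (infix "\<simeq>" 50) where
  "f \<simeq> g \<longleftrightarrow> [:int p:] dvd f - g"

lemma pcong_iff: "f \<simeq> g \<longleftrightarrow> (\<forall>i. int p dvd coeff f i - coeff g i)"
  by (simp add: pcong_def const_poly_dvd_iff)

lemma pcong_refl [simp]: "f \<simeq> f"
  by (simp add: pcong_def)

lemma pcong_sym: "f \<simeq> g \<Longrightarrow> g \<simeq> f"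
  unfolding pcong_def by (metis dvd_minus_iff minus_diff_eq)

lemma pcong_trans [trans]: "f \<simeq> g \<Longrightarrow> g \<simeq> h \<Longrightarrow> f \<simeq> h"
  unfolding pcong_def by (drule (1) dvd_add) simp

lemma pcong_add: "f \<simeq> g \<Longrightarrow> f' \<simeq> g' \<Longrightarrow> f + f' \<simeq> g + g'"
  unfolding pcong_def by (drule (1) dvd_add) (simp add: algebra_simps)

lemma pcong_diff: "f \<simeq> g \<Longrightarrow> f' \<simeq> g' \<Longrightarrow> f - f' \<simeq> g - g'"
  unfolding pcong_def by (drule (1) dvd_diff) (simp add: algebra_simps)

lemma pcong_mult: "f \<simeq> g \<Longrightarrow> f' \<simeq> g' \<Longrightarrow> f * f' \<simeq> g * g'"
proof -
  assume "f \<simeq> g" "f' \<simeq> g'"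
  hence "[:int p:] dvd (f - g) * f'" "[:int p:] dvd g * (f' - g')"
    by (simp_all add: pcong_def)
  hence "[:int p:] dvd (f - g) * f' + g * (f' - g')" by (rule dvd_add)
  thus ?thesis by (simp add: pcong_def algebra_simps)
qed

lemma pcong_mult_left: "f' \<simeq> g' \<Longrightarrow> f * f' \<simeq> f * g'"
  by (rule pcong_mult) simp_all

lemma pcong_mult_right: "f \<simeq> g \<Longrightarrow> f * h \<simeq> g * h"
  by (rule pcong_mult) simp_all

lemma pcong_coeff: "f \<simeq> g \<Longrightarrow> int p dvd coeff f i \<longleftrightarrow> int p dvd coeff g i"
  unfolding pcong_iff using dvd_diff_cong by blast

lemma prime_dvd_mult_int: "int p dvd a * b \<longleftrightarrow> int p dvd a \<or> int p dvd b"
  using prime_p by (simp add: prime_dvd_mult_iff)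

lemma inverse_mod_p:
  assumes "\<not> int p dvd a" obtains c where "int p dvd 1 - c * a"
proof -
  have "coprime a (int p)"
    using assms prime_p by (metis coprime_commute prime_imp_coprime prime_nat_int_transfer)
  then obtain c where "[a * c = 1] (mod int p)" using coprime_iff_invertible_int by blast
  hence "int p dvd 1 - c * a" by (metis cong_iff_dvd_diff cong_sym mult.commute)
  thus thesis by (rule that)
qed

text \<open>
  Leading coefficients multiply, also if \<open>a\<close> and \<open>b\<close> only bound the degrees modulo \<open>p\<close>.
\<close>

lemma coeff_mult_top:
  assumes "\<And>i. i > a \<Longrightarrow> int p dvd coeff f i" "\<And>i. i > b \<Longrightarrow> int p dvd coeff g i"
  shows "int p dvd coeff (f * g) (a + b) - coeff f a * coeff g b"
proof -
  have "coeff (f * g) (a + b) = coeff f a * coeff g b + (\<Sum>i\<in>{..a+b}-{a}. coeff f i * coeff g (a + b - i))"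
    unfolding coeff_mult by (subst sum.remove[of _ a]) auto
  moreover have "int p dvd (\<Sum>i\<in>{..a+b}-{a}. coeff f i * coeff g (a + b - i))"
  proof (rule dvd_sum)
    fix i assume "i \<in> {..a+b}-{a}"
    hence "i > a \<or> a + b - i > b" by auto
    thus "int p dvd coeff f i * coeff g (a + b - i)" using assms by auto
  qed
  ultimately show ?thesis by simp
qed

text \<open>
  Division with remainder works because the leading coefficient of \<open>v\<close> is a unit modulo \<open>p\<close>.  Degree
  bounds are stated through vanishing coefficients, so that \<open>D = 0\<close> leaves the remainder \<open>0\<close>.
\<close>

lemma division_mod_p:
  assumes v: "\<And>i. i > D \<Longrightarrow> coeff v i = 0" "\<not> int p dvd coeff v D"
    and w: "\<And>i. i \<ge> n \<Longrightarrow> coeff w i = 0"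
  shows "\<exists>\<alpha> \<rho>. w \<simeq> \<alpha> * v + \<rho> \<and> (\<forall>i\<ge>D. coeff \<rho> i = 0) \<and> (\<forall>i. i + D \<ge> n \<longrightarrow> coeff \<alpha> i = 0)"
  using w
proof (induction n arbitrary: w)
  case 0
  hence "w = 0" by (simp add: poly_eq_iff)
  thus ?case by (intro exI[of _ 0]) auto
next
  case (Suc n)
  show ?case
  proof (cases "n < D")
    case True
    thus ?thesis using Suc.prems by (intro exI[of _ 0] exI[of _ w]) auto
  next
    case False
    obtain c where c: "int p dvd 1 - c * coeff v D" using inverse_mod_p[OF v(2)] .
    define s where "s = coeff w n"
    define w1 where "w1 = w - monom (c * s) (n - D) * v"
    define w2 where "w2 = w1 - monom (coeff w1 n) n"
    have w1: "coeff w1 i = 0" if "i > n" for i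
      using that False Suc.prems v(1) by (simp add: w1_def coeff_monom_mult)
    have "coeff w1 n = s * (1 - c * coeff v D)"
      using False by (simp add: w1_def coeff_monom_mult) (simp add: s_def algebra_simps)
    hence "w1 \<simeq> w2" using c by (auto simp: pcong_iff w2_def)
    have "\<And>i. i \<ge> n \<Longrightarrow> coeff w2 i = 0"
      using w1 by (auto simp: w2_def le_less)
    from Suc.IH[OF this] obtain \<alpha> \<rho> where
      *: "w2 \<simeq> \<alpha> * v + \<rho>" "\<forall>i\<ge>D. coeff \<rho> i = 0" "\<forall>i. i + D \<ge> n \<longrightarrow> coeff \<alpha> i = 0" by blast
    have "w1 \<simeq> \<alpha> * v + \<rho>" using \<open>w1 \<simeq> w2\<close> *(1) by (rule pcong_trans)
    hence "monom (c * s) (n - D) * v + w1 \<simeq> monom (c * s) (n - D) * v + (\<alpha> * v + \<rho>)"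
      by (intro pcong_add) auto
    hence "w \<simeq> (monom (c * s) (n - D) + \<alpha>) * v + \<rho>"
      by (simp add: w1_def algebra_simps)
    moreover have "\<forall>i. i + D \<ge> Suc n \<longrightarrow> coeff (monom (c * s) (n - D) + \<alpha>) i = 0"
      using *(3) False by (auto simp: le_diff_conv)
    ultimately show ?thesis using *(2) by blast
  qed
qed

lemma quotient_degree_mod_p:
  assumes g: "\<And>i. i > D \<Longrightarrow> coeff g i = 0" "\<not> int p dvd coeff g D"
    and ag: "\<And>i. i \<ge> n \<Longrightarrow> int p dvd coeff (\<alpha> * g) i"
    and "i + D \<ge> n"
  shows "int p dvd coeff \<alpha> i"
proof (rule ccontr)
  assume ni: "\<not> int p dvd coeff \<alpha> i"
  define X where "X = {j. \<not> int p dvd coeff \<alpha> j}"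
  have fin: "finite X"
    by (rule finite_subset[of _ "{..degree \<alpha>}"]) (auto simp: X_def intro!: le_degree)
  have iX: "i \<in> X" using ni by (simp add: X_def)
  define k where "k = Max X"
  have k: "k \<in> X" "i \<le> k" using Max_in[OF fin] Max_ge[OF fin] iX by (auto simp: k_def)
  have "\<And>j. j > k \<Longrightarrow> int p dvd coeff \<alpha> j"
    using Max_ge[OF fin] by (force simp: k_def X_def)
  from coeff_mult_top[of k \<alpha> D g, OF this] g(1)
  have "int p dvd coeff (\<alpha> * g) (k + D) - coeff \<alpha> k * coeff g D" by simp
  moreover have "int p dvd coeff (\<alpha> * g) (k + D)" using ag k(2) \<open>i + D \<ge> n\<close> by simp
  ultimately have "int p dvd coeff \<alpha> k * coeff g D" using dvd_diff_cong by blast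
  thus False using k(1) g(2) by (simp add: X_def prime_dvd_mult_int)
qed

text \<open>
  The ideal generated by \<open>f\<close>, \<open>g\<close> and \<open>p\<close> is the whole ring.
\<close>

definition comaximal :: "int poly \<Rightarrow> int poly \<Rightarrow> bool" where
  "comaximal f g \<longleftrightarrow> (\<exists>A B. A * f + B * g \<simeq> 1)"

lemma comaximal_sym: "comaximal f g \<Longrightarrow> comaximal g f"
  unfolding comaximal_def by (metis add.commute)

lemma comaximal_one [simp]: "comaximal 1 f" "comaximal f 1"
  unfolding comaximal_def
  by (rule exI[of _ 1], rule exI[of _ 0], simp) (rule exI[of _ 0], rule exI[of _ 1], simp)

lemma comaximal_mult:
  assumes "comaximal f h" "comaximal g h" shows "comaximal (f * g) h"
proof -
  from assms obtain A B A' B' where "A * f + B * h \<simeq> 1" "A' * g + B' * h \<simeq> 1"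
    by (auto simp: comaximal_def)
  hence "(A * f + B * h) * (A' * g + B' * h) \<simeq> 1 * 1" by (rule pcong_mult)
  hence "(A * A') * (f * g) + (A * f * B' + B * (A' * g + B' * h)) * h \<simeq> 1"
    by (simp add: algebra_simps)
  thus ?thesis unfolding comaximal_def by blast
qed

lemma comaximal_prod:
  "(\<And>x. x \<in> S \<Longrightarrow> comaximal (F x) h) \<Longrightarrow> comaximal (\<Prod>x\<in>S. F x) h"
  by (induction S rule: infinite_finite_induct) (auto intro: comaximal_mult)

lemma comaximal_smult:
  assumes "comaximal f g" "\<not> int p dvd a" shows "comaximal (smult a f) g"
proof -
  obtain c where c: "int p dvd 1 - c * a" using inverse_mod_p[OF assms(2)] .
  have "[:c:] * [:a:] + 0 * g \<simeq> 1"
    unfolding pcong_iff using c dvd_minus_iff[of "int p" "1 - c * a"]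
    by (auto simp: coeff_pCons algebra_simps split: nat.splits)
  hence "comaximal [:a:] g" unfolding comaximal_def by blast
  from comaximal_mult[OF this assms(1)] show ?thesis by simp
qed

lemma comaximal_add_multiple:
  assumes "comaximal f g" shows "comaximal f (f * m + g)"
proof -
  from assms obtain A B where "A * f + B * g \<simeq> 1" by (auto simp: comaximal_def)
  hence "(A - B * m) * f + B * (f * m + g) \<simeq> 1" by (simp add: algebra_simps)
  thus ?thesis unfolding comaximal_def by blast
qed

text \<open>
  Every \<open>r\<close> of degree below \<open>D\<close> is a combination of \<open>g\<close> and \<open>u\<close> with coefficients of degree below
  \<open>D\<close>: reduce the coefficient of \<open>u\<close> modulo \<open>g\<close>, then compare degrees to bound that of \<open>g\<close>.  The
  bound does not depend on \<open>p\<close>, although the witnesses of comaximality do.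
\<close>

lemma comaximal_bezout:
  assumes g: "\<And>i. i > D \<Longrightarrow> coeff g i = 0" "\<not> int p dvd coeff g D"
    and u: "\<And>i. i \<ge> D \<Longrightarrow> coeff u i = 0"
    and com: "comaximal g u"
    and r: "\<And>i. i \<ge> D \<Longrightarrow> coeff r i = 0"
  shows "\<exists>\<alpha> \<beta>. r \<simeq> \<alpha> * g + \<beta> * u \<and> (\<forall>i\<ge>D. int p dvd coeff \<alpha> i) \<and> (\<forall>i\<ge>D. coeff \<beta> i = 0)"
proof -
  from com obtain A B where AB: "A * g + B * u \<simeq> 1" by (auto simp: comaximal_def)
  have "\<And>i. i \<ge> Suc (degree (r * B)) \<Longrightarrow> coeff (r * B) i = 0" by (simp add: coeff_eq_0)
  from division_mod_p[OF g this] obtain \<sigma> \<beta> where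
    s: "r * B \<simeq> \<sigma> * g + \<beta>" and b: "\<forall>i\<ge>D. coeff \<beta> i = 0" by blast
  define \<alpha> where "\<alpha> = r * A + \<sigma> * u"
  have "(\<sigma> * g + \<beta>) * u \<simeq> (r * B) * u" by (intro pcong_mult_right pcong_sym[OF s])
  hence "r * A * g + (\<sigma> * g + \<beta>) * u \<simeq> r * A * g + (r * B) * u" by (intro pcong_add) auto
  also have "r * A * g + (r * B) * u = r * (A * g + B * u)" by (simp add: algebra_simps)
  also have "\<dots> \<simeq> r * 1" by (intro pcong_mult_left AB)
  finally have *: "\<alpha> * g + \<beta> * u \<simeq> r" by (simp add: \<alpha>_def algebra_simps)
  have bu: "coeff (\<beta> * u) i = 0" if "i \<ge> 2 * D" for i
  proof -
    have "coeff \<beta> k * coeff u (i - k) = 0" if "k \<le> i" for k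
      using b u[of "i - k"] \<open>i \<ge> 2 * D\<close> by (cases "k \<ge> D") auto
    thus ?thesis unfolding coeff_mult by (intro sum.neutral) auto
  qed
  have "int p dvd coeff \<alpha> i" if "i \<ge> D" for i
  proof (rule quotient_degree_mod_p[OF g, of "2 * D"])
    fix j assume j: "j \<ge> 2 * D"
    have "int p dvd coeff (\<alpha> * g) j + coeff (\<beta> * u) j - coeff r j"
      using * by (simp add: pcong_iff)
    thus "int p dvd coeff (\<alpha> * g) j" using bu[OF j] r[of j] j by simp
  qed (use that in auto)
  thus ?thesis using pcong_sym[OF *] b by blast
qed

section \<open>Frobenius powers of the maximal ideal\<close>

text \<open>
  If \<open>f\<close> has degree at most \<open>n\<close>, this says that its homogenization of degree \<open>n\<close> lies in
  \<open>\<langle>x\<^sup>q, y\<^sup>q\<rangle>\<close> modulo \<open>p\<close>: the monomials \<open>x\<^sup>i y\<^sup>n\<^sup>-\<^sup>i\<close> outside this ideal are those with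
  \<open>i < q\<close> and \<open>n - i < q\<close>.
\<close>

definition in_frob :: "nat \<Rightarrow> nat \<Rightarrow> int poly \<Rightarrow> bool" where
  "in_frob n q f \<longleftrightarrow> (\<forall>i<q. n < i + q \<longrightarrow> int p dvd coeff f i)"

lemma in_frob_cong: "f \<simeq> g \<Longrightarrow> in_frob n q f \<longleftrightarrow> in_frob n q g"
  unfolding in_frob_def by (simp add: pcong_coeff)

lemma in_frob_mult:
  assumes "in_frob n q f" "degree g \<le> k" shows "in_frob (n + k) q (f * g)"
  unfolding in_frob_def coeff_mult
proof (intro allI impI dvd_sum)
  fix i j assume i: "i < q" "n + k < i + q" and j: "j \<in> {..i}"
  show "int p dvd coeff f j * coeff g (i - j)"
  proof (cases "i - j \<le> k")
    case True
    thus ?thesis using i j assms(1) by (auto simp: in_frob_def)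
  next
    case False
    thus ?thesis using assms(2) by (simp add: coeff_eq_0)
  qed
qed

text \<open>
  The ideal \<open>\<langle>x\<^sup>q, y\<^sup>q\<rangle>\<close> is stable under derivations because \<open>q\<close> vanishes modulo \<open>p\<close>.  This is the
  derivative with respect to \<open>x\<close>.
\<close>

lemma in_frob_pderiv:
  assumes "in_frob n q f" "p dvd q" shows "in_frob n q (pderiv f)"
  unfolding in_frob_def
proof (intro allI impI)
  fix i assume i: "i < q" "n < i + q"
  show "int p dvd coeff (pderiv f) i"
  proof (cases "Suc i = q")
    case True
    hence "int p dvd of_nat (Suc i)" using assms(2) by (simp only: int_dvd_int_iff)
    thus ?thesis unfolding coeff_pderiv by (rule dvd_mult2)
  next
    case False
    thus ?thesis using assms(1) i by (auto simp: coeff_pderiv in_frob_def)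
  qed
qed

text \<open>
  By Euler's formula \<open>y F\<^sub>y = n F - x F\<^sub>x\<close>, so the polynomial in the conclusion dehomogenizes the
  derivative \<open>F\<^sub>y\<close> with respect to \<open>y\<close>.
\<close>

lemma in_frob_euler:
  assumes "in_frob n q f" "p dvd q" "n \<ge> 1"
  shows "in_frob (n - 1) q (smult (int n) f - pCons 0 (pderiv f))"
  unfolding in_frob_def
proof (intro allI impI)
  fix i assume i: "i < q" "n - 1 < i + q"
  have eq: "coeff (smult (int n) f - pCons 0 (pderiv f)) i = (int n - int i) * coeff f i"
    by (cases i) (auto simp: coeff_pderiv algebra_simps)
  show "int p dvd coeff (smult (int n) f - pCons 0 (pderiv f)) i"
  proof (cases "n < i + q")
    case True
    thus ?thesis using assms(1) i unfolding eq by (auto simp: in_frob_def)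
  next
    case False
    hence "int n - int i = int q" using i assms(3) by auto
    thus ?thesis unfolding eq using assms(2) by (simp add: dvd_mult2)
  qed
qed

text \<open>
  A multiple of an element of \<open>\<langle>x\<^sup>q, y\<^sup>q\<rangle>\<close> has no monomial \<open>x\<^sup>q\<^sup>-\<^sup>1 y\<^sup>q\<^sup>-\<^sup>1\<close>; the last
  hypothesis bounds the degree of \<open>a\<close> so that the product has formal degree at most \<open>2 q - 2\<close>.
\<close>

lemma socle_coeff:
  assumes "in_frob M q F" "q \<ge> 1"
    and "\<And>j. \<not> int p dvd coeff a j \<Longrightarrow> M + j + 1 < 2 * q"
  shows "int p dvd coeff (a * F) (q - 1)"
  unfolding coeff_mult
proof (rule dvd_sum)
  fix j assume "j \<in> {..q - 1}"
  show "int p dvd coeff a j * coeff F (q - 1 - j)"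
  proof (cases "int p dvd coeff a j")
    case False
    from assms(3)[OF this] \<open>j \<in> _\<close> assms(2)
    have "q - 1 - j < q" "M < q - 1 - j + q" by auto
    thus ?thesis using assms(1) by (simp add: in_frob_def)
  qed simp
qed

text \<open>
  If \<open>h g\<close>, \<open>h u\<close> and \<open>h v\<close> lie in \<open>\<langle>x\<^sup>q, y\<^sup>q\<rangle>\<close> and \<open>g\<close>, \<open>u\<close>, \<open>v\<close> have no common zero on the
  projective line, then \<open>h\<close> lies in this ideal as well, provided that its degree is not too close to
  \<open>2 q\<close>.  Otherwise multiply \<open>h\<close> by the monomial that moves an offending term of \<open>h\<close> to the socle
  monomial \<open>x\<^sup>q\<^sup>-\<^sup>1 y\<^sup>q\<^sup>-\<^sup>1\<close>.  Dividing it by \<open>v\<close>, which does not vanish at infinity, and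
  writing the remainder through \<open>g\<close> and \<open>u\<close> shows that this product lies in the ideal.
\<close>

lemma in_frob_colon:
  assumes g: "\<And>i. i > D \<Longrightarrow> coeff g i = 0" "\<not> int p dvd coeff g D"
    and u: "\<And>i. i \<ge> D \<Longrightarrow> coeff u i = 0"
    and v: "\<And>i. i > D \<Longrightarrow> coeff v i = 0" "\<not> int p dvd coeff v D"
    and com: "comaximal g u"
    and hg: "in_frob n q (h * g)" and hu: "in_frob n q (h * u)" and hv: "in_frob (N + D) q (h * v)"
    and nD: "n + D + 1 \<le> 2 * q"
  shows "in_frob N q h"
  unfolding in_frob_def
proof (intro allI impI)
  fix i assume i: "i < q" "N < i + q"
  \<comment> \<open>Multiplication by \<open>x\<^sup>e\<close> moves the coefficient \<open>i\<close> of \<open>h\<close> to the position \<open>q - 1\<close>.\<close>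
  define e where "e = q - 1 - i"
  have "\<And>j. j \<ge> Suc e \<Longrightarrow> coeff (monom 1 e :: int poly) j = 0" by auto
  from division_mod_p[OF v this] obtain a r where
    ar: "monom 1 e \<simeq> a * v + r" "\<forall>i\<ge>D. coeff r i = 0" "\<forall>i. i + D \<ge> Suc e \<longrightarrow> coeff a i = 0" by blast
  from comaximal_bezout[OF g u com] ar(2) obtain b c where
    bc: "r \<simeq> b * g + c * u" "\<forall>i\<ge>D. int p dvd coeff b i" "\<forall>i\<ge>D. coeff c i = 0" by metis
  have "monom 1 e \<simeq> a * v + (b * g + c * u)"
    by (rule pcong_trans[OF ar(1)], rule pcong_add[OF pcong_refl bc(1)])
  hence "monom 1 e * h \<simeq> (a * v + (b * g + c * u)) * h" by (rule pcong_mult_right)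
  hence dvd_iff: "int p dvd coeff (monom 1 e * h) (q - 1) \<longleftrightarrow>
      int p dvd coeff ((a * v + (b * g + c * u)) * h) (q - 1)"
    by (rule pcong_coeff)
  have "coeff ((a * v + (b * g + c * u)) * h) (q - 1) =
      coeff (a * (h * v)) (q - 1) + coeff (b * (h * g)) (q - 1) + coeff (c * (h * u)) (q - 1)"
    by (simp flip: coeff_add add: algebra_simps)
  moreover have "int p dvd coeff (a * (h * v)) (q - 1)"
  proof (rule socle_coeff[OF hv])
    fix j assume "\<not> int p dvd coeff a j"
    hence "j + D < Suc e" using ar(3) by (metis dvd_0_right not_le)
    thus "N + D + j + 1 < 2 * q" using i by (auto simp: e_def)
  qed (use i in auto)
  moreover have "int p dvd coeff (b * (h * g)) (q - 1)"
  proof (rule socle_coeff[OF hg])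
    fix j assume "\<not> int p dvd coeff b j"
    hence "j < D" using bc(2) by (metis not_le)
    thus "n + j + 1 < 2 * q" using nD by auto
  qed (use i in auto)
  moreover have "int p dvd coeff (c * (h * u)) (q - 1)"
  proof (rule socle_coeff[OF hu])
    fix j assume "\<not> int p dvd coeff c j"
    hence "j < D" using bc(3) by (metis dvd_0_right not_le)
    thus "n + j + 1 < 2 * q" using nD by auto
  qed (use i in auto)
  ultimately have "int p dvd coeff (monom 1 e * h) (q - 1)"
    unfolding dvd_iff by simp
  moreover have "q - 1 - e = i" "\<not> q - 1 < e" using i by (auto simp: e_def)
  ultimately show "int p dvd coeff h i" by (simp add: coeff_monom_mult)
qed

text \<open>
  Modulo \<open>p\<close> the power \<open>f\<^sup>p\<close> is \<open>f(x\<^sup>p)\<close>: the \<open>p\<close>-th power is additive by the divisibility of the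
  binomial coefficients, and fixes the integers by Fermat's theorem.
\<close>

lemma power_p_cong:
  "int p dvd coeff (f ^ p) k - (if p dvd k then coeff f (k div p) else 0)"
proof (induction f arbitrary: k)
  case 0
  have "p > 0" using prime_p prime_gt_0_nat by blast
  thus ?case by (simp add: power_0_left)
next
  case (pCons a f)
  have p0: "p > 0" using prime_p prime_gt_0_nat by blast
  have binom: "(x + y) ^ p \<simeq> x ^ p + y ^ p" for x y :: "int poly"
  proof -
    have "(x + y) ^ p = (\<Sum>k\<le>p. of_nat (p choose k) * x ^ k * y ^ (p - k))"
      by (rule binomial_ring)
    also have "{..p} = insert 0 (insert p {1..<p})" using p0 by auto
    also have "(\<Sum>k\<in>\<dots>. of_nat (p choose k) * x ^ k * y ^ (p - k)) =
       y ^ p + (x ^ p + (\<Sum>k\<in>{1..<p}. of_nat (p choose k) * x ^ k * y ^ (p - k)))"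
      using p0 by (subst sum.insert, simp, simp, subst sum.insert) auto
    also have "\<dots> - (x ^ p + y ^ p) = (\<Sum>k\<in>{1..<p}. of_nat (p choose k) * x ^ k * y ^ (p - k))"
      by simp
    finally have eq: "(x + y) ^ p - (x ^ p + y ^ p) =
      (\<Sum>k\<in>{1..<p}. of_nat (p choose k) * x ^ k * y ^ (p - k))" .
    show ?thesis unfolding pcong_def eq
    proof (intro dvd_sum dvd_mult2)
      fix k assume "k \<in> {1..<p}"
      hence "p dvd p choose k" using prime_p by (intro dvd_choose_prime) auto
      then obtain m where "p choose k = p * m" ..
      hence "of_nat (p choose k) = [:int p:] * of_nat m" by (simp add: of_nat_poly)
      thus "[:int p:] dvd of_nat (p choose k)" by (metis dvd_triv_left)
    qed
  qed
  have ferm: "int p dvd a ^ p - a"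
  proof (cases "int p dvd a")
    case True
    moreover have "a dvd a ^ p" using p0 by (simp add: dvd_power)
    ultimately show ?thesis by (meson dvd_diff dvd_trans)
  next
    case False
    define m where "m = nat (a mod int p)"
    have m: "[a = int m] (mod int p)" using p0 by (simp add: m_def cong_def)
    have "\<not> p dvd m" using False m by (metis cong_dvd_iff cong_sym int_dvd_int_iff)
    hence "[m ^ (p - 1) = 1] (mod p)" using fermat_theorem prime_p by blast
    hence "[m * m ^ (p - 1) = m * 1] (mod p)" by (rule cong_scalar_left)
    hence "[m ^ p = m] (mod p)" using p0 by (simp flip: power_Suc)
    hence "[int m ^ p = int m] (mod int p)" by (metis cong_int_iff of_nat_power)
    hence "[a ^ p = a] (mod int p)" using m by (meson cong_pow cong_sym cong_trans)
    thus ?thesis by (simp add: cong_iff_dvd_diff)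
  qed
  have "pCons a f = [:a:] + monom 1 1 * f" by (simp add: monom_altdef)
  hence "(pCons a f) ^ p \<simeq> [:a:] ^ p + (monom 1 1 * f) ^ p" using binom by simp
  also have "[:a:] ^ p + (monom 1 1 * f) ^ p = [:a ^ p:] + monom 1 p * f ^ p"
    by (simp add: poly_const_pow power_mult_distrib monom_power)
  finally have c: "int p dvd coeff (pCons a f ^ p) k - coeff ([:a ^ p:] + monom 1 p * f ^ p) k"
    by (simp add: pcong_iff)
  have "int p dvd coeff ([:a ^ p:] + monom 1 p * f ^ p) k -
     (if p dvd k then coeff (pCons a f) (k div p) else 0)"
  proof (cases "k = 0")
    case True
    thus ?thesis using ferm p0 by (simp add: coeff_monom_mult)
  next
    case k0: False
    show ?thesis
    proof (cases "k < p")
      case True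
      hence "\<not> p dvd k" using k0 by (auto dest: dvd_imp_le)
      thus ?thesis using True k0 by (auto simp: coeff_monom_mult coeff_pCons split: nat.splits)
    next
      case False
      have "k div p = Suc ((k - p) div p)" using False p0 by (simp add: le_div_geq)
      moreover have "p dvd k \<longleftrightarrow> p dvd k - p" using False by (simp add: dvd_minus_self)
      ultimately show ?thesis using False k0 pCons.IH[of "k - p"]
        by (auto simp: coeff_monom_mult coeff_pCons split: nat.splits)
    qed
  qed
  from dvd_add[OF c this] show ?case by simp
qed

lemma in_frobD: "in_frob n q f \<Longrightarrow> i < q \<Longrightarrow> n < i + q \<Longrightarrow> int p dvd coeff f i"
  by (simp add: in_frob_def)

text \<open>
  Frobenius is flat: \<open>F\<^sup>p \<in> \<langle>x\<^sup>p\<^sup>q, y\<^sup>p\<^sup>q\<rangle>\<close> if and only if \<open>F \<in> \<langle>x\<^sup>q, y\<^sup>q\<rangle>\<close>.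
\<close>

lemma in_frob_power_p: "in_frob (p * n) (p * q) (f ^ p) \<longleftrightarrow> in_frob n q f"
proof -
  have p0: "p > 0" using prime_p prime_gt_0_nat by blast
  have at_multiple: "int p dvd coeff (f ^ p) (p * i) \<longleftrightarrow> int p dvd coeff f i" for i
    using dvd_diff_cong[OF power_p_cong[of f "p * i"]]
    unfolding nonzero_mult_div_cancel_left[OF p0[THEN gr_implies_not0]] by (simp only: dvd_triv_left if_True)
  have elsewhere: "int p dvd coeff (f ^ p) k" if "\<not> p dvd k" for k
    using dvd_diff_cong[OF power_p_cong[of f k]] that by (simp only: if_False dvd_0_right)
  have range: "p * i < p * q \<and> p * n < p * i + p * q \<longleftrightarrow> i < q \<and> n < i + q" for i
    using p0 mult_less_cancel1[of p n "i + q"] by (simp only: distrib_left mult_less_cancel1) blast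
  show ?thesis
  proof
    assume *: "in_frob (p * n) (p * q) (f ^ p)"
    show "in_frob n q f"
      unfolding in_frob_def
    proof (intro allI impI)
      fix i assume "i < q" "n < i + q"
      with range[of i] have "p * i < p * q" "p * n < p * i + p * q" by blast+
      from in_frobD[OF * this] show "int p dvd coeff f i" by (simp only: at_multiple)
    qed
  next
    assume *: "in_frob n q f"
    show "in_frob (p * n) (p * q) (f ^ p)"
      unfolding in_frob_def
    proof (intro allI impI)
      fix k assume k: "k < p * q" "p * n < k + p * q"
      show "int p dvd coeff (f ^ p) k"
      proof (cases "p dvd k")
        case True
        then obtain i where i: "k = p * i" ..
        with k range[of i] have "i < q" "n < i + q" by blast+
        from in_frobD[OF * this] show ?thesis by (simp only: at_multiple i)
      qed (rule elsewhere)
    qed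
  qed
qed

end

section \<open>Products of coprime forms\<close>

lemma coeff_mult_beyond:
  fixes f g :: "'a::comm_semiring_0 poly"
  assumes "\<And>i. i > a \<Longrightarrow> coeff f i = 0" "\<And>i. i \<ge> b \<Longrightarrow> coeff g i = 0" "i \<ge> a + b"
  shows "coeff (f * g) i = 0"
  unfolding coeff_mult
proof (rule sum.neutral, rule ballI)
  fix j assume "j \<in> {..i}"
  with assms(3) have "j > a \<or> i - j \<ge> b" by auto
  thus "coeff f j * coeff g (i - j) = 0" using assms(1,2) by auto
qed

text \<open>
  A polynomial \<open>P\<close> in \<open>Ps\<close> stands for the form obtained by homogenizing it in its own degree.
\<close>

locale forms_mod_p = prime_modulus +
  fixes Ps :: "int poly set"
  assumes finite_Ps: "finite Ps"
    and lead_Ps: "P \<in> Ps \<Longrightarrow> \<not> int p dvd lead_coeff P"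
    and squarefree_Ps: "P \<in> Ps \<Longrightarrow> comaximal P (pderiv P)"
    and comaximal_Ps: "P \<in> Ps \<Longrightarrow> Q \<in> Ps \<Longrightarrow> P \<noteq> Q \<Longrightarrow> comaximal P Q"
    and degree_Ps: "P \<in> Ps \<Longrightarrow> degree P \<ge> 1"
begin

text \<open>
  The index \<open>None\<close> stands for the form \<open>y\<close>, which dehomogenizes to \<open>1\<close> and is therefore visible only
  in the formal degree \<open>form_degree\<close> of a product, not in \<open>form_prod\<close>.
\<close>

definition factors :: "int poly option set" where
  "factors = insert None (Some ` Ps)"

definition form_prod :: "(int poly option \<Rightarrow> nat) \<Rightarrow> int poly" where
  "form_prod b = (\<Prod>P\<in>Ps. P ^ b (Some P))"

definition form_degree :: "(int poly option \<Rightarrow> nat) \<Rightarrow> nat" where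
  "form_degree b = b None + (\<Sum>P\<in>Ps. b (Some P) * degree P)"

text \<open>
  The degree of the product of all the forms involved, including \<open>y\<close>.
\<close>

definition total_degree :: nat where
  "total_degree = Suc (\<Sum>P\<in>Ps. degree P)"

definition exps_in_frob :: "nat \<Rightarrow> (int poly option \<Rightarrow> nat) \<Rightarrow> bool" where
  "exps_in_frob q b \<longleftrightarrow> in_frob (form_degree b) q (form_prod b)"

definition lower_exp :: "nat \<Rightarrow> nat" where
  "lower_exp n = (if p dvd n then n else n - 1)"

lemma p_gt_1: "p > 1" using prime_p prime_gt_1_nat by blast

lemma prod_lower_exp:
  assumes "finite S"
  shows "(\<Prod>P\<in>S. P ^ c P) = (\<Prod>P\<in>S. P ^ lower_exp (c P)) * (\<Prod>P\<in>{P\<in>S. \<not> p dvd c P}. P :: int poly)"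
proof -
  have "P ^ c P = P ^ lower_exp (c P) * (if \<not> p dvd c P then P else 1)" for P
    using dvd_0_right[of p] by (cases "c P") (auto simp: lower_exp_def)
  thus ?thesis using assms by (simp add: prod.inter_filter prod.distrib[symmetric] cong: prod.cong)
qed

lemma prod_Ps_nonzero:
  assumes "S \<subseteq> Ps" shows "(\<Prod>P\<in>S. P ^ c P) \<noteq> 0" "(\<Prod>P\<in>S. P) \<noteq> 0"
proof -
  have "finite S" using assms finite_Ps finite_subset by blast
  moreover have "P \<noteq> 0" if "P \<in> S" for P using lead_Ps[of P] that assms by auto
  ultimately show "(\<Prod>P\<in>S. P ^ c P) \<noteq> 0" "(\<Prod>P\<in>S. P) \<noteq> 0" by auto
qed

lemma prod_Ps_lead:
  assumes "S \<subseteq> Ps" shows "\<not> int p dvd lead_coeff (\<Prod>P\<in>S. P ^ c P)"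
proof -
  have "finite S" using assms finite_Ps finite_subset by blast
  thus ?thesis using assms
  proof induction
    case empty
    thus ?case using p_gt_1 by simp
  next
    case (insert P S)
    have "\<not> int p dvd lead_coeff P ^ c P"
      using lead_Ps[of P] insert.prems prime_p prime_dvd_power[of "int p"] by auto
    thus ?case using insert by (simp add: lead_coeff_mult lead_coeff_power prime_dvd_mult_int)
  qed
qed

text \<open>
  Let \<open>F\<close> be the product with exponents \<open>c\<close> and let \<open>h\<close> be that with the lowered exponents, so that
  \<open>F = h g\<close> with \<open>g\<close> the product of the forms whose exponent is prime to \<open>p\<close>.  Then \<open>F' = h u\<close> for the
  numerator \<open>u\<close> of the logarithmic derivative, and \<open>g\<close>, \<open>u\<close> have no common zero because the factors of
  \<open>g\<close> are squarefree and pairwise coprime, and occur in \<open>F\<close> with exponents that are units modulo \<open>p\<close>.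
\<close>

lemma logarithmic_derivative:
  assumes "S \<subseteq> Ps"
  shows "\<exists>u. pderiv (\<Prod>P\<in>S. P ^ c P) \<simeq> (\<Prod>P\<in>S. P ^ lower_exp (c P)) * u \<and>
    comaximal (\<Prod>P\<in>{P\<in>S. \<not> p dvd c P}. P) u \<and>
    (\<forall>i\<ge>degree (\<Prod>P\<in>{P\<in>S. \<not> p dvd c P}. P). coeff u i = 0)"
proof -
  have "finite S" using assms finite_Ps finite_subset by blast
  thus ?thesis using assms
  proof induction
    case empty
    show ?case by (rule exI[of _ 0]) (simp add: pcong_def)
  next
    case (insert P S)
    let ?F = "\<Prod>P\<in>S. P ^ c P" and ?H = "\<Prod>P\<in>S. P ^ lower_exp (c P)"
      and ?g = "\<Prod>P\<in>{P\<in>S. \<not> p dvd c P}. P" and ?n = "c P"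
    from insert obtain u where u: "pderiv ?F \<simeq> ?H * u" "comaximal ?g u" "\<And>i. i \<ge> degree ?g \<Longrightarrow> coeff u i = 0"
      by auto
    have PS: "P \<in> Ps" "S \<subseteq> Ps" "P \<notin> S" using insert by auto
    have prodP: "(\<Prod>P\<in>insert P S. P ^ c P) = P ^ ?n * ?F"
      "(\<Prod>P\<in>insert P S. P ^ lower_exp (c P)) = P ^ lower_exp ?n * ?H"
      using insert by simp_all
    have deriv: "pderiv (P ^ ?n * ?F) = P ^ ?n * pderiv ?F + ?F * smult (of_nat ?n) (P ^ (?n - 1) * pderiv P)"
      by (simp add: pderiv_mult pderiv_power)
    show ?case
    proof (cases "p dvd ?n")
      case True
      have "smult (of_nat ?n) (P ^ (?n - 1) * pderiv P) \<simeq> 0"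
        unfolding pcong_iff using True by (auto simp: int_dvd_int_iff intro: dvd_mult2)
      hence "P ^ ?n * pderiv ?F + ?F * smult (of_nat ?n) (P ^ (?n - 1) * pderiv P) \<simeq>
         P ^ ?n * (?H * u) + ?F * 0"
        by (intro pcong_add pcong_mult_left u(1))
      hence "pderiv (P ^ ?n * ?F) \<simeq> P ^ lower_exp ?n * ?H * u" unfolding deriv using True
        by (simp add: lower_exp_def mult.assoc)
      moreover have "{Q \<in> insert P S. \<not> p dvd c Q} = {Q \<in> S. \<not> p dvd c Q}" using True by auto
      ultimately show ?thesis unfolding prodP using u by auto
    next
      case False
      hence n: "?n \<noteq> 0" by (metis dvd_0_right)
      have set: "{Q \<in> insert P S. \<not> p dvd c Q} = insert P {Q \<in> S. \<not> p dvd c Q}" using False by auto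
      have g': "(\<Prod>P\<in>{Q \<in> insert P S. \<not> p dvd c Q}. P) = P * ?g"
        unfolding set using insert by (subst prod.insert) auto
      define u' where "u' = ?g * smult (of_nat ?n) (pderiv P) + P * u"
      have "P ^ ?n * pderiv ?F + ?F * smult (of_nat ?n) (P ^ (?n - 1) * pderiv P) \<simeq>
         P ^ ?n * (?H * u) + ?F * smult (of_nat ?n) (P ^ (?n - 1) * pderiv P)"
        by (intro pcong_add pcong_mult_left u(1)) simp
      also have "P ^ ?n * (?H * u) + ?F * smult (of_nat ?n) (P ^ (?n - 1) * pderiv P) = P ^ lower_exp ?n * ?H * u'"
      proof -
        have "P ^ ?n = P ^ (?n - 1) * P" using n by (cases "?n") auto
        moreover have "?F = ?H * ?g" by (rule prod_lower_exp) fact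
        ultimately show ?thesis using False by (simp add: u'_def lower_exp_def algebra_simps)
      qed
      finally have D: "pderiv (P ^ ?n * ?F) \<simeq> P ^ lower_exp ?n * ?H * u'"
        unfolding deriv .
      have Pg: "comaximal ?g P"
        by (rule comaximal_prod) (use PS comaximal_Ps in auto)
      have "\<not> int p dvd of_nat ?n" using False by simp
      with comaximal_sym[OF squarefree_Ps[OF PS(1)]]
      have "comaximal (smult (of_nat ?n) (pderiv P)) P"
        by (rule comaximal_smult)
      with Pg have "comaximal (?g * smult (of_nat ?n) (pderiv P)) P"
        by (rule comaximal_mult)
      hence "comaximal P (?g * smult (of_nat ?n) (pderiv P))" by (rule comaximal_sym)
      from comaximal_add_multiple[OF this, of u] have 1: "comaximal P u'"
        unfolding u'_def by (subst add.commute)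
      have "comaximal ?g (P * u)"
        by (rule comaximal_sym, rule comaximal_mult) (use Pg u(2) in \<open>auto intro: comaximal_sym\<close>)
      from comaximal_add_multiple[OF this] have 2: "comaximal ?g u'"
        unfolding u'_def .
      have gnz: "?g \<noteq> 0" by (rule prod_Ps_nonzero(2)) (use PS in auto)
      have Pnz: "P \<noteq> 0" using lead_Ps[OF PS(1)] by auto
      have "coeff u' i = 0" if i: "i \<ge> degree P + degree ?g" for i
      proof -
        have "coeff (?g * smult (of_nat ?n) (pderiv P)) i = 0"
        proof (rule coeff_mult_beyond[of "degree ?g" _ "degree P"])
          fix j assume "degree P \<le> j"
          thus "coeff (smult (of_nat ?n) (pderiv P)) j = 0" by (simp add: coeff_pderiv coeff_eq_0)
        qed (use i in \<open>auto simp: coeff_eq_0\<close>)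
        moreover have "coeff (P * u) i = 0"
          by (rule coeff_mult_beyond[of "degree P", OF _ u(3)]) (use i in \<open>auto simp: coeff_eq_0\<close>)
        ultimately show ?thesis by (simp add: u'_def)
      qed
      with D comaximal_mult[OF 1 2] show ?thesis
        unfolding prodP g' degree_mult_eq[OF Pnz gnz] by blast
    qed
  qed
qed

lemma degree_prod_Ps:
  assumes "S \<subseteq> Ps" shows "degree (\<Prod>P\<in>S. P ^ c P) = (\<Sum>P\<in>S. c P * degree P)"
proof -
  have "finite S" using assms finite_Ps finite_subset by blast
  thus ?thesis using assms
  proof induction
    case (insert P S)
    have P: "P \<noteq> 0" using lead_Ps[of P] insert by auto
    have "degree (\<Prod>P\<in>insert P S. P ^ c P) = degree (P ^ c P * (\<Prod>P\<in>S. P ^ c P))"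
      using insert by simp
    also have "\<dots> = c P * degree P + degree (\<Prod>P\<in>S. P ^ c P)"
      using P insert prod_Ps_nonzero(1)[of S c] by (subst degree_mult_eq) (auto simp: degree_power_eq)
    finally show ?case using insert by simp
  qed simp
qed

text \<open>
  This applies \<open>in_frob_colon\<close> to the cofactors \<open>g\<close>, \<open>u\<close> of \<open>F\<close> and \<open>F\<^sub>x\<close>.  They have no common zero
  in the affine chart.  The point at infinity is a zero of \<open>F\<close> of order \<open>b None\<close>.  If \<open>p\<close> divides this
  number, the form \<open>y\<close> is not lowered and \<open>g\<close> does not vanish at infinity.  Otherwise the cofactor
  \<open>v\<close> of \<open>F\<^sub>y\<close> does not vanish there.
\<close>

lemma exps_in_frob_lower:
  assumes q: "p dvd q" and b: "exps_in_frob q b" and bound: "form_degree b + total_degree \<le> 2 * q"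
  shows "exps_in_frob q (\<lambda>i. lower_exp (b i))"
proof -
  define f h where "f = form_prod b" and "h = form_prod (\<lambda>i. lower_exp (b i))"
  define T where "T = {P \<in> Ps. \<not> p dvd b (Some P)}"
  define g where "g = (\<Prod>P\<in>T. P)"
  define D where "D = degree g"
  define n where "n = form_degree b"
  have T: "T \<subseteq> Ps" by (auto simp: T_def)
  have f: "f = h * g"
    unfolding f_def h_def form_prod_def g_def T_def using finite_Ps by (rule prod_lower_exp)
  obtain u where u: "pderiv f \<simeq> h * u" "comaximal g u" "\<And>i. i \<ge> D \<Longrightarrow> coeff u i = 0"
    using logarithmic_derivative[OF order_refl, of "\<lambda>P. b (Some P)"]
    unfolding f_def h_def form_prod_def g_def T_def D_def by blast
  have lead_g: "\<not> int p dvd coeff g D"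
    using prod_Ps_lead[OF T, of "\<lambda>_. 1"] by (simp add: g_def D_def)
  have lead_h: "\<not> int p dvd lead_coeff h" unfolding h_def form_prod_def by (rule prod_Ps_lead) simp
  have nz: "h \<noteq> 0" "g \<noteq> 0" using lead_h lead_g by auto
  have deg_f: "degree f = degree h + D" using nz by (simp add: f D_def degree_mult_eq)
  have n: "n = b None + degree f"
    by (simp add: n_def form_degree_def f_def form_prod_def degree_prod_Ps)
  have N: "form_degree (\<lambda>i. lower_exp (b i)) = lower_exp (b None) + degree h"
    by (simp add: form_degree_def h_def form_prod_def degree_prod_Ps)
  have D_le: "D \<le> (\<Sum>P\<in>Ps. degree P)"
    using degree_prod_Ps[OF T, of "\<lambda>_. 1"] sum_mono2[OF finite_Ps T, of degree]
    by (simp add: g_def D_def)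
  hence nD: "n + D + 1 \<le> 2 * q" using bound by (simp add: n_def total_degree_def)
  have fI: "in_frob n q f" using b by (simp add: exps_in_frob_def n_def f_def)
  have hg: "in_frob n q (h * g)" using fI by (simp add: f)
  have hu: "in_frob n q (h * u)" using in_frob_pderiv[OF fI q] u(1) in_frob_cong by blast
  have gD: "\<And>i. i > D \<Longrightarrow> coeff g i = 0" by (simp add: D_def coeff_eq_0)
  show ?thesis
  proof (cases "p dvd b None")
    case True
    hence N_eq: "form_degree (\<lambda>i. lower_exp (b i)) + D = n"
      unfolding N n deg_f by (simp add: lower_exp_def)
    show ?thesis unfolding exps_in_frob_def h_def[symmetric]
      by (rule in_frob_colon[OF gD lead_g u(3) gD lead_g u(2) hg hu _ nD]) (use N_eq hg in simp_all)
  next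
    case False
    hence b0: "b None \<noteq> 0" by (metis dvd_0_right)
    hence N_eq: "form_degree (\<lambda>i. lower_exp (b i)) + D = n - 1"
      unfolding N n deg_f using False by (simp add: lower_exp_def)
    define v where "v = smult (int n) g - pCons 0 u"
    have vD: "coeff v i = 0" if "i > D" for i
      using that gD u(3)[of "i - 1"] by (cases i) (auto simp: v_def)
    have fv: "smult (int n) f - pCons 0 (pderiv f) \<simeq> h * v"
    proof -
      have "smult (int n) f - [:0, 1:] * pderiv f \<simeq> smult (int n) f - [:0, 1:] * (h * u)"
        by (intro pcong_diff pcong_mult_left u(1)) simp
      thus ?thesis by (simp add: v_def f algebra_simps)
    qed
    have hv: "in_frob (form_degree (\<lambda>i. lower_exp (b i)) + D) q (h * v)"
      unfolding N_eq using in_frob_euler[OF fI q] b0 n in_frob_cong[OF fv] by simp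
    \<comment> \<open>Up to units, the leading coefficient of \<open>h v = n f - x f'\<close> is \<open>n - degree f = b None\<close>.\<close>
    have "\<not> int p dvd coeff v D"
    proof
      assume "int p dvd coeff v D"
      hence "int p dvd lead_coeff h * coeff v D" by simp
      moreover have "int p dvd coeff (h * v) (degree h + D) - lead_coeff h * coeff v D"
        by (rule coeff_mult_top) (use vD in \<open>auto simp: coeff_eq_0\<close>)
      ultimately have "int p dvd coeff (h * v) (degree h + D)"
        by (simp only: dvd_diff_cong)
      hence "int p dvd coeff (smult (int n) f - pCons 0 (pderiv f)) (degree f)"
        by (simp only: pcong_coeff[OF fv] deg_f)
      moreover have "coeff (smult (int n) f - pCons 0 (pderiv f)) (degree f) = (int n - int (degree f)) * lead_coeff f"
        by (cases "degree f") (auto simp: coeff_pderiv algebra_simps)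
      ultimately have "int p dvd int (b None) * (lead_coeff h * lead_coeff g)"
        by (simp add: n f lead_coeff_mult)
      thus False using False lead_h lead_g by (simp add: prime_dvd_mult_int D_def)
    qed
    from in_frob_colon[OF gD lead_g u(3) vD this u(2) hg hu hv nD]
    show ?thesis unfolding exps_in_frob_def h_def .
  qed
qed

lemma form_prod_add: "form_prod (\<lambda>i. b i + c i) = form_prod b * form_prod c"
  by (simp add: form_prod_def power_add prod.distrib)

lemma form_degree_add: "form_degree (\<lambda>i. b i + c i) = form_degree b + form_degree c"
  by (simp add: form_degree_def algebra_simps sum.distrib)

lemma form_degree_scale: "form_degree (\<lambda>i. k * b i) = k * form_degree b"
  by (simp add: form_degree_def algebra_simps sum_distrib_left)

lemma form_degree_mono: "(\<And>i. i \<in> factors \<Longrightarrow> b i \<le> c i) \<Longrightarrow> form_degree b \<le> form_degree c"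
  unfolding form_degree_def by (intro add_mono sum_mono mult_right_mono) (auto simp: factors_def)

lemma degree_form_prod_le: "degree (form_prod b) \<le> form_degree b"
  by (simp add: form_degree_def form_prod_def degree_prod_Ps)

lemma exps_in_frob_mono:
  assumes "exps_in_frob q b" "\<And>i. i \<in> factors \<Longrightarrow> b i \<le> c i" shows "exps_in_frob q c"
proof -
  have eq: "b i + (c i - b i) = c i" if "i \<in> factors" for i using assms(2)[OF that] by simp
  have "form_prod c = form_prod b * form_prod (\<lambda>i. c i - b i)" "form_degree c = form_degree b + form_degree (\<lambda>i. c i - b i)"
    unfolding form_prod_add[symmetric] form_degree_add[symmetric]
    by (auto simp: form_prod_def form_degree_def eq factors_def intro!: prod.cong sum.cong)
  thus ?thesis using in_frob_mult[OF _ degree_form_prod_le] assms(1) by (simp add: exps_in_frob_def)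
qed

lemma exps_in_frob_p: "exps_in_frob (p * q) (\<lambda>i. p * b i) \<longleftrightarrow> exps_in_frob q b"
proof -
  have "form_prod (\<lambda>i. p * b i) = form_prod b ^ p"
    by (simp add: form_prod_def prod_power_distrib mult.commute[of p] power_mult)
  thus ?thesis by (simp add: exps_in_frob_def form_degree_scale in_frob_power_p)
qed

lemma exps_in_frob_p_power: "exps_in_frob (p ^ k * q) (\<lambda>i. p ^ k * b i) \<longleftrightarrow> exps_in_frob q b"
  by (induction k) (simp_all add: mult.assoc exps_in_frob_p)

lemma exps_in_frob_round_down:
  assumes q: "p dvd q" and b: "exps_in_frob q b" and bound: "form_degree b + total_degree \<le> 2 * q"
  shows "exps_in_frob q (\<lambda>i. p * (b i div p))"
proof -
  \<comment> \<open>After \<open>k\<close> steps an exponent has dropped by \<open>k\<close>, unless it met a multiple of \<open>p\<close> before.\<close>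
  have "exps_in_frob q (\<lambda>i. b i - min k (b i mod p))" for k
  proof (induction k)
    case (Suc k)
    have "form_degree (\<lambda>i. b i - min k (b i mod p)) \<le> form_degree b" by (rule form_degree_mono) simp
    hence "form_degree (\<lambda>i. b i - min k (b i mod p)) + total_degree \<le> 2 * q" using bound by simp
    from exps_in_frob_lower[OF q Suc this]
    have "exps_in_frob q (\<lambda>i. lower_exp (b i - min k (b i mod p)))" .
    moreover have "lower_exp (n - min k (n mod p)) = n - min (Suc k) (n mod p)" for n
    proof (cases "n mod p \<le> k")
      case True
      thus ?thesis by (simp add: lower_exp_def min_absorb2 minus_mod_eq_mult_div)
    next
      case False
      have "n - k = p * (n div p) + (n mod p - k)"
        using False mult_div_mod_eq[of p n] by linarith
      moreover have "\<not> p dvd p * (n div p) + (n mod p - k)"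
      proof -
        have "0 < n mod p - k" "n mod p - k < p"
          using False p_gt_1 mod_less_divisor[of p n] by linarith+
        thus ?thesis by (metis dvd_add_right_iff dvd_triv_left nat_dvd_not_less)
      qed
      ultimately show ?thesis using False by (simp add: lower_exp_def)
    qed
    ultimately show ?case by simp
  qed (use b in simp)
  moreover have "n - min p (n mod p) = p * (n div p)" for n
  proof -
    have "min p (n mod p) = n mod p" using p_gt_1 mod_less_divisor[of p n] by linarith
    thus ?thesis by (simp add: minus_mod_eq_mult_div)
  qed
  ultimately have "exps_in_frob q (\<lambda>i. b i - min p (b i mod p))" "\<And>n. n - min p (n mod p) = p * (n div p)"
    by blast+
  thus ?thesis by (simp only:)
qed

text \<open>
  The hypothesis on the degree is what the last of the \<open>k + 1\<close> descents, which starts on the level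
  \<open>p\<^sup>e\<^sup>+\<^sup>1\<close>, requires; the earlier ones need less.
\<close>

lemma exps_in_frob_descend:
  assumes "exps_in_frob (p ^ (e + Suc k)) b" "form_degree b + total_degree * p ^ k \<le> 2 * p ^ (e + Suc k)"
  shows "exps_in_frob (p ^ e) (\<lambda>i. b i div p ^ Suc k)"
  using assms
proof (induction k arbitrary: b)
  case 0
  have "exps_in_frob (p * p ^ e) (\<lambda>i. p * (b i div p))"
    by (rule exps_in_frob_round_down) (use 0 in \<open>auto simp: mult.commute\<close>)
  thus ?case by (simp add: exps_in_frob_p)
next
  case (Suc k)
  have "total_degree * 1 \<le> total_degree * p ^ Suc k"
    by (rule mult_le_mono2) (use p_gt_1 in \<open>simp del: power_Suc\<close>)
  hence "form_degree b + total_degree \<le> 2 * p ^ (e + Suc (Suc k))" using Suc.prems(2) by linarith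
  hence "form_degree b + total_degree \<le> 2 * (p * p ^ (e + Suc k))" by simp
  moreover have "exps_in_frob (p * p ^ (e + Suc k)) b" using Suc.prems(1) by simp
  ultimately have "exps_in_frob (p * p ^ (e + Suc k)) (\<lambda>i. p * (b i div p))"
    by (intro exps_in_frob_round_down) auto
  hence 1: "exps_in_frob (p ^ (e + Suc k)) (\<lambda>i. b i div p)" by (simp only: exps_in_frob_p)
  have "p * form_degree (\<lambda>i. b i div p) \<le> form_degree b"
    unfolding form_degree_scale[symmetric] by (rule form_degree_mono) simp
  hence "p * (form_degree (\<lambda>i. b i div p) + total_degree * p ^ k) \<le> p * (2 * p ^ (e + Suc k))"
    using Suc.prems(2) by (simp add: algebra_simps)
  hence "form_degree (\<lambda>i. b i div p) + total_degree * p ^ k \<le> 2 * p ^ (e + Suc k)"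
    using p_gt_1 by (simp only: mult_le_cancel1)
  from Suc.IH[OF 1 this] show ?case by (simp add: div_mult2_eq mult.commute)
qed

end

section \<open>The infimum of the membership exponents\<close>

lemma Inf_le_of_fractions:
  fixes X :: "real set"
  assumes p: "p > (1::nat)" and s: "s \<ge> 0" and X: "\<And>x. x \<in> X \<Longrightarrow> x \<ge> 0"
    and ge: "\<And>a e. real a / real (p ^ e) \<ge> s \<Longrightarrow> real a / real (p ^ e) \<in> X"
  shows "Inf X \<le> s"
proof (rule field_le_epsilon)
  fix \<epsilon> :: real assume "\<epsilon> > 0"
  moreover have "1 / real p < 1" using p by simp
  ultimately obtain e where e: "(1 / real p) ^ e < \<epsilon>" using real_arch_pow_inv by blast
  have pe: "real (p ^ e) > 0" using p by simp
  define a where "a = nat \<lceil>s * real (p ^ e)\<rceil>"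
  have a: "real a \<ge> s * real (p ^ e)" "real a \<le> s * real (p ^ e) + 1"
    using s unfolding a_def by (simp_all add: of_nat_nat)
  have "real a / real (p ^ e) \<ge> s" using a(1) pe by (simp add: field_simps)
  hence "real a / real (p ^ e) \<in> X" by (rule ge)
  hence "Inf X \<le> real a / real (p ^ e)" by (rule cInf_lower) (rule bdd_belowI[of _ 0], rule X)
  also have "\<dots> \<le> (s * real (p ^ e) + 1) / real (p ^ e)" using a(2) by (intro divide_right_mono) auto
  also have "\<dots> = s + (1 / real p) ^ e" using p by (simp add: add_divide_distrib power_one_over)
  finally show "Inf X \<le> s + \<epsilon>" using e by simp
qed

context forms_mod_p begin

definition thresholds :: "(int poly option \<Rightarrow> nat) \<Rightarrow> real set" where
  "thresholds m = {real a / real (p ^ e) | a e. exps_in_frob (p ^ e) (\<lambda>i. a * m i)}"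

lemma thresholds_nonneg: "x \<in> thresholds m \<Longrightarrow> x \<ge> 0"
  by (auto simp: thresholds_def)

lemma finite_factors: "finite factors"
  using finite_Ps by (simp add: factors_def)

lemma exps_in_frob_large_degree: "form_degree b \<ge> 2 * q \<Longrightarrow> exps_in_frob q b"
  by (auto simp: exps_in_frob_def in_frob_def)

text \<open>
  A form of positive degree lies in \<open>\<langle>x, y\<rangle>\<close>, hence its \<open>p\<^sup>e\<close>-th power in the Frobenius power.
\<close>

lemma exps_in_frob_single:
  assumes "i \<in> factors" "b i \<ge> p ^ e" shows "exps_in_frob (p ^ e) b"
proof -
  let ?s = "\<lambda>j. if j = i then 1 else 0 :: nat"
  have "form_degree ?s \<ge> 1"
  proof (cases i)
    case (Some P)
    hence P: "P \<in> Ps" using assms(1) by (auto simp: factors_def)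
    have "degree P \<le> (\<Sum>Q\<in>Ps. ?s (Some Q) * degree Q)"
      using member_le_sum[of P Ps "\<lambda>Q. ?s (Some Q) * degree Q"] P finite_Ps Some by simp
    thus ?thesis using degree_Ps[OF P] by (simp add: form_degree_def)
  qed (simp add: form_degree_def)
  hence "exps_in_frob 1 ?s" by (simp add: exps_in_frob_def in_frob_def)
  hence "exps_in_frob (p ^ e * 1) (\<lambda>j. p ^ e * ?s j)" by (simp only: exps_in_frob_p_power)
  thus ?thesis using assms(2) by (auto intro: exps_in_frob_mono)
qed

lemma exps_in_frob_thresholds:
  assumes "exps_in_frob (p ^ e0) b" and "\<And>i. i \<in> factors \<Longrightarrow> b i * p ^ e \<le> a * m i * p ^ e0"
  shows "real a / real (p ^ e) \<in> thresholds m"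
proof -
  have "exps_in_frob (p ^ e * p ^ e0) (\<lambda>i. p ^ e * b i)" using assms(1) by (simp only: exps_in_frob_p_power)
  hence "exps_in_frob (p ^ e * p ^ e0) (\<lambda>i. p ^ e0 * (a * m i))"
    by (rule exps_in_frob_mono) (use assms(2) in \<open>simp add: mult_ac\<close>)
  hence "exps_in_frob (p ^ e0 * p ^ e) (\<lambda>i. p ^ e0 * (a * m i))" by (simp only: mult.commute)
  hence "exps_in_frob (p ^ e) (\<lambda>i. a * m i)" by (simp only: exps_in_frob_p_power)
  thus ?thesis unfolding thresholds_def by blast
qed

lemma Inf_thresholds_le:
  assumes "s \<ge> 0" "exps_in_frob (p ^ e0) b"
    and "\<And>i. i \<in> factors \<Longrightarrow> real (b i) \<le> s * real (m i) * real (p ^ e0)"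
  shows "Inf (thresholds m) \<le> s"
proof (rule Inf_le_of_fractions[OF p_gt_1 assms(1) thresholds_nonneg])
  fix a e assume ae: "s \<le> real a / real (p ^ e)"
  have pe: "real (p ^ e) > 0" using p_gt_1 by simp
  show "real a / real (p ^ e) \<in> thresholds m"
  proof (rule exps_in_frob_thresholds[OF assms(2)])
    fix i assume "i \<in> factors"
    have sp: "s * real (p ^ e) \<le> real a" using ae pe by (simp add: field_simps)
    have "real (b i) * real (p ^ e) \<le> s * real (m i) * real (p ^ e0) * real (p ^ e)"
      using assms(3)[OF \<open>i \<in> factors\<close>] pe by (intro mult_right_mono) auto
    also have "\<dots> = (s * real (p ^ e)) * (real (m i) * real (p ^ e0))" by simp
    also have "\<dots> \<le> real a * (real (m i) * real (p ^ e0))" using sp by (intro mult_right_mono) auto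
    finally have "real (b i * p ^ e) \<le> real (a * m i * p ^ e0)" by (simp only: of_nat_mult mult.assoc)
    thus "b i * p ^ e \<le> a * m i * p ^ e0" by (simp only: of_nat_le_iff)
  qed
qed

lemma Inf_thresholds_le_inverse_degree:
  assumes "form_degree m \<ge> 1" shows "Inf (thresholds m) \<le> 2 / real (form_degree m)"
proof (rule Inf_le_of_fractions[OF p_gt_1 _ thresholds_nonneg])
  fix a e assume "2 / real (form_degree m) \<le> real a / real (p ^ e)"
  moreover have "real (p ^ e) > 0" using p_gt_1 by simp
  ultimately have "2 * real (p ^ e) \<le> real a * real (form_degree m)" using assms by (simp add: field_simps)
  hence "real (2 * p ^ e) \<le> real (a * form_degree m)" by (simp only: of_nat_mult of_nat_numeral)
  hence "2 * p ^ e \<le> a * form_degree m" by (simp only: of_nat_le_iff)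
  hence "exps_in_frob (p ^ e) (\<lambda>i. a * m i)" by (intro exps_in_frob_large_degree) (simp only: form_degree_scale)
  thus "real a / real (p ^ e) \<in> thresholds m" unfolding thresholds_def by blast
qed simp

lemma Inf_thresholds_le_inverse_mult:
  assumes "i \<in> factors" "m i \<ge> 1" shows "Inf (thresholds m) \<le> 1 / real (m i)"
proof (rule Inf_le_of_fractions[OF p_gt_1 _ thresholds_nonneg])
  fix a e assume "1 / real (m i) \<le> real a / real (p ^ e)"
  moreover have "real (p ^ e) > 0" using p_gt_1 by simp
  ultimately have "real (p ^ e) \<le> real (a * m i)" using assms(2) by (simp add: field_simps)
  hence "p ^ e \<le> a * m i" by (simp only: of_nat_le_iff)
  hence "exps_in_frob (p ^ e) (\<lambda>i. a * m i)" using exps_in_frob_single[OF assms(1), of e "\<lambda>i. a * m i"] by simp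
  thus "real a / real (p ^ e) \<in> thresholds m" unfolding thresholds_def by blast
qed simp

text \<open>
  If \<open>G\<^sup>a\<close> lay in the ideal for a smaller \<open>x = a / p\<^sup>e\<close>, all exponents \<open>a m\<^sub>i\<close> would be less than
  \<open>p\<^sup>e\<close>, and descending to the level \<open>q = 1\<close> would round them down to \<open>0\<close>.  But \<open>1\<close> does not lie
  in the maximal ideal.
\<close>

lemma thresholds_lower:
  assumes "x \<in> thresholds m" "form_degree m \<ge> 1"
  shows "(\<exists>i\<in>factors. m i \<ge> 1 \<and> x \<ge> 1 / real (m i)) \<or>
         x \<ge> (2 - real total_degree / real p) / real (form_degree m)"
proof (rule ccontr)
  assume neg: "\<not> ?thesis"
  from assms(1) obtain a e where x: "x = real a / real (p ^ e)" and I: "exps_in_frob (p ^ e) (\<lambda>i. a * m i)"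
    by (auto simp: thresholds_def)
  have pe: "real (p ^ e) > 0" and p0: "real p > 0" using p_gt_1 by simp_all
  have small: "a * m i < p ^ e" if "i \<in> factors" for i
  proof (rule ccontr)
    assume "\<not> a * m i < p ^ e"
    hence ge: "p ^ e \<le> a * m i" by simp
    hence "m i \<noteq> 0" using p_gt_1 by (intro notI) simp
    moreover have "real (p ^ e) \<le> real (a * m i)" using ge by (simp only: of_nat_le_iff)
    ultimately have "1 / real (m i) \<le> x" using pe by (simp add: x field_simps)
    thus False using neg \<open>m i \<noteq> 0\<close> that by force
  qed
  have "exps_in_frob (p ^ 1 * p ^ e) (\<lambda>i. p ^ 1 * (a * m i))" using I by (simp only: exps_in_frob_p_power)
  hence I': "exps_in_frob (p ^ (0 + Suc e)) (\<lambda>i. p * (a * m i))" by simp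
  have "x < (2 - real total_degree / real p) / real (form_degree m)" using neg by auto
  hence "real a * real (form_degree m) < (2 - real total_degree / real p) * real (p ^ e)"
    using pe assms(2) by (simp add: x field_simps)
  hence "real p * (real a * real (form_degree m)) < real p * ((2 - real total_degree / real p) * real (p ^ e))"
    using p0 by simp
  also have "\<dots> = 2 * (real p * real (p ^ e)) - real total_degree * real (p ^ e)"
    using p0 by (simp add: field_simps)
  finally have "real (p * (a * form_degree m) + total_degree * p ^ e) < real (2 * (p * p ^ e))"
    by (simp only: of_nat_mult of_nat_add of_nat_numeral)
  hence "p * (a * form_degree m) + total_degree * p ^ e < 2 * (p * p ^ e)" by (simp only: of_nat_less_iff)
  hence "form_degree (\<lambda>i. p * (a * m i)) + total_degree * p ^ e \<le> 2 * p ^ (0 + Suc e)"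
    by (simp add: form_degree_scale)
  from exps_in_frob_descend[OF I' this]
  have I1: "exps_in_frob 1 (\<lambda>i. p * (a * m i) div p ^ Suc e)" by simp
  have zero: "p * (a * m i) div p ^ Suc e = 0" if "i \<in> factors" for i
    using small[OF that] p_gt_1 by simp
  have "exps_in_frob 1 (\<lambda>i. 0)" by (rule exps_in_frob_mono[OF I1]) (simp only: zero)
  hence "in_frob 0 1 1" by (simp add: exps_in_frob_def form_degree_def form_prod_def)
  from in_frobD[OF this, of 0] show False using p_gt_1 by simp
qed

text \<open>
  Below \<open>\<tau> / d\<close> with \<open>\<tau> < 2\<close>, every membership descends to the same level \<open>p\<^sup>e\<^sup>0\<close>.  An exponent
  vector \<open>b\<close> found there forces the infimum to be at most the maximum of \<open>b\<^sub>i / (m\<^sub>i p\<^sup>e\<^sup>0)\<close>, and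
  this maximum is at most the given element of the set.  As only finitely many such maxima occur, the
  infimum is one of them.
\<close>

lemma Inf_thresholds_rational:
  assumes deg: "form_degree m \<ge> 1" and less: "Inf (thresholds m) < 2 / real (form_degree m)"
    and ne: "thresholds m \<noteq> {}"
  shows "\<exists>i\<in>factors. \<exists>n e. m i \<ge> 1 \<and> Inf (thresholds m) = real n / (real (m i) * real (p ^ e))"
proof -
  define t d where "t = Inf (thresholds m)" and "d = real (form_degree m)"
  have d: "d \<ge> 1" using deg by (simp add: d_def)
  have "2 - d * t > 0" using less d by (simp add: t_def d_def field_simps)
  moreover have total_pos: "real total_degree > 0" by (simp add: total_degree_def del: of_nat_sum)
  ultimately have "(2 - d * t) / real total_degree > 0" by simp
  moreover have "1 / real p < 1" using p_gt_1 by simp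
  ultimately obtain e0 where e0: "(1 / real p) ^ e0 < (2 - d * t) / real total_degree"
    using real_arch_pow_inv by blast
  \<comment> \<open>For slopes below \<open>\<tau>\<close>, \<open>exps_in_frob_descend\<close> reaches \<open>p\<^sup>e\<^sup>0\<close> from all higher levels.\<close>
  define \<tau> where "\<tau> = 2 - real total_degree / real (p ^ e0)"
  have "real total_degree * (1 / real p) ^ e0 < 2 - d * t"
    using e0 total_pos by (simp only: less_divide_eq mult.commute if_True)
  hence "real total_degree / real (p ^ e0) < 2 - d * t" by (simp add: power_one_over)
  hence \<tau>: "t < \<tau> / d" using d by (simp add: \<tau>_def less_divide_eq mult.commute)
  define \<Sigma> where "\<Sigma> = (\<Union>i\<in>factors. (\<lambda>n. real n / (real (m i) * real (p ^ e0))) ` {..2 * p ^ e0 * m i})"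
  define \<Sigma>' where "\<Sigma>' = {s\<in>\<Sigma>. t \<le> s \<and> (\<exists>i\<in>factors. \<exists>n. m i \<ge> 1 \<and> s = real n / (real (m i) * real (p ^ e0)))}"
  have fin: "finite \<Sigma>'" using finite_factors by (simp add: \<Sigma>'_def \<Sigma>_def)
  have key: "\<exists>s\<in>\<Sigma>'. s \<le> x" if x: "x \<in> thresholds m" "x < \<tau> / d" for x
  proof -
    from x obtain a e where xae: "x = real a / real (p ^ e)" and I: "exps_in_frob (p ^ e) (\<lambda>i. a * m i)"
      by (auto simp: thresholds_def)
    have pe: "real (p ^ e) > 0" "real (p ^ e0) > 0" and p0: "real p > 0" using p_gt_1 by simp_all
    define b where "b = (\<lambda>i. (p ^ e0 * (a * m i)) div p ^ e)"
    have xd: "x * d < \<tau>" using x d by (simp add: field_simps)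
    have "exps_in_frob (p ^ e0 * p ^ e) (\<lambda>i. p ^ e0 * (a * m i))" using I by (simp only: exps_in_frob_p_power)
    hence I': "exps_in_frob (p ^ (e0 + e)) (\<lambda>i. p ^ e0 * (a * m i))" by (simp only: power_add)
    have Ib: "exps_in_frob (p ^ e0) b"
    proof (cases e)
      case 0
      thus ?thesis using I' by (simp add: b_def)
    next
      case (Suc k)
      have "real a * d \<le> \<tau> * real (p ^ e)" using xd pe by (simp add: xae field_simps)
      hence "real (p ^ e0) * (real a * d) \<le> real (p ^ e0) * (\<tau> * real (p ^ e))"
        using pe by (intro mult_left_mono) auto
      also have "\<dots> = 2 * real (p ^ (e0 + e)) - real total_degree * real (p ^ e)"
      proof -
        have "real (p ^ e0) * \<tau> = 2 * real (p ^ e0) - real total_degree"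
          using p0 by (simp add: \<tau>_def right_diff_distrib)
        hence "real (p ^ e0) * \<tau> * real (p ^ e) = (2 * real (p ^ e0) - real total_degree) * real (p ^ e)"
          by (simp only:)
        thus ?thesis by (simp add: power_add algebra_simps)
      qed
      finally have "real (p ^ e0 * (a * form_degree m) + total_degree * p ^ e) \<le> real (2 * p ^ (e0 + e))"
        by (simp only: of_nat_mult of_nat_add d_def of_nat_numeral)
      hence "p ^ e0 * (a * form_degree m) + total_degree * p ^ e \<le> 2 * p ^ (e0 + e)" by (simp only: of_nat_le_iff)
      moreover have "total_degree * p ^ k \<le> total_degree * p ^ e" using p_gt_1 Suc by (intro mult_le_mono2) simp
      ultimately have "form_degree (\<lambda>i. p ^ e0 * (a * m i)) + total_degree * p ^ k \<le> 2 * p ^ (e0 + e)"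
        by (simp only: form_degree_scale)
      with I' show ?thesis unfolding b_def Suc by (intro exps_in_frob_descend)
    qed
    have ble: "real (b i) \<le> x * real (m i) * real (p ^ e0)" for i
    proof -
      have "b i * p ^ e \<le> p ^ e0 * (a * m i)" by (simp add: b_def)
      hence "real (b i * p ^ e) \<le> real (p ^ e0 * (a * m i))" by (simp only: of_nat_le_iff)
      thus ?thesis using pe by (simp add: xae field_simps)
    qed
    define J where "J = {i\<in>factors. m i \<ge> 1}"
    define f where "f i = real (b i) / (real (m i) * real (p ^ e0))" for i
    have finJ: "finite J" using finite_factors by (simp add: J_def)
    have "J \<noteq> {}"
    proof
      assume "J = {}"
      hence "m i = 0" if "i \<in> factors" for i using that by (force simp: J_def)
      hence "form_degree m = 0" by (simp add: form_degree_def factors_def)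
      thus False using deg by simp
    qed
    hence "Max (f ` J) \<in> f ` J" using finJ by (intro Max_in) auto
    then obtain i where i: "i \<in> J" "f i = Max (f ` J)" by auto
    have max: "f j \<le> f i" if "j \<in> J" for j unfolding i(2) using finJ that by simp
    have t_le: "t \<le> f i"
      unfolding t_def
    proof (rule Inf_thresholds_le[OF _ Ib])
      show "0 \<le> f i" by (simp add: f_def)
      fix j assume j: "j \<in> factors"
      show "real (b j) \<le> f i * real (m j) * real (p ^ e0)"
      proof (cases "m j = 0")
        case True
        thus ?thesis by (simp add: b_def)
      next
        case False
        hence "f j \<le> f i" using j by (intro max) (simp add: J_def)
        thus ?thesis using False pe by (simp add: f_def field_simps)
      qed
    qed
    have le_x: "f i \<le> x" using ble[of i] i(1) pe by (simp add: f_def J_def field_simps)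
    have "x \<le> 2"
    proof -
      have "\<tau> \<le> 2" by (simp add: \<tau>_def)
      have "x \<ge> 0" using x(1) by (rule thresholds_nonneg)
      hence "x * 1 \<le> x * d" using d by (intro mult_left_mono)
      thus ?thesis using xd \<open>\<tau> \<le> 2\<close> by simp
    qed
    have "real (b i) \<le> x * real (m i) * real (p ^ e0)" by (rule ble)
    also have "\<dots> \<le> 2 * real (m i) * real (p ^ e0)" using \<open>x \<le> 2\<close> by (intro mult_right_mono) auto
    finally have "real (b i) \<le> real (2 * p ^ e0 * m i)" by (simp add: mult_ac)
    hence "b i \<le> 2 * p ^ e0 * m i" by (simp only: of_nat_le_iff)
    hence "f i \<in> \<Sigma>" using i(1) unfolding \<Sigma>_def f_def J_def by blast
    hence "f i \<in> \<Sigma>'" using t_le i(1) unfolding \<Sigma>'_def f_def J_def by blast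
    thus ?thesis using le_x by blast
  qed
  have bdd: "bdd_below (thresholds m)" by (rule bdd_belowI[of _ 0]) (rule thresholds_nonneg)
  obtain x where x: "x \<in> thresholds m" "x < \<tau> / d"
    using \<tau> cInf_less_iff[OF ne bdd] unfolding t_def by blast
  with key have "\<Sigma>' \<noteq> {}" by blast
  with fin have min: "Min \<Sigma>' \<in> \<Sigma>'" by (intro Min_in)
  have "Min \<Sigma>' = t"
  proof (rule ccontr)
    assume "Min \<Sigma>' \<noteq> t"
    hence "t < min (Min \<Sigma>') (\<tau> / d)" using min \<tau> by (auto simp: \<Sigma>'_def)
    then obtain x where "x \<in> thresholds m" "x < min (Min \<Sigma>') (\<tau> / d)"
      using cInf_less_iff[OF ne bdd] unfolding t_def by blast
    with key[of x] obtain s where "s \<in> \<Sigma>'" "s \<le> x" "x < Min \<Sigma>'" by auto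
    moreover have "Min \<Sigma>' \<le> s" using fin \<open>s \<in> \<Sigma>'\<close> by (rule Min_le)
    ultimately show False by simp
  qed
  with min show ?thesis unfolding \<Sigma>'_def t_def by auto
qed

lemma thresholds_nonempty: "form_degree m \<ge> 1 \<Longrightarrow> thresholds m \<noteq> {}"
proof -
  assume "form_degree m \<ge> 1"
  hence "exps_in_frob (p ^ 0) (\<lambda>i. 2 * m i)" by (intro exps_in_frob_large_degree) (simp add: form_degree_scale)
  thus ?thesis unfolding thresholds_def by blast
qed

lemma exponent_le_form_degree: "i \<in> factors \<Longrightarrow> m i \<le> form_degree m"
proof (cases i)
  case (Some P)
  assume "i \<in> factors"
  hence P: "P \<in> Ps" using Some by (auto simp: factors_def)
  have "m i * 1 \<le> m i * degree P" using degree_Ps[OF P] by (intro mult_le_mono2)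
  also have "\<dots> \<le> (\<Sum>Q\<in>Ps. m (Some Q) * degree Q)"
    using member_le_sum[of P Ps "\<lambda>Q. m (Some Q) * degree Q"] P finite_Ps Some by simp
  finally show ?thesis by (simp add: form_degree_def)
qed (simp add: form_degree_def)

text \<open>
  The number \<open>(d + 1) d\<close> arises as follows.  The total degree of the factors is at most \<open>d + 1\<close>, so the
  infimum is at least \<open>(2 - (d + 1) / p) / d\<close> or \<open>1 / M\<close>, while fractions with denominators \<open>d\<close> and
  \<open>k \<le> d\<close> that differ are at least \<open>1 / (d k)\<close> apart.
\<close>

lemma Inf_thresholds_dichotomy:
  fixes m :: "int poly option \<Rightarrow> nat"
  defines "d \<equiv> form_degree m" and "M \<equiv> Max (m ` factors)" and "t \<equiv> Inf (thresholds m)"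
  assumes deg: "d \<ge> 1" and mpos: "\<And>P. P \<in> Ps \<Longrightarrow> m (Some P) \<ge> 1" and large: "p > (d + 1) * d"
  shows "t = min (2 / real d) (1 / real M) \<or>
    (\<exists>i\<in>factors. \<exists>a b k e. m i \<ge> 1 \<and> 0 < b \<and> coprime a b \<and> t = real a / real b \<and>
       b = k * p ^ e \<and> 1 \<le> e \<and> k dvd m i)"
proof -
  have fin: "finite (m ` factors)" "m ` factors \<noteq> {}" using finite_factors by (auto simp: factors_def)
  have M_ge: "m i \<le> M" if "i \<in> factors" for i using fin that by (simp add: M_def)
  obtain iM where iM: "iM \<in> factors" "m iM = M" using Max_in[OF fin] by (auto simp: M_def)
  have M1: "M \<ge> 1"
  proof (rule ccontr)
    assume "\<not> M \<ge> 1"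
    hence "m i = 0" if "i \<in> factors" for i using M_ge[OF that] by simp
    hence "form_degree m = 0" by (simp add: form_degree_def factors_def)
    thus False using deg by (simp add: d_def)
  qed
  have Md: "M \<le> d" using exponent_le_form_degree[OF iM(1), of m] iM(2) by (simp add: d_def)
  have total_le: "total_degree \<le> d + 1"
  proof -
    have "(\<Sum>P\<in>Ps. degree P) \<le> (\<Sum>P\<in>Ps. m (Some P) * degree P)"
      using mpos by (intro sum_mono) simp
    thus ?thesis by (simp add: total_degree_def d_def form_degree_def)
  qed
  have ne: "thresholds m \<noteq> {}" by (rule thresholds_nonempty) (use deg in \<open>simp add: d_def\<close>)
  have t_d: "t \<le> 2 / real d"
    unfolding t_def d_def by (rule Inf_thresholds_le_inverse_degree) (use deg in \<open>simp add: d_def\<close>)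
  have t_M: "t \<le> 1 / real M"
    unfolding t_def iM(2)[symmetric] by (rule Inf_thresholds_le_inverse_mult) (use iM M1 in auto)
  have p0: "real p > 0" using p_gt_1 by simp
  define A where "A = 2 - real total_degree / real p"
  define l where "l = A / real d"
  have pA: "real p * A = 2 * real p - real total_degree" using p0 by (simp add: A_def right_diff_distrib)
  have lower: "min (1 / real M) l \<le> t"
    unfolding t_def
  proof (rule cInf_greatest[OF ne])
    fix x assume "x \<in> thresholds m"
    from thresholds_lower[OF this] deg consider i where "i \<in> factors" "m i \<ge> 1" "x \<ge> 1 / real (m i)" | "x \<ge> l"
      unfolding l_def d_def A_def by blast
    thus "min (1 / real M) l \<le> x"
    proof cases
      case 1
      have "1 / real M \<le> 1 / real (m i)" using M_ge[OF 1(1)] 1(2) by (simp add: frac_le)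
      thus ?thesis using 1(3) by linarith
    qed auto
  qed
  have large': "real total_degree * real d < real p"
  proof -
    have "real (total_degree * d) \<le> real ((d + 1) * d)" using total_le by (simp only: of_nat_le_iff mult_le_mono1)
    also have "\<dots> < real p" using large by (simp only: of_nat_less_iff)
    finally show ?thesis by simp
  qed
  show ?thesis
  proof (cases "2 * M > d")
    case True
    \<comment> \<open>One factor dominates, and the lower bound already meets the upper bound \<open>1 / M\<close>.\<close>
    have "real total_degree * real M \<le> real total_degree * real d" using Md by (intro mult_left_mono) auto
    hence "real total_degree * real M < real p" using large' by simp
    moreover have "real d + 1 \<le> 2 * real M" using True by linarith
    hence "real p * (real d + 1) \<le> real p * (2 * real M)" by (intro mult_left_mono) auto
    ultimately have "real p * real d \<le> (2 * real p - real total_degree) * real M"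
      by (simp add: algebra_simps)
    also have "\<dots> = real p * (A * real M)" using pA by (simp only: mult.assoc[symmetric])
    finally have "real d \<le> A * real M" using p0 by (simp only: mult_le_cancel_left_pos)
    hence "1 / real M \<le> l" using deg M1 by (simp add: l_def divide_le_eq le_divide_eq mult.commute)
    hence "t = 1 / real M" using lower t_M by simp
    moreover have "1 / real M \<le> 2 / real d" using True deg M1 by (simp add: field_simps)
    ultimately show ?thesis by simp
  next
    case False
    have dM: "2 / real d \<le> 1 / real M" using False deg M1 by (simp add: field_simps)
    show ?thesis
    proof (cases "t = 2 / real d")
      case True
      thus ?thesis using dM by simp
    next
      case tne: False
      have t_less: "t < 2 / real d" using t_d tne by simp
      have t_ge: "l \<le> t" using lower t_less dM by linarith
      obtain i n e0 where i: "i \<in> factors" "m i \<ge> 1" "t = real n / (real (m i) * real (p ^ e0))"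
        using Inf_thresholds_rational[of m] ne deg t_less unfolding t_def d_def by blast
      define c where "c = m i * p ^ e0"
      have c0: "c > 0" using i(2) p_gt_1 by (simp add: c_def)
      have tc: "t = real n / real c" using i(3) by (simp add: c_def)
      define g where "g = gcd n c"
      define a b where "a = n div g" and "b = c div g"
      have g0: "g > 0" using c0 by (simp add: g_def)
      have ng: "n = a * g" "c = b * g" by (simp_all add: a_def b_def g_def)
      have b0: "b > 0" using c0 ng(2) by (cases b) auto
      have cop: "coprime a b" unfolding a_def b_def g_def using c0 by (intro div_gcd_coprime) auto
      have tab: "t = real a / real b" using g0 unfolding tc ng by simp
      have "\<not> is_unit p" using p_gt_1 by simp
      with b0 obtain k where k: "b = p ^ multiplicity p b * k" "\<not> p dvd k"
        using multiplicity_decompose'[of b p] by auto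
      define e where "e = multiplicity p b"
      have bk: "b = k * p ^ e" using k(1) by (simp add: e_def mult.commute)
      have "k dvd m i * p ^ e0" using ng(2) bk c_def by (metis dvd_def mult.assoc mult.commute)
      moreover have "coprime k (p ^ e0)"
        using prime_imp_coprime[OF prime_p k(2)] by (simp add: coprime_commute)
      ultimately have km: "k dvd m i" by (simp add: coprime_dvd_mult_left_iff)
      have "e \<ge> 1"
      proof (rule ccontr)
        assume "\<not> e \<ge> 1"
        hence "b = k" using bk by simp
        \<comment> \<open>Then \<open>t\<close> and \<open>2 / d\<close> are distinct fractions with denominators at most \<open>d\<close>, so they
          are further apart than the lower bound for \<open>t\<close> allows.\<close>
        hence "b \<le> d" using km i(2) exponent_le_form_degree[OF i(1), of m] dvd_imp_le[of k "m i"]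
          by (simp add: d_def)
        have "real a * real d < 2 * real b" using t_less tab b0 deg by (simp add: field_simps)
        hence "real (a * d) < real (2 * b)" by simp
        hence "a * d + 1 \<le> 2 * b" by (simp only: of_nat_less_iff)
        hence "real (a * d + 1) \<le> real (2 * b)" by (simp only: of_nat_le_iff)
        hence 1: "real a * real d + 1 \<le> 2 * real b" by simp
        have "A * real b \<le> real a * real d"
          using t_ge tab b0 deg by (simp add: l_def divide_le_eq le_divide_eq mult.commute)
        hence "real p * (A * real b) \<le> real p * (real a * real d)" using p0 by simp
        hence "(2 * real p - real total_degree) * real b \<le> real p * (real a * real d)"
          unfolding mult.assoc[symmetric] pA .
        moreover have "real p * (real a * real d + 1) \<le> real p * (2 * real b)"
          using 1 by (intro mult_left_mono) auto
        ultimately have "real p \<le> real total_degree * real b" by (simp add: algebra_simps)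
        also have "\<dots> \<le> real total_degree * real d" using \<open>b \<le> d\<close> by (intro mult_left_mono) auto
        finally show False using large' by simp
      qed
      with i(1,2) b0 cop tab bk km show ?thesis by blast
    qed
  qed
qed

end

section \<open>Homogenization\<close>

text \<open>
  The form \<open>F\<close> of degree \<open>n\<close> with \<open>F(x, 1) = f\<close>, for \<open>degree f \<le> n\<close>.
\<close>

definition homogenize :: "nat \<Rightarrow> 'a::comm_ring_1 poly \<Rightarrow> 'a poly poly" where
  "homogenize n f = (\<Sum>i\<le>n. const2 (coeff f i) * var_x ^ i * var_y ^ (n - i))"

lemma const2_mult_powers: "const2 (c :: 'a::comm_ring_1) * var_x ^ i * var_y ^ j = monom (monom c i) j"
proof -
  have x: "var_x ^ i = [:monom (1::'a) i:]"
    by (simp add: var_x_def poly_const_pow monom_altdef)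
  have y: "var_y ^ j = monom (1::'a poly) j" by (simp add: var_y_def monom_altdef)
  have "const2 c * var_x ^ i * var_y ^ j = [:[:c:]:] * [:monom 1 i:] * monom 1 j"
    by (simp only: x y const2_def)
  thus ?thesis by (simp add: smult_monom)
qed

lemma const2_simps: "const2 0 = 0" "const2 1 = 1" "const2 (a + b) = const2 a + const2 b"
    "const2 (a * b) = const2 a * const2 (b :: 'a::comm_ring_1)"
  by (simp_all add: const2_def flip: one_pCons)

lemma coeff2_eqI: "(\<And>i j. coeff2 g i j = coeff2 h i j) \<Longrightarrow> g = h"
  by (simp add: coeff2_def poly_eq_iff)

lemma coeff2_homogenize: "coeff2 (homogenize n f) i j = (if i + j = n then coeff f i else 0)"
proof -
  have "coeff2 (homogenize n f) i j = (\<Sum>k\<le>n. if n - k = j \<and> k = i then coeff f k else 0)"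
    unfolding homogenize_def const2_mult_powers coeff2_def coeff_sum
    by (intro sum.cong) (auto simp: coeff_sum)
  also have "\<dots> = (\<Sum>k\<le>n. if k = i then if n - i = j then coeff f i else 0 else 0)"
    by (intro sum.cong) auto
  finally show ?thesis by (auto simp: sum.delta)
qed

lemma coeff2_mult:
  "coeff2 (g * h) i j = (\<Sum>l\<le>j. \<Sum>k\<le>i. coeff2 g k l * coeff2 h (i - k) (j - l))"
  by (simp add: coeff2_def coeff_mult coeff_sum)

lemma poly_homogenize: "degree f \<le> n \<Longrightarrow> poly (homogenize n f) 1 = f"
  using poly_as_sum_of_monoms'[of f n]
  by (simp add: homogenize_def const2_mult_powers poly_sum poly_monom)

lemma homogenize_unique:
  assumes "\<And>i j. coeff2 g i j \<noteq> 0 \<Longrightarrow> i + j = n"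
  shows "g = homogenize n (poly g 1)" "degree (poly g 1) \<le> n"
proof -
  have c: "coeff (poly g 1) i = (if i \<le> n then coeff2 g i (n - i) else 0)" for i
  proof -
    have "coeff (poly g 1) i = (\<Sum>j\<le>degree g. coeff2 g i j)"
      by (simp add: poly_altdef coeff_sum coeff2_def)
    also have "\<dots> = (\<Sum>j\<le>degree g. if j = n - i then (if i \<le> n then coeff2 g i (n - i) else 0) else 0)"
      by (intro sum.cong refl) (use assms in \<open>fastforce\<close>)
    also have "\<dots> = (if i \<le> n then coeff2 g i (n - i) else 0)"
      by (auto simp: sum.delta coeff2_def coeff_eq_0)
    finally show ?thesis .
  qed
  show "g = homogenize n (poly g 1)"
  proof (rule coeff2_eqI)
    fix i j show "coeff2 g i j = coeff2 (homogenize n (poly g 1)) i j"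
      unfolding coeff2_homogenize c using assms[of i j] by auto
  qed
  show "degree (poly g 1) \<le> n" by (rule degree_le) (simp add: c)
qed

lemma homogenize_mult:
  assumes "degree f \<le> n" "degree h \<le> m"
  shows "homogenize n f * homogenize m h = homogenize (n + m) (f * h)"
proof -
  have "homogenize n f * homogenize m h = homogenize (n + m) (poly (homogenize n f * homogenize m h) 1)"
  proof (rule homogenize_unique(1))
    fix i j assume "coeff2 (homogenize n f * homogenize m h) i j \<noteq> 0"
    then obtain l k where "l \<le> j" "k \<le> i" "coeff2 (homogenize n f) k l * coeff2 (homogenize m h) (i - k) (j - l) \<noteq> 0"
      unfolding coeff2_mult by (meson atMost_iff sum.neutral)
    hence "coeff2 (homogenize n f) k l \<noteq> 0" "coeff2 (homogenize m h) (i - k) (j - l) \<noteq> 0" by auto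
    hence "k + l = n" "i - k + (j - l) = m" by (auto simp: coeff2_homogenize split: if_splits)
    thus "i + j = n + m" using \<open>l \<le> j\<close> \<open>k \<le> i\<close> by auto
  qed
  thus ?thesis using assms by (simp add: poly_homogenize)
qed

lemma homogenize_const: "homogenize 0 [:c:] = const2 c"
  by (simp add: homogenize_def)

lemma homogenize_power:
  "degree (f :: 'a::comm_ring_1 poly) \<le> n \<Longrightarrow> homogenize n f ^ k = homogenize (n * k) (f ^ k)"
proof (induction k)
  case 0
  show ?case using homogenize_const[of "1::'a"] by (simp add: const2_simps flip: one_pCons)
next
  case (Suc k)
  have "degree (f ^ k) \<le> n * k" using degree_power_le[of f k] Suc.prems
    by (meson le_trans mult_le_mono1)
  thus ?case using Suc by (simp add: homogenize_mult add.commute)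
qed

lemma homogenize_one: "homogenize k 1 = (var_y ^ k :: 'a::comm_ring_1 poly poly)"
proof (rule coeff2_eqI)
  fix i j
  have "var_y ^ k = const2 1 * var_x ^ 0 * (var_y ^ k :: 'a poly poly)" by (simp add: const2_simps)
  hence "var_y ^ k = monom (monom (1::'a) 0) k" unfolding const2_mult_powers .
  thus "coeff2 (homogenize k 1) i j = coeff2 (var_y ^ k :: 'a poly poly) i j"
    unfolding coeff2_homogenize by (auto simp: coeff2_def)
qed

section \<open>Substitution\<close>

text \<open>
  Polynomials in two variables are generated by the constants and the variables, so identities between
  ring homomorphisms or derivations need only be checked there.
\<close>

lemma poly2_induct [case_names const x y add mult]:
  fixes g :: "'a::comm_ring_1 poly poly"
  assumes "\<And>c. P (const2 c)" "P var_x" "P var_y"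
    and add: "\<And>g h. P g \<Longrightarrow> P h \<Longrightarrow> P (g + h)" and mult: "\<And>g h. P g \<Longrightarrow> P h \<Longrightarrow> P (g * h)"
  shows "P g"
proof -
  have inner: "P [:q:]" for q
  proof (induction q)
    case 0
    show ?case using assms(1)[of 0] by (simp add: const2_def)
  next
    case (pCons a q)
    have "[:pCons a q:] = const2 a + var_x * [:q:]" by (simp add: const2_def var_x_def)
    thus ?case using add[OF assms(1) mult[OF assms(2) pCons.IH]] by simp
  qed
  show ?thesis
  proof (induction g)
    case 0
    show ?case using inner[of 0] by simp
  next
    case (pCons q g)
    have "pCons q g = [:q:] + var_y * g" by (simp add: var_y_def)
    thus ?case using add[OF inner mult[OF assms(3) pCons.IH]] by simp
  qed
qed

lemma poly_map_poly_hom: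
  fixes h :: "'a::comm_ring_1 \<Rightarrow> 'b::comm_ring_1"
  assumes h0: "h 0 = 0" and hadd: "\<And>a b. h (a + b) = h a + h b"
    and hmult: "\<And>a b. h (a * b) = h a * h b"
  shows "poly (map_poly h (p + q)) Y = poly (map_poly h p) Y + poly (map_poly h q) Y"
    and "poly (map_poly h (p * q)) Y = poly (map_poly h p) Y * poly (map_poly h q) Y"
proof -
  have add: "poly (map_poly h (p + q)) Y = poly (map_poly h p) Y + poly (map_poly h q) Y" for p q
  proof -
    have "map_poly h (p + q) = map_poly h p + map_poly h q"
      by (rule poly_eqI) (simp add: coeff_map_poly h0 hadd)
    thus ?thesis by simp
  qed
  have smult: "poly (map_poly h (smult a q)) Y = h a * poly (map_poly h q) Y" for a q
    by (induction q) (simp_all add: map_poly_pCons h0 hmult algebra_simps)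
  show "poly (map_poly h (p + q)) Y = poly (map_poly h p) Y + poly (map_poly h q) Y" by (rule add)
  show "poly (map_poly h (p * q)) Y = poly (map_poly h p) Y * poly (map_poly h q) Y"
    by (induction p) (simp_all add: map_poly_pCons h0 hmult add smult algebra_simps)
qed

lemma subst2_const: "subst2 (const2 c) X Y = const2 c"
  by (simp add: subst2_def const2_def map_poly_pCons)

lemma subst2_var: "subst2 var_x X Y = X" "subst2 var_y X Y = Y"
  by (simp_all add: subst2_def var_x_def var_y_def map_poly_pCons const2_simps)

lemma subst2_add: "subst2 (g + h) X Y = subst2 g X Y + subst2 h X Y"
  and subst2_mult: "subst2 (g * h) X Y = subst2 g X Y * subst2 h X Y"
  unfolding subst2_def
  by (rule poly_map_poly_hom; simp add: poly_map_poly_hom const2_simps)+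

lemma subst2_0 [simp]: "subst2 0 X Y = 0"
  by (simp add: subst2_def)

lemma subst2_1 [simp]: "subst2 1 X Y = 1"
  using subst2_const[of 1] by (simp add: const2_simps)

lemma subst2_power: "subst2 (g ^ n) X Y = subst2 g X Y ^ n"
  by (induction n) (simp_all add: subst2_mult)

lemma subst2_sum: "subst2 (\<Sum>x\<in>A. F x) X Y = (\<Sum>x\<in>A. subst2 (F x) X Y)"
  by (induction A rule: infinite_finite_induct) (simp_all add: subst2_add)

lemma subst2_minus: "subst2 (- g) X Y = - subst2 g X Y"
proof -
  have "subst2 g X Y + subst2 (- g) X Y = 0" by (simp flip: subst2_add)
  thus ?thesis by (simp add: eq_neg_iff_add_eq_0 add.commute)
qed

lemma subst2_diff: "subst2 (g - h) X Y = subst2 g X Y - subst2 h X Y"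
  using subst2_add[of g "- h"] by (simp add: subst2_minus)

lemma coeff2_00_simps:
  "coeff2 (g + h) 0 0 = coeff2 g 0 0 + coeff2 h 0 0"
  "coeff2 (g * h) 0 0 = coeff2 g 0 0 * coeff2 h 0 0"
  "coeff2 (const2 c) 0 0 = c" "coeff2 var_x 0 0 = 0" "coeff2 var_y 0 0 = 0"
  by (simp_all add: coeff2_def const2_def var_x_def var_y_def coeff_mult_0)

lemma coeff2_00_power: "coeff2 (g ^ n) 0 0 = (coeff2 g 0 0 :: 'a::comm_ring_1) ^ n"
  by (induction n) (simp_all add: coeff2_00_simps, simp add: coeff2_def)

lemma coeff2_00_subst2:
  assumes "coeff2 X 0 0 = 0" "coeff2 Y 0 0 = 0"
  shows "coeff2 (subst2 g X Y) 0 0 = coeff2 g 0 0"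
  by (induction g rule: poly2_induct)
     (simp_all add: subst2_const subst2_var subst2_add subst2_mult coeff2_00_simps assms)

lemma dx_simps:
  fixes c :: "'a::idom" and g h :: "'a poly poly"
  shows "dx (const2 c) = 0" "dx (var_x :: 'a poly poly) = 1" "dx (var_y :: 'a poly poly) = 0"
  "dx (g + h) = dx g + dx h" "dx (g * h) = dx g * h + g * dx h"
proof -
  have [simp]: "dx (pCons a g) = pCons (pderiv a) (dx g)" for a and g :: "'a poly poly"
    by (simp add: dx_def map_poly_pCons)
  have [simp]: "dx (0 :: 'a poly poly) = 0" "dx (1 :: 'a poly poly) = 0"
    by (simp_all add: dx_def map_poly_1)
  have add: "dx (g + h) = dx g + dx h" for g h :: "'a poly poly"
    unfolding dx_def by (rule poly_eqI) (simp add: coeff_map_poly pderiv_add)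
  have [simp]: "dx (smult a h) = smult (pderiv a) h + smult a (dx h)" for a and h :: "'a poly poly"
    by (induction h) (simp_all add: pderiv_mult algebra_simps)
  show "dx (const2 c) = 0" "dx (var_x :: 'a poly poly) = 1" "dx (var_y :: 'a poly poly) = 0"
    by (simp_all add: const2_def var_x_def var_y_def pderiv_pCons flip: one_pCons)
  show "dx (g + h) = dx g + dx h" by (rule add)
  show "dx (g * h) = dx g * h + g * dx h"
    by (induction g) (simp_all add: add algebra_simps)
qed

lemma dy_simps:
  "dy (const2 c) = 0" "dy var_x = 0" "dy var_y = 1"
  "dy (g + h) = dy g + dy h" "dy (g * h) = dy g * h + g * dy h"
  by (simp_all add: dy_def const2_def var_x_def var_y_def pderiv_pCons pderiv_add pderiv_mult mult.commute)

lemma chain_rule: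
  "dx (subst2 g X Y) = subst2 (dx g) X Y * dx X + subst2 (dy g) X Y * dx Y"
  "dy (subst2 g X Y) = subst2 (dx g) X Y * dy X + subst2 (dy g) X Y * dy Y"
  by (induction g rule: poly2_induct;
      simp add: subst2_const subst2_var subst2_add subst2_mult dx_simps dy_simps algebra_simps)+

lemma jacobian_subst2:
  "jacobian (subst2 g X Y) (subst2 h X Y) = subst2 (jacobian g h) X Y * jacobian X Y"
  by (simp add: jacobian_def chain_rule subst2_mult subst2_diff algebra_simps)


section \<open>Blow-ups of homogeneous polynomials\<close>

text \<open>
  If \<open>l\<close> generates the kernel of a substitution, then the quotient by \<open>l\<close> embeds into a domain.  This
  covers \<open>x\<close>, \<open>y\<close> and all linear forms at once.
\<close>

lemma prime_elem_of_retraction: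
  fixes l :: "'a::idom poly poly"
  assumes l: "l \<noteq> 0" "\<not> l dvd 1" and zero: "subst2 l X Y = 0"
    and X: "l dvd var_x - X" and Y: "l dvd var_y - Y"
  shows "prime_elem l" and "l dvd g \<longleftrightarrow> subst2 g X Y = 0"
proof -
  have diff: "l dvd g - subst2 g X Y" for g
  proof (induction g rule: poly2_induct)
    case (add g h)
    hence "l dvd (g - subst2 g X Y) + (h - subst2 h X Y)" by (rule dvd_add)
    thus ?case by (simp add: subst2_add algebra_simps)
  next
    case (mult g h)
    hence "l dvd (g - subst2 g X Y) * h + subst2 g X Y * (h - subst2 h X Y)"
      by (intro dvd_add) auto
    thus ?case by (simp add: subst2_mult algebra_simps)
  qed (simp_all add: subst2_const subst2_var X Y)
  have dvd_iff: "l dvd g \<longleftrightarrow> subst2 g X Y = 0" for g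
  proof
    assume "l dvd g"
    thus "subst2 g X Y = 0" by (auto simp: subst2_mult zero)
  next
    assume "subst2 g X Y = 0"
    thus "l dvd g" using diff[of g] by simp
  qed
  show "l dvd g \<longleftrightarrow> subst2 g X Y = 0" by (rule dvd_iff)
  show "prime_elem l"
    by (rule prime_elemI) (use l in \<open>auto simp: dvd_iff subst2_mult\<close>)
qed

text \<open>
  The linear form that corresponds to the root \<open>z\<close> of the dehomogenization.
\<close>

definition root_form :: "complex \<Rightarrow> complex poly poly" where
  "root_form z = var_x - const2 z * var_y"

lemma not_dvd_1_of_origin: "coeff2 l 0 0 = (0 :: 'a::idom) \<Longrightarrow> \<not> l dvd 1"
  by (auto elim!: dvdE dest!: arg_cong[of _ _ "\<lambda>g. coeff2 g 0 0"] simp: coeff2_00_simps)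
     (simp add: coeff2_def)

lemma coeff2_00_diff: "coeff2 (g - h) 0 0 = coeff2 g 0 0 - (coeff2 h 0 0 :: 'a::comm_ring_1)"
  by (simp add: coeff2_def)

lemma root_form_nz: "root_form z \<noteq> 0"
proof
  assume "root_form z = 0"
  hence "coeff2 (root_form z) 1 0 = 0" by (simp add: coeff2_def)
  thus False by (simp add: root_form_def coeff2_def var_x_def var_y_def const2_def)
qed

lemma var_nz: "var_x \<noteq> (0 :: 'a::comm_ring_1 poly poly)" "var_y \<noteq> (0 :: 'a poly poly)"
  by (simp_all add: var_x_def var_y_def)

lemma prime_elem_root_form: "prime_elem (root_form z)"
proof (rule prime_elem_of_retraction)
  show "subst2 (root_form z) (const2 z * var_y) var_y = 0"
    by (simp add: root_form_def subst2_diff subst2_mult subst2_var subst2_const)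
  show "root_form z \<noteq> 0" by (rule root_form_nz)
  show "\<not> root_form z dvd 1"
    by (rule not_dvd_1_of_origin) (simp add: root_form_def coeff2_00_diff coeff2_00_simps)
qed (simp_all add: root_form_def)

lemma prime_elem_var_y: "prime_elem (var_y :: 'a::idom poly poly)"
  by (rule prime_elem_of_retraction[of _ var_x 0])
     (auto simp: var_nz subst2_var not_dvd_1_of_origin coeff2_00_simps)

lemma var_x_dvd_iff: "var_x dvd (g :: 'a::idom poly poly) \<longleftrightarrow> subst2 g 0 var_y = 0"
  by (rule prime_elem_of_retraction(2))
     (auto simp: var_nz subst2_var not_dvd_1_of_origin coeff2_00_simps)

lemma not_var_x_dvd:
  assumes "coeff2 (U :: 'a::idom poly poly) 0 0 \<noteq> 0"
  shows "\<not> var_x dvd var_y ^ B * U"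
proof
  assume "var_x dvd var_y ^ B * U"
  hence "var_y ^ B * subst2 U 0 var_y = 0"
    by (simp only: var_x_dvd_iff subst2_mult subst2_power subst2_var)
  hence "subst2 U 0 var_y = 0" by (simp add: var_nz)
  moreover have "coeff2 (subst2 U 0 var_y) 0 0 = coeff2 U 0 0"
    by (rule coeff2_00_subst2) (simp_all add: coeff2_00_simps, simp add: coeff2_def)
  ultimately show False using assms by (simp add: coeff2_def)
qed

lemma multiplicity_var_x_monomial:
  fixes U :: "complex poly poly"
  assumes "coeff2 U 0 0 \<noteq> 0"
  shows "multiplicity var_x (var_x ^ A * var_y ^ B * U) = A"
proof (rule multiplicity_eqI)
  show "var_x ^ A dvd var_x ^ A * var_y ^ B * U" by simp
  show "\<not> var_x ^ Suc A dvd var_x ^ A * var_y ^ B * U"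
    using not_var_x_dvd[OF assms, of B]
    by (simp only: power_Suc2 mult.assoc) (simp add: var_nz)
qed

lemma blowup_chart_hom:
  "blowup_chart c (g * h) = blowup_chart c g * blowup_chart c h"
  "blowup_chart c (g ^ n) = blowup_chart c g ^ n"
  "coeff2 (blowup_chart c g) 0 0 = coeff2 g 0 0"
  by (cases c; simp add: subst2_mult subst2_power coeff2_00_subst2 coeff2_00_simps)+

lemma pullback_snoc: "pullback (w @ [c]) g = blowup_chart c (pullback w g)"
  by (simp add: pullback_def)

lemma jacobian_vars: "jacobian var_x var_y = (1 :: 'a::idom poly poly)"
  by (simp add: jacobian_def dx_simps dy_simps)

lemma jac_Nil: "jac [] = 1"
  by (simp add: jac_def pullback_def jacobian_vars)

text \<open>
  By the chain rule the Jacobian acquires the Jacobian of the chart as a factor, which is the equation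
  of the new exceptional curve.
\<close>

lemma jac_snoc: "jac (w @ [c]) = blowup_chart c (jac w) * (case c of Some _ \<Rightarrow> var_x | None \<Rightarrow> var_y)"
proof (cases c)
  case None
  thus ?thesis
    by (simp add: jac_def pullback_snoc jacobian_subst2) (simp add: jacobian_def dx_simps dy_simps)
next
  case (Some a)
  thus ?thesis
    by (simp add: jac_def pullback_snoc jacobian_subst2) (simp add: jacobian_def dx_simps dy_simps)
qed

text \<open>
  Being a monomial times a local unit persists under blowing up a point.  The new exceptional curve gets
  the sum of the exponents.  In the direction \<open>c \<noteq> 0\<close> the curve \<open>y = 0\<close> is left behind.
\<close>

lemma chart_monomial:
  assumes "coeff2 U 0 0 \<noteq> 0"
  shows "\<exists>B' V. blowup_chart (Some c) (var_x ^ A * var_y ^ B * U) = var_x ^ (A + B) * var_y ^ B' * V \<and>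
      coeff2 V 0 0 \<noteq> 0 \<and> B' = (if c = 0 then B else 0)"
    and "\<exists>V. blowup_chart None (var_x ^ A * var_y ^ B * U) = var_x ^ A * var_y ^ (A + B) * V \<and>
      coeff2 V 0 0 \<noteq> 0"
proof -
  let ?U = "blowup_chart (Some c) U"
  have eq: "blowup_chart (Some c) (var_x ^ A * var_y ^ B * U) =
     var_x ^ (A + B) * (var_y + const2 c) ^ B * ?U"
    by (simp add: subst2_mult subst2_power subst2_var power_add power_mult_distrib mult_ac)
  have U: "coeff2 ?U 0 0 \<noteq> 0" unfolding blowup_chart_hom by fact
  show "\<exists>B' V. blowup_chart (Some c) (var_x ^ A * var_y ^ B * U) = var_x ^ (A + B) * var_y ^ B' * V \<and>
      coeff2 V 0 0 \<noteq> 0 \<and> B' = (if c = 0 then B else 0)"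
  proof (cases "c = 0")
    case True
    thus ?thesis unfolding eq using U by (intro exI[of _ B] exI[of _ ?U]) (simp add: const2_simps)
  next
    case False
    thus ?thesis unfolding eq using U
      by (intro exI[of _ 0] exI[of _ "(var_y + const2 c) ^ B * ?U"])
         (simp add: coeff2_00_simps coeff2_00_power mult.assoc)
  qed
  have "blowup_chart None (var_x ^ A * var_y ^ B * U) =
     var_x ^ A * var_y ^ (A + B) * blowup_chart None U"
    by (simp add: subst2_mult subst2_power subst2_var power_add power_mult_distrib algebra_simps)
  moreover have "coeff2 (blowup_chart None U) 0 0 \<noteq> 0" unfolding blowup_chart_hom by fact
  ultimately show "\<exists>V. blowup_chart None (var_x ^ A * var_y ^ B * U) = var_x ^ A * var_y ^ (A + B) * V \<and>
      coeff2 V 0 0 \<noteq> 0" by blast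
qed

text \<open>
  The last two conditions are the discrepancy inequalities for the at most two curves through the point.
\<close>

definition monomial_over :: "real \<Rightarrow> complex poly poly \<Rightarrow> inf_near \<Rightarrow> nat \<Rightarrow> nat \<Rightarrow> nat \<Rightarrow> nat \<Rightarrow> bool" where
  "monomial_over \<mu> g w A B \<alpha> \<beta> \<longleftrightarrow> (\<exists>U V. coeff2 U 0 0 \<noteq> 0 \<and> coeff2 V 0 0 \<noteq> 0 \<and>
     pullback w g = var_x ^ A * var_y ^ B * U \<and> jac w = var_x ^ \<alpha> * var_y ^ \<beta> * V \<and>
     \<mu> * real A \<le> real \<alpha> + 1 \<and> \<mu> * real B \<le> real \<beta> + 1)"

lemma monomial_over_snoc:
  assumes "monomial_over \<mu> g w A B \<alpha> \<beta>"
  shows "\<exists>B' \<beta>'. monomial_over \<mu> g (w @ [Some c]) (A + B) B' (\<alpha> + \<beta> + 1) \<beta>'"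
    and "monomial_over \<mu> g (w @ [None]) A (A + B) \<alpha> (\<alpha> + \<beta> + 1)"
proof -
  from assms obtain U V where UV: "coeff2 U 0 0 \<noteq> 0" "coeff2 V 0 0 \<noteq> 0"
    "pullback w g = var_x ^ A * var_y ^ B * U" "jac w = var_x ^ \<alpha> * var_y ^ \<beta> * V"
    and le: "\<mu> * real A \<le> real \<alpha> + 1" "\<mu> * real B \<le> real \<beta> + 1"
    by (auto simp: monomial_over_def)
  have sum: "\<mu> * real (A + B) \<le> real (\<alpha> + \<beta> + 1) + 1" using le by (simp add: algebra_simps)
  obtain B' U' where 1: "blowup_chart (Some c) (pullback w g) = var_x ^ (A + B) * var_y ^ B' * U'"
      "coeff2 U' 0 0 \<noteq> 0" "B' = (if c = 0 then B else 0)"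
    using chart_monomial(1)[OF UV(1)] unfolding UV(3) by blast
  obtain \<beta>' V' where 2: "blowup_chart (Some c) (jac w) = var_x ^ (\<alpha> + \<beta>) * var_y ^ \<beta>' * V'"
      "coeff2 V' 0 0 \<noteq> 0" "\<beta>' = (if c = 0 then \<beta> else 0)"
    using chart_monomial(1)[OF UV(2)] unfolding UV(4) by blast
  have "jac (w @ [Some c]) = var_x ^ (\<alpha> + \<beta> + 1) * var_y ^ \<beta>' * V'"
    unfolding jac_snoc 2(1) by simp
  moreover have "\<mu> * real B' \<le> real \<beta>' + 1" using le 1(3) 2(3) by simp
  ultimately show "\<exists>B' \<beta>'. monomial_over \<mu> g (w @ [Some c]) (A + B) B' (\<alpha> + \<beta> + 1) \<beta>'"
    using 1 2 sum unfolding monomial_over_def pullback_snoc by blast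
  obtain U' where 3: "blowup_chart None (pullback w g) = var_x ^ A * var_y ^ (A + B) * U'"
      "coeff2 U' 0 0 \<noteq> 0"
    using chart_monomial(2)[OF UV(1)] unfolding UV(3) by blast
  obtain V' where 4: "blowup_chart None (jac w) = var_x ^ \<alpha> * var_y ^ (\<alpha> + \<beta>) * V'"
      "coeff2 V' 0 0 \<noteq> 0"
    using chart_monomial(2)[OF UV(2)] unfolding UV(4) by blast
  have "jac (w @ [None]) = var_x ^ \<alpha> * var_y ^ (\<alpha> + \<beta> + 1) * V'"
    unfolding jac_snoc 4(1) by simp
  thus "monomial_over \<mu> g (w @ [None]) A (A + B) \<alpha> (\<alpha> + \<beta> + 1)"
    using 3 4 le sum unfolding monomial_over_def pullback_snoc by blast
qed


lemma const2_minus: "const2 (- z) = - const2 (z :: 'a::comm_ring_1)"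
  by (simp add: const2_def)

lemma root_form_homogenize: "root_form z = homogenize 1 [:-z, 1:]"
  by (simp add: homogenize_def root_form_def const2_simps const2_minus)

lemma homogenize_root_factor:
  assumes "f \<noteq> 0" "degree f \<le> d"
  obtains f' where "f = [:-z, 1:] ^ order z f * f'" "poly f' z \<noteq> 0" "degree f' \<le> d - order z f"
    "homogenize d f = root_form z ^ order z f * homogenize (d - order z f) f'"
proof -
  obtain f' where f': "f = [:-z, 1:] ^ order z f * f'" "\<not> [:-z, 1:] dvd f'"
    using order_decomp[OF assms(1)] by blast
  have "f' \<noteq> 0" using f' assms(1) by auto
  have deg: "degree f = order z f + degree f'"
    by (subst f'(1), subst degree_mult_eq) (use \<open>f' \<noteq> 0\<close> in \<open>auto simp: degree_power_eq\<close>)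
  hence le: "degree f' \<le> d - order z f" "order z f \<le> d" using assms(2) by auto
  have "root_form z ^ order z f * homogenize (d - order z f) f' = homogenize d f"
  proof -
    have "degree ([:-z, 1:] ^ order z f) \<le> order z f" by (simp add: degree_power_eq)
    thus ?thesis using le
      by (simp add: root_form_homogenize homogenize_power homogenize_mult flip: f'(1))
  qed
  moreover have "poly f' z \<noteq> 0" using f'(2) by (simp add: poly_eq_0_iff_dvd)
  ultimately show thesis using that[OF f'(1) _ le(1)] by simp
qed

lemma homogenize_split_y:
  assumes "degree f \<le> d" shows "homogenize d f = var_y ^ (d - degree f) * homogenize (degree f) f"
  using assms homogenize_mult[of 1 "d - degree f" f "degree f"] by (simp add: homogenize_one)

lemma multiplicity_root_form:
  assumes "f \<noteq> 0" "degree f \<le> d" shows "multiplicity (root_form z) (homogenize d f) = order z f"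
proof (rule multiplicity_eqI)
  obtain f' where f': "homogenize d f = root_form z ^ order z f * homogenize (d - order z f) f'"
    using homogenize_root_factor[OF assms] by metis
  thus "root_form z ^ order z f dvd homogenize d f" by simp
  show "\<not> root_form z ^ Suc (order z f) dvd homogenize d f"
  proof
    assume "root_form z ^ Suc (order z f) dvd homogenize d f"
    then obtain h where "homogenize d f = root_form z ^ Suc (order z f) * h" ..
    hence "poly (homogenize d f) 1 = poly (root_form z ^ Suc (order z f) * h) 1" by simp
    hence "f = [:-z, 1:] ^ Suc (order z f) * poly h 1"
      using assms(2) by (simp add: poly_homogenize root_form_homogenize poly_power del: power_Suc)
    thus False using order_2[OF assms(1)] by (metis dvd_triv_left)
  qed
qed

lemma multiplicity_var_y:
  assumes "f \<noteq> 0" "degree f \<le> d"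
  shows "multiplicity var_y (homogenize d f :: complex poly poly) = d - degree f"
proof (rule multiplicity_eqI)
  show "var_y ^ (d - degree f) dvd homogenize d f" using homogenize_split_y[OF assms(2)] by simp
  show "\<not> var_y ^ Suc (d - degree f) dvd homogenize d f"
  proof
    assume "var_y ^ Suc (d - degree f) dvd homogenize d f"
    then obtain h where h: "homogenize d f = var_y ^ Suc (d - degree f) * h" ..
    have "var_y ^ Suc (d - degree f) = monom (1 :: complex poly) (Suc (d - degree f))"
      by (simp add: var_y_def monom_altdef)
    hence "coeff2 (homogenize d f) (degree f) (d - degree f) = 0"
      unfolding h coeff2_def by (simp add: coeff_monom_mult)
    thus False using assms by (simp add: coeff2_homogenize)
  qed
qed

lemma blowup_Some_homogenize:
  "blowup_chart (Some c) (homogenize n f) = var_x ^ n * (\<Sum>i\<le>n. const2 (coeff f i) * (var_y + const2 c) ^ (n - i))"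
proof -
  have "blowup_chart (Some c) (const2 a * var_x ^ i * var_y ^ (n - i)) =
    var_x ^ n * (const2 a * (var_y + const2 c) ^ (n - i))" if "i \<le> n" for i a
  proof -
    have "var_x ^ n = var_x ^ i * (var_x :: complex poly poly) ^ (n - i)"
      using that by (simp flip: power_add)
    thus ?thesis by (simp only: blowup_chart.simps subst2_mult subst2_power subst2_var subst2_const
        power_mult_distrib mult_ac)
  qed
  thus ?thesis unfolding homogenize_def sum_distrib_left by (simp add: subst2_sum)
qed

lemma coeff2_00_sum: "coeff2 (sum F A) 0 0 = (\<Sum>x\<in>A. coeff2 (F x) 0 0)"
  by (simp add: coeff2_def coeff_sum)

lemma blowup_None_homogenize:
  assumes "degree f \<le> n"
  shows "blowup_chart None (homogenize n f) = var_y ^ n * [:f:]"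
proof -
  have "blowup_chart None (homogenize n f) = var_y ^ n * (\<Sum>i\<le>n. const2 (coeff f i) * var_x ^ i)"
  proof -
    have "blowup_chart None (const2 a * var_x ^ i * var_y ^ (n - i)) = var_y ^ n * (const2 a * var_x ^ i)"
      if "i \<le> n" for i a
    proof -
      have "var_y ^ n = var_y ^ i * (var_y :: complex poly poly) ^ (n - i)"
        using that by (simp flip: power_add)
      thus ?thesis by (simp only: blowup_chart.simps subst2_mult subst2_power subst2_var subst2_const
          power_mult_distrib mult_ac)
    qed
    thus ?thesis unfolding homogenize_def sum_distrib_left by (simp add: subst2_sum)
  qed
  also have "(\<Sum>i\<le>n. const2 (coeff f i) * var_x ^ i) = [:\<Sum>i\<le>n. monom (coeff f i) i:]"
  proof -
    have "const2 (coeff f i) * var_x ^ i = [:monom (coeff f i) i:]" for i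
      using const2_mult_powers[of "coeff f i" i 0] by (simp add: monom_0)
    moreover have "(\<Sum>i\<in>A. [:F i:]) = [:\<Sum>i\<in>A. F i:]" for A :: "nat set" and F :: "nat \<Rightarrow> complex poly"
      by (induction A rule: infinite_finite_induct) simp_all
    ultimately show ?thesis by simp
  qed
  also have "\<dots> = [:f:]" using poly_as_sum_of_monoms'[OF assms] by simp
  finally show ?thesis .
qed

lemma jac_single: "jac [c] = (case c of Some _ \<Rightarrow> var_x | None \<Rightarrow> var_y)"
  using jac_snoc[of "[]" c] by (cases c) (simp_all add: jac_Nil)

text \<open>
  Over the origin, \<open>G\<close> vanishes along the exceptional curve to the order \<open>d\<close>, and along a transversal
  curve to the order of the linear factor of \<open>G\<close> with the given tangent direction, which is at most
  \<open>M\<close>.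
\<close>

lemma monomial_over_first:
  assumes f: "f \<noteq> 0" "degree f \<le> d"
    and M: "\<And>z. order z f \<le> M" "d - degree f \<le> M"
    and mu: "\<mu> \<ge> 0" "\<mu> * real d \<le> 2" "\<mu> * real M \<le> 1"
  shows "\<exists>B. monomial_over \<mu> (homogenize d f) [Some c] d B 1 0"
    and "\<exists>A. monomial_over \<mu> (homogenize d f) [None] A d 0 1"
proof -
  have muM: "\<mu> * real m \<le> 1" if "m \<le> M" for m
    using mult_left_mono[of "real m" "real M" \<mu>] mu that by simp
  have one: "coeff2 (1 :: complex poly poly) 0 0 = 1" by (simp add: coeff2_def)
  have "\<exists>m U. m \<le> M \<and> coeff2 U 0 0 \<noteq> 0 \<and> blowup_chart (Some c) (homogenize d f) = var_x ^ d * var_y ^ m * U"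
  \<comment> \<open>The direction \<open>[1 : c]\<close> is the zero of \<open>y\<close> for \<open>c = 0\<close>, and of the linear form that belongs to
    the root \<open>1 / c\<close> otherwise.\<close>
  proof (cases "c = 0")
    case True
    define K where "K = (\<Sum>i\<le>degree f. const2 (coeff f i) * var_y ^ (degree f - i))"
    have "coeff2 K 0 0 = (\<Sum>i\<le>degree f. if i = degree f then coeff f i else 0)"
      unfolding K_def coeff2_00_sum
      by (intro sum.cong) (auto simp: coeff2_00_simps coeff2_00_power one power_0_left)
    hence "coeff2 K 0 0 \<noteq> 0" using f by (simp add: sum.delta)
    moreover have "blowup_chart (Some c) (homogenize d f) = var_x ^ d * var_y ^ (d - degree f) * K"
    proof -
      have "blowup_chart (Some c) (homogenize d f) = (var_x * var_y) ^ (d - degree f) * (var_x ^ degree f * K)"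
        using blowup_Some_homogenize[of c "degree f" f] True
        by (subst homogenize_split_y[OF f(2)], subst blowup_chart_hom(1), subst blowup_chart_hom(2))
           (simp add: subst2_var const2_simps K_def)
      also have "\<dots> = var_x ^ (d - degree f + degree f) * var_y ^ (d - degree f) * K"
        by (simp only: power_add power_mult_distrib mult_ac)
      finally show ?thesis using f(2) by simp
    qed
    ultimately show ?thesis using M(2) by blast
  next
    case False
    define z where "z = 1 / c"
    obtain f' where f': "f = [:-z, 1:] ^ order z f * f'" "poly f' z \<noteq> 0" "degree f' \<le> d - order z f"
      "homogenize d f = root_form z ^ order z f * homogenize (d - order z f) f'" by (rule homogenize_root_factor[OF f])
    define m where "m = order z f"
    have "m \<le> d" using order_degree[OF f(1), of z] f(2) by (simp add: m_def)
    define K where "K = (\<Sum>i\<le>d-m. const2 (coeff f' i) * (var_y + const2 c) ^ (d - m - i))"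
    have "coeff2 K 0 0 = (\<Sum>i\<le>d-m. coeff f' i * c ^ (d - m - i))"
      by (simp add: K_def coeff2_00_sum coeff2_00_simps coeff2_00_power)
    also have "\<dots> = (\<Sum>i\<le>d-m. c ^ (d - m) * (coeff f' i * z ^ i))"
    proof (rule sum.cong[OF refl])
      fix i assume "i \<in> {..d - m}"
      hence "d - m = (d - m - i) + i" by simp
      hence "c ^ (d - m) = c ^ (d - m - i) * c ^ i" by (metis power_add)
      hence "c ^ (d - m - i) = c ^ (d - m) * z ^ i" using False by (simp add: z_def power_one_over)
      thus "coeff f' i * c ^ (d - m - i) = c ^ (d - m) * (coeff f' i * z ^ i)" by simp
    qed
    also have "\<dots> = c ^ (d - m) * poly f' z"
    proof -
      have "poly f' z = (\<Sum>i\<le>d-m. coeff f' i * z ^ i)"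
        unfolding poly_altdef using f'(3)
        by (intro sum.mono_neutral_left) (auto simp: m_def coeff_eq_0)
      thus ?thesis by (simp add: sum_distrib_left)
    qed
    finally have K0: "coeff2 (const2 (-z) ^ m * K) 0 0 \<noteq> 0"
      using False f'(2) by (simp add: coeff2_00_simps coeff2_00_power z_def)
    have "blowup_chart (Some c) (root_form z) = const2 (-z) * (var_x * var_y)"
    proof -
      have "blowup_chart (Some c) (root_form z) = var_x - const2 z * (var_x * (var_y + const2 c))"
        by (simp add: root_form_def subst2_diff subst2_mult subst2_var subst2_const)
      also have "\<dots> = var_x - const2 (z * c) * var_x - const2 z * (var_x * var_y)"
        by (simp add: const2_simps algebra_simps)
      also have "const2 (z * c) = 1" using False by (simp add: z_def const2_simps)
      finally show ?thesis by (simp add: const2_minus)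
    qed
    hence "blowup_chart (Some c) (homogenize d f) = (const2 (-z) * (var_x * var_y)) ^ m * (var_x ^ (d - m) * K)"
      using blowup_Some_homogenize[of c "d - m" f']
      by (subst f'(4), subst blowup_chart_hom(1), subst blowup_chart_hom(2)) (simp add: K_def m_def)
    also have "\<dots> = var_x ^ (m + (d - m)) * var_y ^ m * (const2 (-z) ^ m * K)"
      by (simp only: power_add power_mult_distrib mult_ac)
    finally have "blowup_chart (Some c) (homogenize d f) = var_x ^ d * var_y ^ m * (const2 (-z) ^ m * K)"
      using \<open>m \<le> d\<close> by simp
    thus ?thesis using K0 M(1)[of z] unfolding m_def by blast
  qed
  then obtain m U where "m \<le> M" "coeff2 U 0 0 \<noteq> 0"
    "blowup_chart (Some c) (homogenize d f) = var_x ^ d * var_y ^ m * U" by blast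
  thus "\<exists>B. monomial_over \<mu> (homogenize d f) [Some c] d B 1 0"
    unfolding monomial_over_def using mu muM one
    by (intro exI[of _ m] exI[of _ U] exI[of _ 1]) (simp add: pullback_def jac_single)
  obtain f' where f': "f = [:-0, 1:] ^ order 0 f * f'" "poly f' 0 \<noteq> 0" by (rule homogenize_root_factor[OF f])
  have "[:f:] = var_x ^ order 0 f * [:f':]"
    by (subst f'(1)) (simp add: var_x_def poly_const_pow)
  hence "blowup_chart None (homogenize d f) = var_x ^ order 0 f * var_y ^ d * [:f':]"
    unfolding blowup_None_homogenize[OF f(2)] by (simp only: mult_ac)
  moreover have "coeff2 [:f':] 0 0 \<noteq> 0" using f'(2) by (simp add: coeff2_def poly_0_coeff_0)
  ultimately show "\<exists>A. monomial_over \<mu> (homogenize d f) [None] A d 0 1"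
    unfolding monomial_over_def using mu muM[OF M(1)] one
    by (intro exI[of _ "order 0 f"] exI[of _ "[:f':]"] exI[of _ 1]) (simp add: pullback_def jac_single)
qed

section \<open>The log canonical threshold of a binary form\<close>

lemma monomial_over_nonempty:
  assumes f: "f \<noteq> 0" "degree f \<le> d"
    and M: "\<And>z. order z f \<le> M" "d - degree f \<le> M"
    and mu: "\<mu> \<ge> 0" "\<mu> * real d \<le> 2" "\<mu> * real M \<le> 1" and d: "d \<ge> 1" and "w \<noteq> []"
  shows "\<exists>A B \<alpha> \<beta>. monomial_over \<mu> (homogenize d f) w A B \<alpha> \<beta> \<and> A + B \<ge> 1"
  using \<open>w \<noteq> []\<close>
proof (induction w rule: rev_nonempty_induct)
  case (single c)
  show ?case
  proof (cases c)
    case None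
    thus ?thesis using monomial_over_first(2)[OF f M mu] d by (metis trans_le_add2)
  next
    case (Some a)
    thus ?thesis using monomial_over_first(1)[OF f M mu, of a] d by (metis trans_le_add1)
  qed
next
  case (snoc c w)
  then obtain A B \<alpha> \<beta> where *: "monomial_over \<mu> (homogenize d f) w A B \<alpha> \<beta>" "A + B \<ge> 1" by blast
  show ?case
  proof (cases c)
    case None
    thus ?thesis using monomial_over_snoc(2)[OF *(1)] *(2) by (metis trans_le_add2)
  next
    case (Some a)
    thus ?thesis using monomial_over_snoc(1)[OF *(1), of a] *(2) by (metis trans_le_add1)
  qed
qed

lemma exc_monomial_over:
  assumes "monomial_over \<mu> g (w @ [Some 0]) A B \<alpha> \<beta>"
  shows "exc_ord w g = A" "exc_discr w = \<alpha>" "\<mu> * real A \<le> real \<alpha> + 1"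
  using assms by (auto simp: monomial_over_def exc_ord_def exc_discr_def multiplicity_var_x_monomial)

text \<open>
  The chart \<open>Some 0\<close> shows the exceptional curve of \<open>w\<close> as \<open>x = 0\<close>, so its order and discrepancy are
  the exponents of \<open>x\<close> there.
\<close>

lemma exceptional_ratio:
  assumes f: "f \<noteq> 0" "degree f \<le> d"
    and M: "\<And>z. order z f \<le> M" "d - degree f \<le> M"
    and mu: "\<mu> \<ge> 0" "\<mu> * real d \<le> 2" "\<mu> * real M \<le> 1" and d: "d \<ge> 1"
  shows "\<mu> \<le> real (exc_discr w + 1) / real (exc_ord w (homogenize d f))"
    and "real (exc_discr [] + 1) / real (exc_ord [] (homogenize d f)) = 2 / real d"
proof -
  obtain B where B: "monomial_over \<mu> (homogenize d f) ([] @ [Some 0]) d B 1 0"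
    using monomial_over_first(1)[OF f M mu, of 0] by auto
  show "real (exc_discr [] + 1) / real (exc_ord [] (homogenize d f)) = 2 / real d"
    using exc_monomial_over[OF B] by simp
  have "\<exists>A B \<alpha> \<beta>. monomial_over \<mu> (homogenize d f) (w @ [Some 0]) A B \<alpha> \<beta> \<and> A \<ge> 1"
  proof (cases "w = []")
    case True
    thus ?thesis using B d by auto
  next
    case False
    from monomial_over_nonempty[OF f M mu d False] obtain A B \<alpha> \<beta> where
      "monomial_over \<mu> (homogenize d f) w A B \<alpha> \<beta>" "A + B \<ge> 1" by blast
    thus ?thesis using monomial_over_snoc(1)[of \<mu> _ w A B \<alpha> \<beta> 0] by blast
  qed
  then obtain A B \<alpha> \<beta> where "monomial_over \<mu> (homogenize d f) (w @ [Some 0]) A B \<alpha> \<beta>" "A \<ge> 1" by blast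
  thus "\<mu> \<le> real (exc_discr w + 1) / real (exc_ord w (homogenize d f))"
    using exc_monomial_over[of \<mu> "homogenize d f" w A B \<alpha> \<beta>] by (simp add: le_divide_eq)
qed

lemma blowup_origin_log_resolution:
  assumes f: "f \<noteq> 0" "degree f \<le> d" and d: "d \<ge> 1"
  shows "log_resolution (homogenize d f) {[]}"
  unfolding log_resolution_def
proof (intro conjI ballI)
  show "blowup_cluster {[]}" by (simp add: blowup_cluster_def)
  fix w assume "w \<in> points_over {[]}"
  hence w: "w \<noteq> []" by (simp add: points_over_def)
  have M: "order z f \<le> d" for z using order_degree[OF f(1), of z] f(2) by linarith
  \<comment> \<open>Only the monomial form is of interest here, so the trivial factor \<open>0\<close> will do.\<close>
  have "(0::real) \<ge> 0" "0 * real d \<le> 2" "0 * real d \<le> 1" by simp_all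
  from monomial_over_nonempty[OF f M _ this d w]
  obtain A B \<alpha> \<beta> where "monomial_over 0 (homogenize d f) w A B \<alpha> \<beta>" by auto
  then obtain U V where UV: "coeff2 U 0 0 \<noteq> 0" "coeff2 V 0 0 \<noteq> 0"
     "pullback w (homogenize d f) = var_x ^ A * var_y ^ B * U" "jac w = var_x ^ \<alpha> * var_y ^ \<beta> * V"
    unfolding monomial_over_def by blast
  have "1 * (pullback w (homogenize d f) * jac w) = (U * V) * var_x ^ (A + \<alpha>) * var_y ^ (B + \<beta>)"
    unfolding UV by (simp add: power_add mult_ac)
  moreover have "coeff2 (1 :: complex poly poly) 0 0 \<noteq> 0" by (simp add: coeff2_def)
  moreover have "coeff2 (jacobian var_x var_y :: complex poly poly) 0 0 \<noteq> 0"
    unfolding jacobian_vars by (simp add: coeff2_def)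
  moreover have "coeff2 (U * V) 0 0 \<noteq> 0" using UV by (simp add: coeff2_00_simps)
  ultimately show "snc_at_origin (pullback w (homogenize d f) * jac w)"
    unfolding snc_at_origin_def using coeff2_00_simps(4,5) by blast
qed

lemma prime_factor_of_homogenize:
  assumes "prime_elem q" "f \<noteq> 0" "q dvd homogenize (degree f) f"
  shows "\<exists>z. poly f z = 0 \<and> q dvd root_form z"
  using assms(2,3)
proof (induction "degree f" arbitrary: f rule: less_induct)
  case less
  show ?case
  proof (cases "degree f = 0")
    case True
    then obtain c where c: "f = [:c:]" by (rule degree_eq_zeroE)
    hence "c \<noteq> 0" using less.prems by auto
    hence "const2 c * const2 (1 / c) = 1" by (simp add: const2_simps flip: const2_simps(4))
    moreover have "q dvd const2 c" using less.prems(2) by (simp add: c homogenize_const)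
    ultimately have "q dvd 1" by (metis dvd_mult2)
    thus ?thesis using assms(1) by (simp add: prime_elem_def)
  next
    case False
    then obtain z where z: "poly f z = 0"
      using fundamental_theorem_of_algebra[of f] by (auto simp: constant_degree)
    then obtain h where h: "f = [:-z, 1:] * h" by (auto simp: poly_eq_0_iff_dvd)
    have "h \<noteq> 0" using h less.prems(1) by auto
    hence deg: "degree f = 1 + degree h" unfolding h by (subst degree_mult_eq) auto
    have "homogenize (degree f) f = root_form z * homogenize (degree h) h"
      unfolding deg root_form_homogenize by (subst homogenize_mult) (auto simp: h)
    hence "q dvd root_form z \<or> q dvd homogenize (degree h) h"
      using less.prems(2) assms(1) by (simp add: prime_elem_dvd_mult_iff)
    thus ?thesis
    proof
      assume "q dvd homogenize (degree h) h"
      from less.hyps[OF _ \<open>h \<noteq> 0\<close> this] deg obtain z where "poly h z = 0" "q dvd root_form z" by auto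
      thus ?thesis unfolding h by auto
    qed (use z in blast)
  qed
qed

lemma multiplicity_irreducible_dvd_prime:
  fixes q l g :: "complex poly poly"
  assumes "irreducible q" "prime_elem l" "q dvd l"
  shows "multiplicity q g = multiplicity l g"
proof -
  obtain u where "l = q * u" using assms(3) by (rule dvdE)
  hence u: "l = u * q" by (simp only: mult.commute)
  have "irreducible l" using assms(2) by (rule prime_elem_imp_irreducible)
  hence "is_unit u" using irreducibleD[OF _ u] assms(1) irreducible_not_unit by blast
  thus ?thesis unfolding u by (simp add: multiplicity_times_unit_left)
qed

text \<open>
  The first element is the multiplicity of \<open>y\<close> in the homogenization of degree \<open>d\<close>, possibly zero.
\<close>

definition factor_mults :: "nat \<Rightarrow> complex poly \<Rightarrow> nat set" where
  "factor_mults d f = insert (d - degree f) ((\<lambda>z. order z f) ` {z. poly f z = 0})"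

lemma finite_factor_mults: "f \<noteq> 0 \<Longrightarrow> finite (factor_mults d f)"
  by (simp add: factor_mults_def poly_roots_finite)

lemma factor_mults_bounds:
  assumes "f \<noteq> 0" 
  shows "order z f \<le> Max (factor_mults d f)" "d - degree f \<le> Max (factor_mults d f)"
proof -
  show "d - degree f \<le> Max (factor_mults d f)"
    using finite_factor_mults[OF assms] by (intro Max_ge) (auto simp: factor_mults_def)
  show "order z f \<le> Max (factor_mults d f)"
  proof (cases "poly f z = 0")
    case True
    thus ?thesis using finite_factor_mults[OF assms] by (intro Max_ge) (auto simp: factor_mults_def)
  qed (simp add: order_0I)
qed

lemma Max_factor_mults_pos:
  assumes "f \<noteq> 0" "degree f \<le> d" "d \<ge> 1" shows "Max (factor_mults d f) \<ge> 1"
proof (cases "degree f = d")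
  case True
  then obtain z where "poly f z = 0"
    using assms(3) fundamental_theorem_of_algebra[of f] by (auto simp: constant_degree)
  hence "order z f \<ge> 1" using assms(1) order_root[of f z] by (cases "order z f") auto
  thus ?thesis using factor_mults_bounds(1)[OF assms(1), of z d] by linarith
next
  case False
  thus ?thesis using factor_mults_bounds(2)[OF assms(1), of d] assms(2) by linarith
qed

definition component_thresholds :: "complex poly poly \<Rightarrow> real set" where
  "component_thresholds g = {1 / real (multiplicity q g) | q. irreducible q \<and> q dvd g \<and> coeff2 q 0 0 = 0}"

lemma component_thresholds_homogenize:
  assumes f: "f \<noteq> 0" "degree f \<le> d" and d: "d \<ge> 1"
  shows "finite (component_thresholds (homogenize d f))"
    and "x \<in> component_thresholds (homogenize d f) \<Longrightarrow> x \<ge> 1 / real (Max (factor_mults d f))"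
    and "1 / real (Max (factor_mults d f)) \<in> component_thresholds (homogenize d f)"
proof -
  let ?M = "Max (factor_mults d f)"
  have homogenize_nz: "homogenize d f \<noteq> 0" using f poly_homogenize[OF f(2)] by auto
  have mult: "\<exists>k. 1 \<le> k \<and> k \<le> ?M \<and> x = 1 / real k" if "x \<in> component_thresholds (homogenize d f)" for x
  proof -
    from that obtain q where q: "irreducible q" "q dvd homogenize d f" "x = 1 / real (multiplicity q (homogenize d f))"
      by (auto simp: component_thresholds_def)
    have "prime_elem q" using q(1) by (rule irreducible_imp_prime_elem)
    hence "q dvd var_y \<or> q dvd homogenize (degree f) f"
      using q(2) unfolding homogenize_split_y[OF f(2)]
      by (auto simp: prime_elem_dvd_mult_iff dest: prime_elem_dvd_power)
    hence "multiplicity q (homogenize d f) \<le> ?M"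
    proof
      assume "q dvd var_y"
      from multiplicity_irreducible_dvd_prime[OF q(1) prime_elem_var_y this]
      show ?thesis using factor_mults_bounds(2)[OF f(1)] by (simp add: multiplicity_var_y[OF f])
    next
      assume "q dvd homogenize (degree f) f"
      from prime_factor_of_homogenize[OF \<open>prime_elem q\<close> f(1) this] obtain z where "q dvd root_form z" by blast
      from multiplicity_irreducible_dvd_prime[OF q(1) prime_elem_root_form this]
      show ?thesis using factor_mults_bounds(1)[OF f(1)] by (simp add: multiplicity_root_form[OF f])
    qed
    moreover have "multiplicity q (homogenize d f) > 0"
      using q(2) \<open>prime_elem q\<close> homogenize_nz prime_elem_multiplicity_eq_zero_iff[of q "homogenize d f"] by auto
    ultimately show ?thesis using q(3) by (intro exI[of _ "multiplicity q (homogenize d f)"]) auto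
  qed
  show "finite (component_thresholds (homogenize d f))"
    by (rule finite_subset[of _ "(\<lambda>k. 1 / real k) ` {..?M}"]) (use mult in force)+
  show "x \<ge> 1 / real ?M" if "x \<in> component_thresholds (homogenize d f)"
    using mult[OF that] by (auto simp: frac_le)
  have comp: "1 / real (multiplicity l (homogenize d f)) \<in> component_thresholds (homogenize d f)"
    if "prime_elem l" "coeff2 l 0 0 = 0" "multiplicity l (homogenize d f) \<ge> 1" for l
  proof -
    have "l dvd homogenize d f"
      using that(3) not_dvd_imp_multiplicity_0 by (metis not_one_le_zero)
    thus ?thesis using that prime_elem_imp_irreducible[OF that(1)]
      unfolding component_thresholds_def by blast
  qed
  have "?M \<in> factor_mults d f" using finite_factor_mults[OF f(1)] by (intro Max_in) (auto simp: factor_mults_def)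
  then consider "?M = d - degree f" | z where "?M = order z f" unfolding factor_mults_def by blast
  thus "1 / real ?M \<in> component_thresholds (homogenize d f)"
  proof cases
    case 1
    have "multiplicity var_y (homogenize d f) = ?M" unfolding 1 by (rule multiplicity_var_y[OF f])
    thus ?thesis using comp[OF prime_elem_var_y] Max_factor_mults_pos[OF f d]
      by (simp add: coeff2_00_simps)
  next
    case (2 z)
    have "multiplicity (root_form z) (homogenize d f) = ?M" unfolding 2 by (rule multiplicity_root_form[OF f])
    thus ?thesis using comp[OF prime_elem_root_form, of z] Max_factor_mults_pos[OF f d]
      by (simp add: root_form_def coeff2_00_diff coeff2_00_simps)
  qed
qed

text \<open>
  The substitution \<open>(u, v) \<mapsto> (u v, v)\<close> sorts a polynomial by degree: the coefficient
  of \<open>v\<^sup>n\<close> is the dehomogenized homogeneous component of degree \<open>n\<close>.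
\<close>

lemma blowup_None_linear_terms:
  "coeff (blowup_chart None g) 0 = [:coeff2 g 0 0:]"
  "coeff (blowup_chart None g) 1 = [:coeff2 g 0 1, coeff2 g 1 0:]"
proof -
  have mult1: "coeff (g * h) (Suc 0) = coeff g 0 * coeff h (Suc 0) + coeff g (Suc 0) * coeff h 0" for g h :: "'b::comm_semiring_1 poly"
    by (simp add: coeff_mult)
  have "coeff (blowup_chart None g) 0 = [:coeff2 g 0 0:] \<and>
    coeff (blowup_chart None g) 1 = [:coeff2 g 0 1, coeff2 g 1 0:]"
  proof (induction g rule: poly2_induct)
    case (add g h)
    thus ?case by (simp add: subst2_add coeff2_def)
  next
    case (mult g h)
    thus ?case
      unfolding blowup_chart_hom by (simp add: mult1 coeff_mult_0 coeff2_def algebra_simps)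
  qed (simp_all add: subst2_const subst2_var, auto simp: const2_def var_x_def var_y_def coeff2_def)
  thus "coeff (blowup_chart None g) 0 = [:coeff2 g 0 0:]"
    "coeff (blowup_chart None g) 1 = [:coeff2 g 0 1, coeff2 g 1 0:]" by blast+
qed

lemma monom_mult_eq:
  fixes P Q :: "'a::idom poly"
  assumes "monom 1 m * P = monom 1 n * Q" "coeff P 0 \<noteq> 0" "coeff Q 0 \<noteq> 0"
  shows "m = n" "P = Q"
proof -
  have le: "n \<le> m" if "monom 1 m * P = monom 1 n * Q" "coeff P 0 \<noteq> 0" for m n and P Q :: "'a poly"
  proof (rule ccontr)
    assume "\<not> n \<le> m"
    hence "coeff (monom 1 n * Q) m = 0" by (simp add: coeff_monom_mult)
    hence "coeff (monom 1 m * P) m = 0" by (simp only: that(1))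
    thus False using that(2) by (simp add: coeff_monom_mult)
  qed
  from le[OF assms(1,2)] le[OF assms(1)[symmetric] assms(3)] show "m = n" by simp
  thus "P = Q" using assms(1) by simp
qed

text \<open>
  For \<open>\<alpha>1 = 0\<close> the first linear form is a multiple of \<open>y\<close>, whose multiplicity shows in the drop of
  the degree.
\<close>

lemma linear_power_exponent_le:
  assumes f: "f \<noteq> 0" "degree f \<le> d" and st: "s \<noteq> 0" "t \<noteq> 0" and "d = a + b"
    and eq: "smult s f = smult t ([:\<beta>1, \<alpha>1:] ^ a * [:\<beta>2, \<alpha>2:] ^ b)"
    and det: "\<alpha>1 * \<beta>2 - \<beta>1 * \<alpha>2 \<noteq> 0"
  shows "a \<le> Max (factor_mults d f)"
proof (cases "\<alpha>1 = 0")
  case True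
  hence nz: "\<beta>1 \<noteq> 0" "\<alpha>2 \<noteq> 0" using det by auto
  have "degree f = degree (smult s f)" using st by simp
  also have "\<dots> = degree ([:\<beta>1 ^ a:] * [:\<beta>2, \<alpha>2:] ^ b)"
    unfolding eq using True st by (simp add: poly_const_pow)
  also have "\<dots> = b" using nz by (simp add: degree_power_eq)
  finally show ?thesis using factor_mults_bounds(2)[OF f(1), of d] \<open>d = a + b\<close> by simp
next
  case False
  define z where "z = - \<beta>1 / \<alpha>1"
  have "[:\<beta>1, \<alpha>1:] = smult \<alpha>1 [:-z, 1:]" using False by (simp add: z_def)
  hence "[:-z, 1:] dvd [:\<beta>1, \<alpha>1:]" by (metis dvd_refl dvd_smult)
  hence "[:-z, 1:] ^ a dvd [:\<beta>1, \<alpha>1:] ^ a" by (rule dvd_power_same)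
  hence "[:-z, 1:] ^ a dvd smult s f" unfolding eq by (intro dvd_smult dvd_mult2)
  hence "[:-z, 1:] ^ a dvd f" using st by (simp add: dvd_smult_iff)
  hence "a \<le> order z f" using f(1) by (simp add: order_divides)
  thus ?thesis using factor_mults_bounds(1)[OF f(1), of z d] by linarith
qed

text \<open>
  This is the case in which no point needs to be blown up.  Comparing the terms of lowest degree in the
  equation \<open>s G = t z\<^sub>1\<^sup>a z\<^sub>2\<^sup>b\<close> shows that \<open>G\<close> is a constant times \<open>l\<^sub>1\<^sup>a l\<^sub>2\<^sup>b\<close> for the linear parts
  of \<open>z\<^sub>1\<close> and \<open>z\<^sub>2\<close>, which are independent.  So \<open>d = a + b\<close>, and both exponents are at most \<open>M\<close>.
\<close>

lemma snc_homogenize_imp: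
  assumes f: "f \<noteq> 0" "degree f \<le> d" and snc: "snc_at_origin (homogenize d f)"
  shows "d \<le> 2 * Max (factor_mults d f)"
proof -
  from snc obtain z1 z2 s t a b where z: "coeff2 z1 0 0 = 0" "coeff2 z2 0 0 = 0"
    and jac: "coeff2 (jacobian z1 z2) 0 0 \<noteq> 0"
    and st: "coeff2 s 0 0 \<noteq> 0" "coeff2 t 0 0 \<noteq> 0" and eq: "s * homogenize d f = t * z1 ^ a * z2 ^ b"
    unfolding snc_at_origin_def by blast
  define \<psi> where "\<psi> = blowup_chart None"
  have lin: "\<exists>K. \<psi> u = var_y * K \<and> coeff K 0 = [:coeff2 u 0 1, coeff2 u 1 0:]" if "coeff2 u 0 0 = 0" for u
  proof -
    obtain c K where K: "\<psi> u = pCons c K" by (cases "\<psi> u")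
    have "c = 0" "coeff K 0 = [:coeff2 u 0 1, coeff2 u 1 0:]"
      using blowup_None_linear_terms[of u] that K by (simp_all add: \<psi>_def)
    thus ?thesis using K by (intro exI[of _ K]) (simp add: var_y_def)
  qed
  obtain K1 where K1: "\<psi> z1 = var_y * K1" "coeff K1 0 = [:coeff2 z1 0 1, coeff2 z1 1 0:]" using lin[OF z(1)] by blast
  obtain K2 where K2: "\<psi> z2 = var_y * K2" "coeff K2 0 = [:coeff2 z2 0 1, coeff2 z2 1 0:]" using lin[OF z(2)] by blast
  have y: "var_y ^ n = monom (1 :: complex poly) n" for n by (simp add: var_y_def monom_altdef)
  have "\<psi> (s * homogenize d f) = \<psi> (t * z1 ^ a * z2 ^ b)" using eq by simp
  hence "\<psi> s * (var_y ^ d * [:f:]) = \<psi> t * (var_y * K1) ^ a * (var_y * K2) ^ b"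
    using blowup_None_homogenize[OF f(2)] by (simp only: \<psi>_def blowup_chart_hom K1(1)[unfolded \<psi>_def] K2(1)[unfolded \<psi>_def])
  hence eq': "monom 1 d * (\<psi> s * [:f:]) = monom 1 (a + b) * (\<psi> t * K1 ^ a * K2 ^ b)"
    unfolding y[symmetric] by (simp only: power_mult_distrib power_add mult_ac)
  have dxdy: "coeff2 (dx g) 0 0 = coeff2 g 1 0" "coeff2 (dy g) 0 0 = coeff2 g 0 1" for g :: "complex poly poly"
    by (simp_all add: dx_def dy_def coeff2_def coeff_map_poly coeff_pderiv)
  have det: "coeff2 z1 1 0 * coeff2 z2 0 1 - coeff2 z1 0 1 * coeff2 z2 1 0 \<noteq> 0"
    using jac by (simp add: jacobian_def coeff2_00_diff coeff2_00_simps dxdy)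
  have K0: "coeff K1 0 \<noteq> 0" "coeff K2 0 \<noteq> 0" using det unfolding K1(2) K2(2) by auto
  have \<psi>0: "coeff (\<psi> g) 0 = [:coeff2 g 0 0:]" for g unfolding \<psi>_def by (rule blowup_None_linear_terms)
  have c0: "coeff (P ^ n) 0 = coeff P 0 ^ n" for P :: "complex poly poly" and n
    by (induction n) (simp_all add: coeff_mult_0)
  have nz: "coeff (\<psi> s * [:f:]) 0 \<noteq> 0" "coeff (\<psi> t * K1 ^ a * K2 ^ b) 0 \<noteq> 0"
    using st f(1) K0 by (simp_all add: coeff_mult_0 \<psi>0 c0)
  from monom_mult_eq[OF eq' nz] have d: "d = a + b" and "\<psi> s * [:f:] = \<psi> t * K1 ^ a * K2 ^ b" by blast+
  hence "coeff (\<psi> s * [:f:]) 0 = coeff (\<psi> t * K1 ^ a * K2 ^ b) 0" by (simp only:)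
  hence E: "smult (coeff2 s 0 0) f = smult (coeff2 t 0 0)
      ([:coeff2 z1 0 1, coeff2 z1 1 0:] ^ a * [:coeff2 z2 0 1, coeff2 z2 1 0:] ^ b)"
    by (simp add: coeff_mult_0 \<psi>0 c0 K1(2) K2(2))
  have "a \<le> Max (factor_mults d f)"
    by (rule linear_power_exponent_le[OF f st d E det])
  moreover have "b \<le> Max (factor_mults d f)"
  proof (rule linear_power_exponent_le[OF f st])
    show "d = b + a" using d by simp
    show "smult (coeff2 s 0 0) f = smult (coeff2 t 0 0)
      ([:coeff2 z2 0 1, coeff2 z2 1 0:] ^ b * [:coeff2 z1 0 1, coeff2 z1 1 0:] ^ a)"
      using E by (simp only: mult.commute)
    show "coeff2 z2 1 0 * coeff2 z1 0 1 - coeff2 z2 0 1 * coeff2 z1 1 0 \<noteq> 0"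
      using det by (simp add: algebra_simps)
  qed
  ultimately show ?thesis using d by linarith
qed

text \<open>
  All log resolutions give the same value.  If the origin is blown up, its exceptional curve contributes
  \<open>2 / d\<close>; if not, then \<open>1 / M \<le> 2 / d\<close> by \<open>snc_homogenize_imp\<close>.  The component of
  multiplicity \<open>M\<close> contributes \<open>1 / M\<close>, and nothing else is smaller.
\<close>

theorem lct_homogenize:
  assumes f: "f \<noteq> 0" "degree f \<le> d" and d: "d \<ge> 1"
  shows "lct (homogenize d f) = min (2 / real d) (1 / real (Max (factor_mults d f)))"
proof -
  define M where "M = Max (factor_mults d f)"
  define \<mu> where "\<mu> = min (2 / real d) (1 / real M)"
  have M1: "M \<ge> 1" unfolding M_def by (rule Max_factor_mults_pos[OF f d])
  have Mb: "\<And>z. order z f \<le> M" "d - degree f \<le> M" unfolding M_def by (rule factor_mults_bounds[OF f(1)])+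
  have "\<mu> \<le> 2 / real d" "\<mu> \<le> 1 / real M" by (simp_all add: \<mu>_def)
  hence mu: "\<mu> \<ge> 0" "\<mu> * real d \<le> 2" "\<mu> * real M \<le> 1"
    using d M1 by (simp_all add: \<mu>_def le_divide_eq)
  note exc = exceptional_ratio[OF f Mb mu d]
  note comp = component_thresholds_homogenize[OF f d, folded M_def]
  have via: "lct_via (homogenize d f) T = \<mu>" if T: "log_resolution (homogenize d f) T" for T
  proof -
    let ?E = "(\<lambda>w. real (exc_discr w + 1) / real (exc_ord w (homogenize d f))) ` T"
    have cl: "blowup_cluster T" using T by (simp add: log_resolution_def)
    have fin: "finite (?E \<union> component_thresholds (homogenize d f))"
      using cl comp(1) by (simp add: blowup_cluster_def)
    have ge: "\<mu> \<le> x" if "x \<in> ?E \<union> component_thresholds (homogenize d f)" for x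
      using that exc(1) comp(2) \<open>\<mu> \<le> 1 / real M\<close> by (auto intro: order.trans)
    have "\<mu> \<in> ?E \<union> component_thresholds (homogenize d f)"
    proof (cases "T = {}")
      case True
      hence "[] \<in> points_over T" by (simp add: points_over_def)
      hence "snc_at_origin (pullback [] (homogenize d f) * jac [])" using T by (auto simp: log_resolution_def)
      hence "snc_at_origin (homogenize d f)" by (simp add: jac_Nil pullback_def)
      from snc_homogenize_imp[OF f this] have "d \<le> 2 * M" by (simp add: M_def)
      hence "\<mu> = 1 / real M" using d M1 by (simp add: \<mu>_def min_def field_simps)
      thus ?thesis using comp(3) by simp
    next
      case False
      then obtain w where "w \<in> T" by blast
      hence "[] \<in> T"
      proof (induction w rule: rev_induct)
        case (snoc c w)
        thus ?case using cl unfolding blowup_cluster_def by blast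
      qed
      hence "2 / real d \<in> ?E" using exc(2) by force
      thus ?thesis using comp(3) by (auto simp: \<mu>_def min_def)
    qed
    with fin ge have "Min (?E \<union> component_thresholds (homogenize d f)) = \<mu>" by (intro Min_eqI) auto
    thus ?thesis unfolding lct_via_def component_thresholds_def .
  qed
  have "lct (homogenize d f) = \<mu>"
    unfolding lct_def
  proof (rule the_equality)
    show "\<exists>T. log_resolution (homogenize d f) T \<and> \<mu> = lct_via (homogenize d f) T"
      using blowup_origin_log_resolution[OF f d] via by metis
  qed (use via in metis)
  thus ?thesis by (simp add: \<mu>_def M_def)
qed

section \<open>Polynomials over the residue field and the F-pure threshold\<close>

context prime_modulus begin

abbreviation (input) Rp :: "int ring" where "Rp \<equiv> residue_ring (int p)"

interpretation R: residues_prime p Rp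
  by unfold_locales (rule prime_p)

lemma cring_R: "cring Rp"
  by (rule R.is_cring)

interpretation U: UP_cring Rp "UP Rp"
  by (intro UP_cring.intro cring_R)

interpretation V: UP_cring "UP Rp" "UP2 Rp"
  unfolding UP2_def by (intro UP_cring.intro U.UP_cring)

lemma R_simps: "carrier Rp = {0..int p - 1}" "x \<otimes>\<^bsub>Rp\<^esub> y = (x * y) mod int p"
   "x \<oplus>\<^bsub>Rp\<^esub> y = (x + y) mod int p" "\<one>\<^bsub>Rp\<^esub> = 1" "\<zero>\<^bsub>Rp\<^esub> = 0"
  by (simp_all add: residue_ring_def)

lemma p_pos: "int p > 0" using prime_p prime_gt_0_nat by simp

lemma mod_carrier: "x mod int p \<in> carrier Rp"
  using p_pos pos_mod_bound[of "int p" x] by (simp add: R_simps)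

lemma UP_coeff: "f \<in> carrier (UP A) \<Longrightarrow> up_ring.coeff (UP A) f n = f n"
  by (simp add: UP_def)

lemma UP_monom:
  "a \<in> carrier A \<Longrightarrow> up_ring.monom (UP A) a n = (\<lambda>i. if i = n then a else \<zero>\<^bsub>A\<^esub>)"
  by (simp add: UP_def)

lemma UP2_apply_carrier: "g \<in> carrier (UP2 Rp) \<Longrightarrow> g j \<in> carrier (UP Rp)"
   "g \<in> carrier (UP2 Rp) \<Longrightarrow> g j i \<in> carrier Rp"
proof -
  show 1: "g j \<in> carrier (UP Rp)" if "g \<in> carrier (UP2 Rp)" for g j
    using that by (auto simp: UP2_def UP_def)
  show "g j i \<in> carrier Rp" if "g \<in> carrier (UP2 Rp)"
    using 1[OF that, of j] by (auto simp: UP_def)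
qed

lemma UP2_add_apply:
  assumes "g \<in> carrier (UP2 Rp)" "h \<in> carrier (UP2 Rp)"
  shows "(g \<oplus>\<^bsub>UP2 Rp\<^esub> h) j i = (g j i + h j i) mod int p"
proof -
  have "(g \<oplus>\<^bsub>UP2 Rp\<^esub> h) j = g j \<oplus>\<^bsub>UP Rp\<^esub> h j"
    using assms by (simp add: UP2_def UP_def)
  moreover have "(g j \<oplus>\<^bsub>UP Rp\<^esub> h j) i = g j i \<oplus>\<^bsub>Rp\<^esub> h j i"
    using assms[THEN UP2_apply_carrier(1), of j] by (simp add: UP_def)
  ultimately show ?thesis by (simp add: R_simps)
qed

lemma UP2_mult_apply:
  assumes "g \<in> carrier (UP2 Rp)" "h \<in> carrier (UP2 Rp)"
  shows "(g \<otimes>\<^bsub>UP2 Rp\<^esub> h) j i =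
    finsum Rp (\<lambda>l. finsum Rp (\<lambda>k. g l k \<otimes>\<^bsub>Rp\<^esub> h (j - l) (i - k)) {..i}) {..j}"
proof -
  have cl: "\<And>l. g l \<otimes>\<^bsub>UP Rp\<^esub> h (j - l) \<in> carrier (UP Rp)"
    using assms by (intro U.UP_mult_closed UP2_apply_carrier)
  have 1: "(g \<otimes>\<^bsub>UP2 Rp\<^esub> h) j = finsum (UP Rp) (\<lambda>l. g l \<otimes>\<^bsub>UP Rp\<^esub> h (j - l)) {..j}"
    using assms by (simp add: UP2_def UP_def)
  have "(g \<otimes>\<^bsub>UP2 Rp\<^esub> h) j i = up_ring.coeff (UP Rp) (finsum (UP Rp) (\<lambda>l. g l \<otimes>\<^bsub>UP Rp\<^esub> h (j - l)) {..j}) i"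
    unfolding 1 using cl by (subst UP_coeff) (auto intro!: U.P.finsum_closed)
  also have "\<dots> = finsum Rp (\<lambda>l. up_ring.coeff (UP Rp) (g l \<otimes>\<^bsub>UP Rp\<^esub> h (j - l)) i) {..j}"
    using cl by (subst U.coeff_finsum) auto
  also have "\<dots> = finsum Rp (\<lambda>l. finsum Rp (\<lambda>k. g l k \<otimes>\<^bsub>Rp\<^esub> h (j - l) (i - k)) {..i}) {..j}"
  proof -
    have "up_ring.coeff (UP Rp) (g l \<otimes>\<^bsub>UP Rp\<^esub> h (j - l)) i =
        finsum Rp (\<lambda>k. g l k \<otimes>\<^bsub>Rp\<^esub> h (j - l) (i - k)) {..i}" for l
      using assms by (subst U.coeff_mult) (simp_all add: UP2_apply_carrier UP_coeff)
    thus ?thesis by (simp only:)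
  qed
  finally show ?thesis .
qed

lemma finsum_mod: "finite A \<Longrightarrow> finsum Rp (\<lambda>x. F x mod int p) A = sum F A mod int p"
proof (induction A rule: finite_induct)
  case (insert x A)
  thus ?case using p_pos
    by (subst R.finsum_insert) (auto simp: R_simps mod_simps)
qed (simp add: R_simps)

definition reduce2 :: "int poly poly \<Rightarrow> nat \<Rightarrow> nat \<Rightarrow> int" where
  "reduce2 H = (\<lambda>j i. coeff2 H i j mod int p)"

lemma reduce2_carrier: "reduce2 H \<in> carrier (UP2 Rp)"
proof -
  have c: "(\<lambda>i. coeff f i mod int p) \<in> carrier (UP Rp)" for f
  proof -
    have "bound \<zero>\<^bsub>Rp\<^esub> (degree f) (\<lambda>i. coeff f i mod int p)"
      by (rule bound.intro) (simp add: coeff_eq_0 R_simps)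
    thus ?thesis using mod_carrier by (auto simp: UP_def intro!: mem_upI)
  qed
  have "bound \<zero>\<^bsub>UP Rp\<^esub> (degree H) (reduce2 H)"
    by (rule bound.intro) (simp add: reduce2_def coeff2_def coeff_eq_0 UP_def R_simps)
  moreover have "reduce2 H n \<in> carrier (UP Rp)" for n
    using c[of "coeff H n"] by (simp add: reduce2_def coeff2_def)
  ultimately have "reduce2 H \<in> up (UP Rp)" by (intro mem_upI) blast+
  thus ?thesis by (simp add: UP2_def UP_def)
qed

lemma reduce2_add: "reduce2 (G + H) = reduce2 G \<oplus>\<^bsub>UP2 Rp\<^esub> reduce2 H"
  by (intro ext) (simp add: UP2_add_apply reduce2_carrier, simp add: reduce2_def coeff2_def mod_simps)

lemma reduce2_mult: "reduce2 (G * H) = reduce2 G \<otimes>\<^bsub>UP2 Rp\<^esub> reduce2 H"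
proof (intro ext)
  fix j i
  have "reduce2 G l k \<otimes>\<^bsub>Rp\<^esub> reduce2 H (j - l) (i - k) = (coeff2 G k l * coeff2 H (i - k) (j - l)) mod int p" for l k
    by (simp add: reduce2_def R_simps mod_simps)
  thus "reduce2 (G * H) j i = (reduce2 G \<otimes>\<^bsub>UP2 Rp\<^esub> reduce2 H) j i"
    by (simp add: UP2_mult_apply reduce2_carrier finsum_mod) (simp add: reduce2_def coeff2_mult)
qed

lemma reduce2_one: "reduce2 1 = \<one>\<^bsub>UP2 Rp\<^esub>"
  using prime_p prime_gt_1_nat[of p]
  by (intro ext) (auto simp: reduce2_def UP2_def UP_def R_simps coeff2_def)

lemma reduce2_power: "reduce2 G [^]\<^bsub>UP2 Rp\<^esub> n = reduce2 (G ^ n)"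
  by (induction n) (simp_all add: reduce2_one[symmetric] reduce2_mult mult.commute V.P.m_comm reduce2_carrier)

lemma reduce2_vars: "UP2_x Rp = reduce2 var_x" "UP2_y Rp = reduce2 var_y"
proof -
  have "\<one>\<^bsub>Rp\<^esub> \<in> carrier Rp" by simp
  hence m: "up_ring.monom (UP Rp) \<one>\<^bsub>Rp\<^esub> 1 = (\<lambda>i. if i = 1 then 1 else 0)"
    by (intro ext) (simp add: UP_def R_simps)
  have mc: "up_ring.monom (UP Rp) \<one>\<^bsub>Rp\<^esub> 1 \<in> carrier (UP Rp)" by (rule U.monom_closed) simp
  have "UP2_x Rp = (\<lambda>j. if j = 0 then up_ring.monom (UP Rp) \<one>\<^bsub>Rp\<^esub> 1 else \<zero>\<^bsub>UP Rp\<^esub>)"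
    unfolding UP2_x_def UP2_def by (rule UP_monom[OF mc])
  also have "\<dots> = reduce2 var_x"
    using prime_p prime_gt_1_nat[of p] unfolding m
    by (intro ext) (auto simp: reduce2_def coeff2_def var_x_def UP_def R_simps coeff_pCons split: nat.splits)
  finally show "UP2_x Rp = reduce2 var_x" .
  have "UP2_y Rp = (\<lambda>j. if j = 1 then \<one>\<^bsub>UP Rp\<^esub> else \<zero>\<^bsub>UP Rp\<^esub>)"
    unfolding UP2_y_def UP2_def by (rule UP_monom) (rule U.UP_one_closed)
  also have "\<dots> = reduce2 var_y"
    using prime_p prime_gt_1_nat[of p]
    by (intro ext) (auto simp: reduce2_def coeff2_def var_y_def UP_def R_simps coeff_pCons split: nat.splits)
  finally show "UP2_y Rp = reduce2 var_y" .
qed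

lemma coeff2_var_power_mult:
  "coeff2 (var_x ^ q * G) i j = (if i < q then 0 else coeff2 G (i - q) j :: 'b::comm_ring_1)"
  "coeff2 (var_y ^ q * G) i j = (if j < q then 0 else coeff2 G i (j - q) :: 'b::comm_ring_1)"
proof -
  have "var_x ^ q = [:monom (1::'b) q:]" by (simp add: var_x_def poly_const_pow monom_altdef)
  thus "coeff2 (var_x ^ q * G) i j = (if i < q then 0 else coeff2 G (i - q) j)"
    by (simp add: coeff2_def coeff_monom_mult)
  have "var_y ^ q = monom (1::'b poly) q" by (simp add: var_y_def monom_altdef)
  thus "coeff2 (var_y ^ q * G) i j = (if j < q then 0 else coeff2 G i (j - q))"
    by (simp add: coeff2_def coeff_monom_mult)
qed

text \<open>
  The ideal is generated by monomials, so it consists of the polynomials without the monomials that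
  neither generator divides.  In the other direction, \<open>B\<close> collects the terms divisible by \<open>y\<^sup>q\<close>, and \<open>A\<close>
  those of the remaining terms that are divisible by \<open>x\<^sup>q\<close>.
\<close>

lemma frobenius_power_membership:
  "reduce2 K \<in> genideal (UP2 Rp) {reduce2 (var_x ^ q), reduce2 (var_y ^ q)} \<longleftrightarrow>
     (\<forall>i<q. \<forall>j<q. int p dvd coeff2 K i j)"
proof
  define I0 where "I0 = {g \<in> carrier (UP2 Rp). \<forall>i<q. \<forall>j<q. g j i = 0}"
  assume mem: "reduce2 K \<in> genideal (UP2 Rp) {reduce2 (var_x ^ q), reduce2 (var_y ^ q)}"
  have mult: "x \<otimes>\<^bsub>UP2 Rp\<^esub> a \<in> I0" if "a \<in> I0" "x \<in> carrier (UP2 Rp)" for a x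
  proof -
    have "(x \<otimes>\<^bsub>UP2 Rp\<^esub> a) j i = 0" if ij: "i < q" "j < q" for i j
    proof -
      have "x l k \<otimes>\<^bsub>Rp\<^esub> a (j - l) (i - k) = 0" for l k
        using \<open>a \<in> I0\<close> ij by (simp add: I0_def R_simps)
      moreover have "finsum Rp (\<lambda>_. 0) A = 0" for A :: "nat set"
        using R.finsum_zero[of A] by (simp add: R_simps)
      ultimately show ?thesis using that \<open>a \<in> I0\<close> \<open>x \<in> _\<close> by (subst UP2_mult_apply) (auto simp: I0_def)
    qed
    thus ?thesis using that by (auto simp: I0_def intro: V.P.m_closed)
  qed
  have "ideal I0 (UP2 Rp)"
  proof (rule idealI)
    show "ring (UP2 Rp)" by (rule V.UP_ring)
    show "subgroup I0 (add_monoid (UP2 Rp))"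
    proof (rule V.P.add.subgroupI)
      show "I0 \<subseteq> carrier (UP2 Rp)" by (auto simp: I0_def)
      have "reduce2 0 j i = 0" for i j by (simp add: reduce2_def coeff2_def)
      hence "reduce2 0 \<in> I0" using reduce2_carrier[of 0] by (simp add: I0_def)
      thus "I0 \<noteq> {}" by blast
      fix a assume a: "a \<in> I0"
      hence ac: "a \<in> carrier (UP2 Rp)" by (simp add: I0_def)
      show "\<ominus>\<^bsub>UP2 Rp\<^esub> a \<in> I0"
      proof -
        have "(\<ominus>\<^bsub>UP2 Rp\<^esub> a) j i = 0" if "i < q" "j < q" for i j
        proof -
          have "(\<ominus>\<^bsub>UP2 Rp\<^esub> a \<oplus>\<^bsub>UP2 Rp\<^esub> a) j i = 0"
            using ac by (simp add: V.P.l_neg) (simp add: UP2_def UP_def R_simps)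
          hence "(\<ominus>\<^bsub>UP2 Rp\<^esub> a) j i mod int p = 0"
            using a that ac by (simp add: UP2_add_apply I0_def)
          moreover have "(\<ominus>\<^bsub>UP2 Rp\<^esub> a) j i \<in> carrier Rp" using ac by (intro UP2_apply_carrier(2)) simp
          ultimately show ?thesis by (simp add: R_simps)
        qed
        thus ?thesis using ac by (simp add: I0_def)
      qed
      fix b assume "b \<in> I0"
      thus "a \<oplus>\<^bsub>UP2 Rp\<^esub> b \<in> I0" using a by (auto simp: I0_def UP2_add_apply)
    qed
    show "x \<otimes>\<^bsub>UP2 Rp\<^esub> a \<in> I0" if "a \<in> I0" "x \<in> carrier (UP2 Rp)" for a x by (rule mult[OF that])
    show "a \<otimes>\<^bsub>UP2 Rp\<^esub> x \<in> I0" if "a \<in> I0" "x \<in> carrier (UP2 Rp)" for a x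
      using mult[OF that] that V.P.m_comm[of x a] by (simp add: I0_def)
  qed
  moreover have "{reduce2 (var_x ^ q), reduce2 (var_y ^ q)} \<subseteq> I0"
  proof -
    have "reduce2 (var_x ^ q) j i = 0" "reduce2 (var_y ^ q) j i = 0" if "i < q" "j < q" for i j
      using that coeff2_var_power_mult[of q "1 :: int poly poly" i j] by (simp_all add: reduce2_def)
    thus ?thesis using reduce2_carrier by (simp add: I0_def)
  qed
  ultimately have "reduce2 K \<in> I0" using V.P.genideal_minimal mem by blast
  thus "\<forall>i<q. \<forall>j<q. int p dvd coeff2 K i j" by (auto simp: I0_def reduce2_def dvd_eq_mod_eq_0)
next
  assume *: "\<forall>i<q. \<forall>j<q. int p dvd coeff2 K i j"
  let ?X = "reduce2 (var_x ^ q)" and ?Y = "reduce2 (var_y ^ q)"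
  define B where "B = poly_shift q K"
  define A where "A = poly_cutoff q (map_poly (poly_shift q) K)"
  have "reduce2 K = reduce2 (var_x ^ q * A + var_y ^ q * B)"
  proof (intro ext)
    fix j i
    have "coeff2 A k j = (if j < q then coeff2 K (k + q) j else 0)" for k
      by (simp add: A_def coeff2_def coeff_poly_cutoff coeff_map_poly coeff_poly_shift)
    moreover have "coeff2 B i k = coeff2 K i (k + q)" for k
      by (simp add: B_def coeff2_def coeff_poly_shift)
    moreover have "coeff2 (var_x ^ q * A + var_y ^ q * B) i j =
        coeff2 (var_x ^ q * A) i j + coeff2 (var_y ^ q * B) i j"
      by (simp add: coeff2_def)
    ultimately have c: "coeff2 (var_x ^ q * A + var_y ^ q * B) i j =
        (if i < q \<and> j < q then 0 else coeff2 K i j)"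
      by (simp add: coeff2_var_power_mult)
    show "reduce2 K j i = reduce2 (var_x ^ q * A + var_y ^ q * B) j i"
    proof (cases "i < q \<and> j < q")
      case True
      hence "coeff2 K i j mod int p = 0" using * by (simp add: dvd_eq_mod_eq_0)
      thus ?thesis unfolding reduce2_def c using True by simp
    next
      case False
      show ?thesis unfolding reduce2_def c if_not_P[OF False] ..
    qed
  qed
  hence eq: "reduce2 K = ?X \<otimes>\<^bsub>UP2 Rp\<^esub> reduce2 A \<oplus>\<^bsub>UP2 Rp\<^esub> ?Y \<otimes>\<^bsub>UP2 Rp\<^esub> reduce2 B"
    by (simp only: reduce2_add reduce2_mult)
  have sub: "{?X, ?Y} \<subseteq> carrier (UP2 Rp)" using reduce2_carrier by simp
  interpret J: ideal "genideal (UP2 Rp) {?X, ?Y}" "UP2 Rp" by (rule V.P.genideal_ideal[OF sub])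
  have "?X \<in> genideal (UP2 Rp) {?X, ?Y}" "?Y \<in> genideal (UP2 Rp) {?X, ?Y}"
    using V.P.genideal_self[OF sub] by auto
  thus "reduce2 K \<in> genideal (UP2 Rp) {?X, ?Y}"
    unfolding eq by (intro J.a_closed J.I_r_closed reduce2_carrier)
qed

lemma fpt_reduce2_homogenize:
  assumes "degree f \<le> d"
  shows "fpt p Rp (reduce2 (homogenize d f)) = Inf {real a / real (p ^ e) | a e. in_frob (a * d) (p ^ e) (f ^ a)}"
proof -
  have "reduce2 (homogenize d f) [^]\<^bsub>UP2 Rp\<^esub> a \<in>
       genideal (UP2 Rp) {UP2_x Rp [^]\<^bsub>UP2 Rp\<^esub> q, UP2_y Rp [^]\<^bsub>UP2 Rp\<^esub> q} \<longleftrightarrow>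
     in_frob (a * d) q (f ^ a)" for a q :: nat
  proof -
    have deg: "degree (f ^ a) \<le> a * d"
      using degree_power_le[of f a] assms by (metis le_trans mult.commute mult_le_mono1)
    have "(\<forall>i<q. \<forall>j<q. int p dvd coeff2 (homogenize (a * d) (f ^ a)) i j) \<longleftrightarrow> in_frob (a * d) q (f ^ a)"
    proof
      assume *: "\<forall>i<q. \<forall>j<q. int p dvd coeff2 (homogenize (a * d) (f ^ a)) i j"
      show "in_frob (a * d) q (f ^ a)"
        unfolding in_frob_def
      proof (intro allI impI)
        fix i assume i: "i < q" "a * d < i + q"
        show "int p dvd coeff (f ^ a) i"
        proof (cases "i \<le> a * d")
          case True
          hence "int p dvd coeff2 (homogenize (a * d) (f ^ a)) i (a * d - i)" using * i by simp
          thus ?thesis using True by (simp add: coeff2_homogenize)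
        next
          case False
          thus ?thesis using deg by (simp add: coeff_eq_0)
        qed
      qed
    next
      assume "in_frob (a * d) q (f ^ a)"
      thus "\<forall>i<q. \<forall>j<q. int p dvd coeff2 (homogenize (a * d) (f ^ a)) i j"
        by (auto simp: in_frob_def coeff2_homogenize)
    qed
    thus ?thesis using assms
      by (simp add: reduce2_vars reduce2_power frobenius_power_membership homogenize_power mult.commute)
  qed
  thus ?thesis unfolding fpt_def by simp
qed

end

section \<open>Factorization over the rational numbers\<close>

abbreviation int_to :: "int poly \<Rightarrow> 'a::comm_ring_1 poly" where
  "int_to \<equiv> map_poly of_int"

lemma int_to_simps:
  "int_to (f + g) = int_to f + (int_to g :: 'a::{idom,ring_char_0} poly)"
  "int_to (f * g) = int_to f * (int_to g :: 'a poly)"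
  "int_to (f ^ n) = (int_to f ^ n :: 'a poly)"
  "int_to (pderiv f) = pderiv (int_to f :: 'a::{idom,ring_char_0} poly)"
  "degree (int_to f :: 'a poly) = degree f"
proof -
  show add: "int_to (f + g) = int_to f + (int_to g :: 'a poly)" for f g
    by (rule poly_eqI) (simp add: coeff_map_poly)
  show mult: "int_to (f * g) = int_to f * (int_to g :: 'a poly)" for f g
    by (rule poly_eqI) (simp add: coeff_map_poly coeff_mult)
  show "int_to (f ^ n) = (int_to f ^ n :: 'a poly)"
    by (induction n) (simp_all add: mult map_poly_1)
  show "int_to (pderiv f) = pderiv (int_to f :: 'a::{idom,ring_char_0} poly)"
    by (rule poly_eqI) (simp add: coeff_map_poly coeff_pderiv)
  show "degree (int_to f :: 'a poly) = degree f"
    by (rule degree_map_poly) simp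
qed

lemma int_to_inj: "int_to f = (int_to g :: 'a::{idom,ring_char_0} poly) \<longleftrightarrow> f = g"
  by (simp add: poly_eq_iff coeff_map_poly)

lemma int_to_prod: "int_to (\<Prod>x\<in>A. F x) = (\<Prod>x\<in>A. int_to (F x) :: 'a::{idom,ring_char_0} poly)"
  by (induction A rule: infinite_finite_induct) (simp_all add: int_to_simps map_poly_1)

lemma clear_denominators:
  fixes f :: "rat poly"
  shows "\<exists>(c::int) F. c \<noteq> 0 \<and> int_to F = smult (of_int c) f"
proof (induction f)
  case 0
  show ?case by (rule exI[of _ 1], rule exI[of _ 0]) simp
next
  case (pCons a f)
  then obtain c F where cF: "c \<noteq> 0" "int_to F = smult (of_int c :: rat) f" by blast
  obtain n d where nd: "quotient_of a = (n, d)" by fastforce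
  hence d: "d \<noteq> 0" "a = of_int n / of_int d" using quotient_of_denom_pos[of a] quotient_of_div[of a] by auto
  have "int_to (pCons (c * n) (smult d F)) = pCons (of_int (c * n)) (smult (of_int d) (int_to F :: rat poly))"
  proof -
    have "int_to (smult d F) = smult (of_int d) (int_to F :: rat poly)"
      by (rule poly_eqI) (simp add: coeff_map_poly)
    thus ?thesis by (simp add: map_poly_pCons)
  qed
  also have "\<dots> = smult (of_int (c * d)) (pCons a f)" using d cF(2) by (simp add: mult.commute)
  finally show ?case using cF(1) d(1) by (intro exI[of _ "c * d"]) auto
qed

text \<open>
  Clearing denominators in a Bezout identity over the rationals leaves a nonzero integer \<open>N\<close>; primes that
  do not divide \<open>N\<close> preserve coprimality.
\<close>

lemma int_bezout:
  assumes "coprime (int_to F :: rat poly) (int_to G)"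
  shows "\<exists>A B N. N \<noteq> 0 \<and> A * F + B * G = [:N:]"
proof -
  obtain a b where ab: "a * int_to F + b * int_to G = (1 :: rat poly)"
    using assms bezout_coefficients_fst_snd[of "int_to F :: rat poly" "int_to G"]
    by (metis coprime_iff_gcd_eq_1)
  obtain c A where A: "c \<noteq> 0" "int_to A = smult (of_int c :: rat) a" using clear_denominators by blast
  obtain d B where B: "d \<noteq> 0" "int_to B = smult (of_int d :: rat) b" using clear_denominators by blast
  have sm: "int_to (smult k F) = smult (of_int k) (int_to F :: rat poly)" for k F
    by (rule poly_eqI) (simp add: coeff_map_poly)
  have "int_to (smult d A * F + smult c B * G) = smult (of_int (c * d)) (a * int_to F + b * int_to G :: rat poly)"
    by (simp add: int_to_simps sm A B smult_add_right mult.commute)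
  also have "\<dots> = int_to [:c * d:]" unfolding ab by (simp add: map_poly_pCons one_pCons)
  finally have "smult d A * F + smult c B * G = [:c * d:]"
    by (simp only: int_to_inj)
  thus ?thesis using A(1) B(1) by (metis mult_eq_0_iff)
qed

lemma comaximal_mod_large_primes:
  assumes "coprime (int_to F :: rat poly) (int_to G)"
  shows "\<forall>\<^sub>F p in sequentially. prime p \<longrightarrow> prime_modulus.comaximal p F G"
proof -
  obtain A B N where N: "N \<noteq> 0" "A * F + B * G = [:N:]" using int_bezout[OF assms] by blast
  have "prime p \<longrightarrow> prime_modulus.comaximal p F G" if "p > nat \<bar>N\<bar>" for p
  proof
    assume "prime p"
    then interpret prime_modulus p by unfold_locales
    have "\<not> int p dvd N" using that N(1) dvd_imp_le_int[of N "int p"] by auto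
    then obtain c where c: "int p dvd 1 - c * N" by (rule inverse_mod_p)
    have "smult c A * F + smult c B * G = smult c (A * F + B * G)" by (simp add: smult_add_right)
    also have "\<dots> = [:c * N:]" unfolding N(2) by simp
    finally have "pcong (smult c A * F + smult c B * G) 1"
      unfolding pcong_iff using c dvd_minus_iff[of "int p" "1 - c * N"]
      by (auto simp: coeff_pCons split: nat.splits)
    thus "comaximal F G" unfolding comaximal_def by blast
  qed
  thus ?thesis unfolding eventually_sequentially by (metis Suc_le_eq less_eq_Suc_le)
qed

lemma not_dvd_mod_large_primes:
  assumes "(c::int) \<noteq> 0" shows "\<forall>\<^sub>F p in sequentially. \<not> int p dvd c"
proof -
  have "\<not> int p dvd c" if "p > nat \<bar>c\<bar>" for p
    using that assms dvd_imp_le_int[of c "int p"] by auto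
  thus ?thesis unfolding eventually_sequentially by (metis Suc_le_eq)
qed

text \<open>
  The prime factors of \<open>f\<close> over the rationals, rescaled to integer polynomials.  In characteristic zero
  they are coprime to their derivatives.
\<close>

lemma irreducible_integral_factorization:
  fixes f :: "rat poly"
  assumes "f \<noteq> 0"
  shows "\<exists>Ps m u v. finite Ps \<and> u \<noteq> 0 \<and> v \<noteq> 0 \<and>
    (\<forall>P\<in>Ps. degree P \<ge> 1 \<and> m P \<ge> 1 \<and> coprime (int_to P :: rat poly) (int_to (pderiv P))) \<and>
    (\<forall>P\<in>Ps. \<forall>Q\<in>Ps. P \<noteq> Q \<longrightarrow> coprime (int_to P :: rat poly) (int_to Q)) \<and>
    smult (of_int u) f = smult (of_int v) (int_to (\<Prod>P\<in>Ps. P ^ m P))"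
proof -
  have "\<exists>F. \<exists>c. c \<noteq> 0 \<and> int_to F = smult (of_int c) q" for q :: "rat poly"
    using clear_denominators[of q] by blast
  then obtain sc where "\<forall>q. \<exists>c. c \<noteq> 0 \<and> int_to (sc q) = smult (of_int c) (q :: rat poly)"
    by metis
  then obtain den where den: "\<And>q. den q \<noteq> 0" "\<And>q. int_to (sc q) = smult (of_int (den q)) (q :: rat poly)"
    by metis
  define S where "S = prime_factors f"
  have prime: "prime q" if "q \<in> S" for q using that by (simp add: S_def in_prime_factors_iff)
  have dvd_sc: "r dvd int_to (sc q) \<longleftrightarrow> r dvd q" and sc_dvd: "int_to (sc q) dvd r \<longleftrightarrow> q dvd r" for q r :: "rat poly"
    unfolding den(2) using den(1) by (simp_all add: dvd_smult_iff smult_dvd_iff)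
  have coprime_sc: "coprime (int_to (sc q)) r \<longleftrightarrow> coprime q r" for q r :: "rat poly"
    unfolding coprime_def dvd_sc ..
  have inj: "inj_on sc S"
  proof (rule inj_onI)
    fix q r assume qr: "q \<in> S" "r \<in> S" "sc q = sc r"
    have "q dvd r" using dvd_sc[of q r] dvd_sc[of q q] qr(3) by simp
    thus "q = r" using prime qr by (intro primes_dvd_imp_eq)
  qed
  define m where "m P = multiplicity (int_to P) f" for P
  have m_sc: "m (sc q) = multiplicity q f" for q
  proof -
    have "is_unit [:of_int (den q) :: rat:]" using den(1)[of q] by (simp add: is_unit_const_poly_iff dvd_field_iff)
    from multiplicity_times_unit_left[OF this, of q f] show ?thesis by (simp add: m_def den(2))
  qed
  have deg: "degree q \<ge> 1" if "q \<in> S" for q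
  proof (rule ccontr)
    assume "\<not> degree q \<ge> 1"
    then obtain c where "q = [:c:]" by (metis degree_eq_zeroE less_one not_le)
    moreover have "q \<noteq> 0" "\<not> is_unit q" using prime[OF that] by auto
    ultimately show False by (auto simp: is_unit_const_poly_iff dvd_field_iff)
  qed
  have deg_sc: "degree (sc q) = degree q" for q
  proof -
    have "degree (sc q) = degree (int_to (sc q) :: rat poly)" by (simp add: int_to_simps)
    thus ?thesis using den(1)[of q] by (simp add: den(2))
  qed
  have fin: "finite S" by (simp add: S_def)
  have 1: "\<forall>P\<in>sc ` S. degree P \<ge> 1 \<and> m P \<ge> 1 \<and> coprime (int_to P :: rat poly) (int_to (pderiv P))"
  proof (intro ballI, elim imageE, hypsubst)
    fix P q assume q: "q \<in> S"
    have "m (sc q) \<ge> 1"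
      using q assms prime_factors_multiplicity[of f] by (auto simp: m_sc S_def)
    moreover have "coprime (int_to (sc q)) (int_to (pderiv (sc q)) :: rat poly)"
    proof -
      have "int_to (pderiv (sc q)) = pderiv (int_to (sc q) :: rat poly)" by (simp add: int_to_simps)
      also have "\<dots> = smult (of_int (den q)) (pderiv q)" by (simp add: den(2) pderiv_smult)
      finally have eq: "int_to (pderiv (sc q)) = smult (of_int (den q) :: rat) (pderiv q)" .
      have "pderiv q \<noteq> 0" using deg[OF q] by (simp add: pderiv_eq_0_iff)
      moreover have "degree (pderiv q) < degree q" using deg[OF q] by (simp add: degree_pderiv)
      ultimately have "\<not> q dvd pderiv q" by (metis dvd_imp_degree_le not_le)
      hence "coprime q (smult (of_int (den q)) (pderiv q))"
        using prime[OF q] den(1)[of q] by (intro prime_imp_coprime) (simp_all add: dvd_smult_iff)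
      thus ?thesis unfolding eq coprime_sc .
    qed
    ultimately show "degree (sc q) \<ge> 1 \<and> m (sc q) \<ge> 1 \<and> coprime (int_to (sc q) :: rat poly) (int_to (pderiv (sc q)))"
      using deg[OF q] by (simp add: deg_sc)
  qed
  have 2: "\<forall>P\<in>sc ` S. \<forall>Q\<in>sc ` S. P \<noteq> Q \<longrightarrow> coprime (int_to P :: rat poly) (int_to Q)"
  proof (intro ballI impI, elim imageE, hypsubst)
    fix q r assume "q \<in> S" "r \<in> S" "sc q \<noteq> sc r"
    hence "coprime q r" using prime by (intro primes_coprime) auto
    thus "coprime (int_to (sc q)) (int_to (sc r) :: rat poly)"
      by (simp add: coprime_sc coprime_commute[of q] coprime_commute[of "int_to (sc q)"])
  qed
  define D where "D = (\<Prod>q\<in>S. den q ^ multiplicity q f)"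
  have D: "D \<noteq> 0" using den(1) fin by (simp add: D_def)
  have "int_to (\<Prod>P\<in>sc ` S. P ^ m P) = (\<Prod>q\<in>S. (int_to (sc q) :: rat poly) ^ multiplicity q f)"
    by (simp add: prod.reindex[OF inj] m_sc int_to_prod int_to_simps)
  also have "\<dots> = smult (of_int D) (\<Prod>q\<in>S. q ^ multiplicity q f)"
  proof -
    have "(\<Prod>q\<in>A. (int_to (sc q) :: rat poly) ^ multiplicity q f) =
        smult (of_int (\<Prod>q\<in>A. den q ^ multiplicity q f)) (\<Prod>q\<in>A. q ^ multiplicity q f)" for A
      by (induction A rule: infinite_finite_induct) (simp_all add: den(2) smult_power mult.commute)
    thus ?thesis by (simp add: D_def)
  qed
  also have "(\<Prod>q\<in>S. q ^ multiplicity q f) = normalize f" unfolding S_def using assms by (rule prod_prime_factors)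
  also have "normalize f = smult (inverse (lead_coeff f)) f"
    by (rule poly_eqI) (simp add: normalize_poly_eq_map_poly coeff_map_poly field_simps)
  finally have E: "int_to (\<Prod>P\<in>sc ` S. P ^ m P) = smult (of_int D * inverse (lead_coeff f)) f" by simp
  obtain a b where ab: "quotient_of (lead_coeff f) = (a, b)" by fastforce
  hence b: "b \<noteq> 0" "lead_coeff f = of_int a / of_int b"
    using quotient_of_denom_pos[of "lead_coeff f"] quotient_of_div[of "lead_coeff f"] by auto
  have a: "a \<noteq> 0" using b assms by auto
  have "smult (of_int (D * b)) f = smult (of_int a) (int_to (\<Prod>P\<in>sc ` S. P ^ m P))"
    unfolding E b(2) using a b(1) by simp
  thus ?thesis using 1 2 fin a b(1) D
    by (intro exI[of _ "sc ` S"] exI[of _ m] exI[of _ "D * b"] exI[of _ a]) simp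
qed

lemma order_factor:
  fixes f :: "complex poly"
  assumes "f = [:-z, 1:] ^ m * h" "poly h z \<noteq> 0" shows "order z f = m"
proof (rule order_unique_lemma)
  show "[:-z, 1:] ^ m dvd f" using assms by simp
  show "\<not> [:-z, 1:] ^ Suc m dvd f"
  proof
    assume "[:-z, 1:] ^ Suc m dvd f"
    hence "[:-z, 1:] ^ m * [:-z, 1:] dvd [:-z, 1:] ^ m * h" using assms(1) by (simp add: mult.commute)
    hence "[:-z, 1:] dvd h" by (subst (asm) dvd_mult_cancel_left) auto
    thus False using assms(2) by (simp add: poly_eq_0_iff_dvd)
  qed
qed

lemma common_root_of_coprime:
  assumes "coprime (int_to F :: rat poly) (int_to G)" "poly (int_to F) (z::complex) = 0"
  shows "poly (int_to G) z \<noteq> 0"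
proof
  assume G: "poly (int_to G) z = 0"
  obtain A B N where N: "N \<noteq> 0" "A * F + B * G = [:N:]" using int_bezout[OF assms(1)] by blast
  have "poly (int_to (A * F + B * G)) z = 0" using assms(2) G by (simp add: int_to_simps)
  thus False unfolding N(2) using N(1) by (simp add: map_poly_pCons)
qed

lemma order_root_of_factorization:
  fixes z :: complex
  assumes fin: "finite Ps" and P: "P \<in> Ps" "poly (int_to P) z = 0"
    and sqf: "coprime (int_to P :: rat poly) (int_to (pderiv P))"
    and cop: "\<And>Q. Q \<in> Ps \<Longrightarrow> P \<noteq> Q \<Longrightarrow> coprime (int_to P :: rat poly) (int_to Q)"
  shows "order z (int_to (\<Prod>P\<in>Ps. P ^ m P)) = m P"
proof -
  obtain s where s: "(int_to P :: complex poly) = [:-z, 1:] * s" using P(2) by (auto simp: poly_eq_0_iff_dvd)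
  have "poly s z = poly (pderiv (int_to P)) z" unfolding s pderiv_mult by (simp add: pderiv_pCons)
  hence s0: "poly s z \<noteq> 0"
    using common_root_of_coprime[OF sqf P(2)] by (simp add: int_to_simps)
  define h where "h = s ^ m P * (\<Prod>Q\<in>Ps - {P}. int_to Q ^ m Q)"
  have "int_to (\<Prod>P\<in>Ps. P ^ m P) = (\<Prod>P\<in>Ps. (int_to P :: complex poly) ^ m P)"
    by (simp add: int_to_prod int_to_simps)
  also have "\<dots> = (int_to P) ^ m P * (\<Prod>Q\<in>Ps - {P}. int_to Q ^ m Q)"
    using fin P(1) by (rule prod.remove)
  also have "\<dots> = [:-z, 1:] ^ m P * h" by (simp only: s h_def power_mult_distrib mult_ac)
  finally show ?thesis
  proof (rule order_factor)
    show "poly h z \<noteq> 0"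
      using s0 fin common_root_of_coprime[OF cop P(2)]
      by (auto simp: h_def poly_prod)
  qed
qed


text \<open>
  The hypothesis makes \<open>c\<close> an inverse of \<open>u\<close> modulo \<open>p\<close>.  The fraction \<open>n / u\<close> need not be in lowest
  terms.
\<close>

lemma (in prime_modulus) red_rat_fraction:
  assumes c: "int p dvd 1 - c * u" and r: "of_int u * r = (of_int n :: rat)"
  shows "red_rat p r = (c * n) mod int p"
proof -
  interpret R: residues_prime p "residue_ring (int p)"
    by unfold_locales (rule prime_p)
  obtain a b where ab: "quotient_of r = (a, b)" by fastforce
  hence b: "b > 0" "r = of_int a / of_int b" and cop: "coprime a b"
    using quotient_of_denom_pos[of r] quotient_of_div[of r] quotient_of_coprime[of r] by auto
  have "(of_int (u * a) :: rat) = of_int (n * b)" using r b by (simp add: field_simps)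
  hence uan: "u * a = n * b" by (simp only: of_int_eq_iff)
  have "\<not> int p dvd u"
  proof
    assume "int p dvd u"
    hence "int p dvd 1" using dvd_add[OF c, of "c * u"] by simp
    thus False using prime_p by (simp add: prime_gt_1_nat)
  qed
  have pb: "\<not> int p dvd b"
  proof
    assume "int p dvd b"
    moreover from this have "int p dvd a" using uan \<open>\<not> int p dvd u\<close> prime_dvd_mult_int
      by (metis dvd_mult)
    ultimately have "int p dvd 1" using cop coprime_common_divisor by blast
    thus False using prime_p by (simp add: prime_gt_1_nat)
  qed
  let ?B = "b mod int p" and ?v = "(c * n) mod int p"
  have carr: "?B \<in> carrier Rp" "?v \<in> carrier Rp" by (rule mod_carrier)+
  have "?B \<noteq> \<zero>\<^bsub>Rp\<^esub>" using pb by (simp add: R_simps dvd_eq_mod_eq_0)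
  hence unit: "?B \<in> Units Rp" using carr by (simp add: R.field_Units)
  have "(c * n) * b - a = - (a * (1 - c * u))" using uan by (simp add: algebra_simps)
  hence "int p dvd (c * n) * b - a" using c by (metis dvd_minus_iff dvd_mult)
  hence "((c * n) * b) mod int p = a mod int p" by (simp add: mod_eq_dvd_iff)
  hence "?v \<otimes>\<^bsub>Rp\<^esub> ?B = a mod int p" by (simp add: R_simps mod_simps)
  hence "a mod int p \<otimes>\<^bsub>Rp\<^esub> inv\<^bsub>Rp\<^esub> ?B = ?v \<otimes>\<^bsub>Rp\<^esub> (?B \<otimes>\<^bsub>Rp\<^esub> inv\<^bsub>Rp\<^esub> ?B)"
    using carr unit by (metis R.m_assoc R.Units_inv_closed)
  also have "\<dots> = ?v" using carr unit by simp
  finally show ?thesis by (simp add: red_rat_def ab Let_def)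
qed

lemma (in prime_modulus) reduction_homogenize:
  assumes c: "int p dvd 1 - c * u" and F: "smult (of_int u) f = smult (of_int v) (int_to F)"
  shows "reduction p (homogenize d f) = reduce2 (homogenize d (smult (c * v) F))"
proof (intro ext)
  fix j i
  have "of_int u * coeff f i = (of_int (v * coeff F i) :: rat)"
    using arg_cong[OF F, of "\<lambda>g. coeff g i"] by (simp add: coeff_map_poly)
  hence "red_rat p (coeff f i) = (c * (v * coeff F i)) mod int p" by (rule red_rat_fraction[OF c])
  moreover have "red_rat p 0 = 0" using red_rat_fraction[OF c, of 0 0] by simp
  ultimately show "reduction p (homogenize d f) j i = reduce2 (homogenize d (smult (c * v) F)) j i"
    by (simp add: reduction_def reduce2_def coeff2_homogenize mult.assoc)
qed

lemma (in prime_modulus) in_frob_smult: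
  assumes "\<not> int p dvd c" shows "in_frob n q (smult c f) \<longleftrightarrow> in_frob n q f"
  using assms by (simp add: in_frob_def prime_dvd_mult_int)

lemma (in forms_mod_p) fpt_reduction:
  assumes F: "smult (of_int u) f = smult (of_int v) (int_to (form_prod m))"
    and uv: "\<not> int p dvd u" "\<not> int p dvd v"
  shows "fpt p (residue_ring (int p)) (reduction p (homogenize (form_degree m) f)) = Inf (thresholds m)"
proof -
  obtain c where c: "int p dvd 1 - c * u" by (rule inverse_mod_p[OF uv(1)])
  have "\<not> int p dvd c"
  proof
    assume "int p dvd c"
    hence "int p dvd 1" using dvd_add[OF c, of "c * u"] by simp
    thus False using p_gt_1 by simp
  qed
  hence "\<not> int p dvd c * v" using uv(2) by (simp add: prime_dvd_mult_int)
  moreover have "prime (int p)" using prime_p by simp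
  ultimately have k: "\<not> int p dvd (c * v) ^ a" for a
    using prime_dvd_power by blast
  have "in_frob (a * form_degree m) q (smult (c * v) (form_prod m) ^ a) \<longleftrightarrow> exps_in_frob q (\<lambda>i. a * m i)" for a q
  proof -
    have "form_prod (\<lambda>i. a * m i) = form_prod m ^ a"
      by (simp add: form_prod_def prod_power_distrib mult.commute[of a] power_mult)
    thus ?thesis by (simp add: smult_power in_frob_smult[OF k] exps_in_frob_def form_degree_scale)
  qed
  moreover have "degree (smult (c * v) (form_prod m)) \<le> form_degree m"
    using degree_form_prod_le[of m] degree_smult_le le_trans by blast
  ultimately show ?thesis
    unfolding reduction_homogenize[OF c F] thresholds_def by (subst fpt_reduce2_homogenize) simp_all
qed

text \<open>
  Distinct irreducible factors over the rationals have no common complex root, and each has only simple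
  roots.  So the multiplicity of a complex linear factor of the form is the exponent of the irreducible
  factor to which it belongs.
\<close>

lemma factor_mults_of_factorization:
  fixes f :: "rat poly"
  assumes fin: "finite Ps" and uv: "u \<noteq> 0" "v \<noteq> 0"
    and Ps: "\<And>P. P \<in> Ps \<Longrightarrow> degree P \<ge> 1 \<and> m P \<ge> 1 \<and> coprime (int_to P :: rat poly) (int_to (pderiv P))"
    and cop: "\<And>P Q. P \<in> Ps \<Longrightarrow> Q \<in> Ps \<Longrightarrow> P \<noteq> Q \<Longrightarrow> coprime (int_to P :: rat poly) (int_to Q)"
    and F: "smult (of_int u) f = smult (of_int v) (int_to (\<Prod>P\<in>Ps. P ^ m P))"
  shows "factor_mults d (map_poly of_rat f) = insert (d - degree f) (m ` Ps)"
    and "P \<in> Ps \<Longrightarrow> \<exists>z. order z (map_poly of_rat f :: complex poly) = m P"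
proof -
  let ?F = "\<Prod>P\<in>Ps. P ^ m P" and ?fC = "map_poly of_rat f :: complex poly"
  have FC: "smult (of_int u) ?fC = smult (of_int v) (int_to ?F)"
  proof (rule poly_eqI)
    fix i
    have "of_int u * coeff f i = (of_int v * of_int (coeff ?F i) :: rat)"
      using arg_cong[OF F, of "\<lambda>g. coeff g i"] by (simp add: coeff_map_poly)
    hence "of_rat (of_int u * coeff f i) = (of_rat (of_int v * of_int (coeff ?F i)) :: complex)" by simp
    thus "coeff (smult (of_int u) ?fC) i = coeff (smult (of_int v) (int_to ?F)) i"
      by (simp add: coeff_map_poly of_rat_mult)
  qed
  have ord: "order z ?fC = order z (int_to ?F)" for z
    using arg_cong[OF FC, of "order z"] uv by (simp add: order_smult)
  have root: "poly ?fC z = 0 \<longleftrightarrow> (\<exists>P\<in>Ps. poly (int_to P) z = 0)" for z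
  proof -
    have "of_int u * poly ?fC z = of_int v * poly (int_to ?F) z"
      using arg_cong[OF FC, of "\<lambda>g. poly g z"] by simp
    hence "poly ?fC z = 0 \<longleftrightarrow> poly (int_to ?F) z = 0" using uv by auto
    also have "\<dots> \<longleftrightarrow> (\<exists>P\<in>Ps. poly (int_to P) z ^ m P = 0)"
      using fin by (simp add: int_to_prod int_to_simps poly_prod poly_power)
    also have "\<dots> \<longleftrightarrow> (\<exists>P\<in>Ps. poly (int_to P) z = 0)"
      using Ps by (force simp: power_eq_0_iff)
    finally show ?thesis .
  qed
  have ord_P: "order z ?fC = m P" if "P \<in> Ps" "poly (int_to P) z = 0" for z P
    unfolding ord by (rule order_root_of_factorization[OF fin that]) (use Ps cop that in auto)
  have ex_root: "\<exists>z::complex. poly (int_to P) z = 0" if "P \<in> Ps" for P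
  proof -
    have "degree (int_to P :: complex poly) \<ge> 1" using Ps[OF that] by (simp add: int_to_simps)
    thus ?thesis using fundamental_theorem_of_algebra[of "int_to P"] by (auto simp: constant_degree)
  qed
  show "P \<in> Ps \<Longrightarrow> \<exists>z. order z ?fC = m P" using ex_root ord_P by metis
  have "(\<lambda>z. order z ?fC) ` {z. poly ?fC z = 0} = m ` Ps"
  proof (intro equalityI subsetI)
    fix k assume "k \<in> (\<lambda>z. order z ?fC) ` {z. poly ?fC z = 0}"
    then obtain z where "k = order z ?fC" "poly ?fC z = 0" by auto
    thus "k \<in> m ` Ps" using root ord_P by (metis imageI)
  next
    fix k assume "k \<in> m ` Ps"
    then obtain P where P: "P \<in> Ps" "k = m P" by auto
    obtain z where z: "poly (int_to P) z = (0::complex)" using ex_root[OF P(1)] by blast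
    hence "poly ?fC z = 0" using root P(1) by blast
    moreover have "k = order z ?fC" using ord_P[OF P(1) z] P(2) by simp
    ultimately show "k \<in> (\<lambda>z. order z ?fC) ` {z. poly ?fC z = 0}" by blast
  qed
  moreover have "degree ?fC = degree f" by (rule degree_map_poly) simp
  ultimately show "factor_mults d ?fC = insert (d - degree f) (m ` Ps)" by (simp add: factor_mults_def)
qed

section \<open>Denominators of F-pure thresholds\<close>

lemma linear_form_var_y: "linear_form (var_y :: complex poly poly)"
  unfolding linear_form_def by (intro exI[of _ 0] exI[of _ 1]) (simp add: const2_simps)

lemma linear_form_root_form: "linear_form (root_form z)"
  unfolding linear_form_def root_form_def
  by (intro exI[of _ 1] exI[of _ "- z"]) (simp add: const2_simps const2_minus)

lemma coeff2_map_poly2: "h 0 = 0 \<Longrightarrow> coeff2 (map_poly2 h g) i j = h (coeff2 g i j)"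
  by (simp add: map_poly2_def coeff2_def coeff_map_poly)

theorem theorem1:
  fixes G\<^sub>0 :: "rat poly poly"
  assumes "homogeneous2 G\<^sub>0" and "\<not> constant2 G\<^sub>0"
  shows "\<exists>N::nat. \<forall>p\<ge>N. Factorial_Ring.prime p \<longrightarrow>
    fpt p (residue_ring (int p)) (reduction p G\<^sub>0) \<noteq> lct (map_poly2 of_rat G\<^sub>0) \<longrightarrow>
    (\<exists>a b :: nat. 0 < b \<and> coprime a b \<and>
       fpt p (residue_ring (int p)) (reduction p G\<^sub>0) = real a / real b \<and>
       (\<exists>k e l. b = k * p ^ e \<and> 1 \<le> e \<and> linear_form l \<and>
          l dvd (map_poly2 of_rat G\<^sub>0 :: complex poly poly) \<and>
          k dvd multiplicity l (map_poly2 of_rat G\<^sub>0)) \<and>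
       p dvd b)"
proof -
  obtain d where hom: "\<And>i j. coeff2 G\<^sub>0 i j \<noteq> 0 \<Longrightarrow> i + j = d"
    using assms(1) unfolding homogeneous2_def by blast
  define f where "f = poly G\<^sub>0 1"
  have G: "G\<^sub>0 = homogenize d f" and deg_f: "degree f \<le> d"
    unfolding f_def by (rule homogenize_unique[OF hom], assumption)+
  have f0: "f \<noteq> 0"
  proof
    assume "f = 0"
    hence "G\<^sub>0 = const2 0" unfolding G by (simp add: homogenize_def const2_simps)
    thus False using assms(2) unfolding constant2_def by blast
  qed
  have d1: "d \<ge> 1"
  proof (rule ccontr)
    assume "\<not> d \<ge> 1"
    hence "d = 0" by simp
    then obtain c where "f = [:c:]" using deg_f degree_eq_zeroE by auto
    hence "G\<^sub>0 = const2 c" unfolding G \<open>d = 0\<close> by (simp add: homogenize_const)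
    thus False using assms(2) unfolding constant2_def by blast
  qed
  obtain Ps m u v where fin: "finite Ps" and uv: "u \<noteq> 0" "v \<noteq> 0"
    and Ps': "\<forall>P\<in>Ps. degree P \<ge> 1 \<and> m P \<ge> 1 \<and> coprime (int_to P :: rat poly) (int_to (pderiv P))"
    and cop': "\<forall>P\<in>Ps. \<forall>Q\<in>Ps. P \<noteq> Q \<longrightarrow> coprime (int_to P :: rat poly) (int_to Q)"
    and F: "smult (of_int u) f = smult (of_int v) (int_to (\<Prod>P\<in>Ps. P ^ m P))"
    using irreducible_integral_factorization[OF f0] by blast
  note Ps = bspec[OF Ps'] and cop = cop'[rule_format]
  define fC where "fC = (map_poly of_rat f :: complex poly)"
  have GC: "map_poly2 of_rat G\<^sub>0 = homogenize d fC"
    unfolding G by (rule coeff2_eqI) (simp add: coeff2_map_poly2 coeff2_homogenize fC_def coeff_map_poly)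
  have deg_fC: "degree fC = degree f" unfolding fC_def by (rule degree_map_poly) simp
  have fC: "fC \<noteq> 0" "degree fC \<le> d"
    using f0 deg_f unfolding deg_fC by (auto simp: fC_def poly_eq_iff coeff_map_poly)
  have mults: "factor_mults d fC = insert (d - degree f) (m ` Ps)"
    unfolding fC_def by (rule factor_mults_of_factorization(1)[OF fin uv Ps cop F])
  define m' where "m' = case_option (d - degree f) m"
  have "\<forall>\<^sub>F p in sequentially. (\<forall>P\<in>Ps. prime p \<longrightarrow> prime_modulus.comaximal p P (pderiv P)) \<and>
     (\<forall>P\<in>Ps. \<forall>Q\<in>Ps. P \<noteq> Q \<longrightarrow> prime p \<longrightarrow> prime_modulus.comaximal p P Q) \<and>
     (\<forall>P\<in>Ps. \<not> int p dvd lead_coeff P) \<and> \<not> int p dvd u \<and> \<not> int p dvd v \<and> p > (d + 1) * d"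
  proof (intro eventually_conj eventually_ball_finite fin ballI)
    fix P Q assume "P \<in> Ps" "Q \<in> Ps"
    thus "\<forall>\<^sub>F p in sequentially. P \<noteq> Q \<longrightarrow> prime p \<longrightarrow> prime_modulus.comaximal p P Q"
      using comaximal_mod_large_primes[OF cop] by (cases "P = Q") auto
  next
    fix P assume P: "P \<in> Ps"
    show "\<forall>\<^sub>F p in sequentially. prime p \<longrightarrow> prime_modulus.comaximal p P (pderiv P)"
      using Ps[OF P] by (intro comaximal_mod_large_primes) blast
    show "\<forall>\<^sub>F p in sequentially. \<not> int p dvd lead_coeff P"
      using Ps[OF P] by (intro not_dvd_mod_large_primes) auto
  qed (use uv in \<open>auto intro: not_dvd_mod_large_primes eventually_gt_at_top\<close>)
  then obtain N where N: "\<And>p. p \<ge> N \<Longrightarrow> (\<forall>P\<in>Ps. prime p \<longrightarrow> prime_modulus.comaximal p P (pderiv P)) \<and>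
     (\<forall>P\<in>Ps. \<forall>Q\<in>Ps. P \<noteq> Q \<longrightarrow> prime p \<longrightarrow> prime_modulus.comaximal p P Q) \<and>
     (\<forall>P\<in>Ps. \<not> int p dvd lead_coeff P) \<and> \<not> int p dvd u \<and> \<not> int p dvd v \<and> p > (d + 1) * d"
    unfolding eventually_sequentially by blast
  show ?thesis
  proof (rule exI[of _ N], intro allI impI)
    fix p :: nat
    assume pN: "p \<ge> N" and p: "prime p"
      and neq: "fpt p (residue_ring (int p)) (reduction p G\<^sub>0) \<noteq> lct (map_poly2 of_rat G\<^sub>0)"
    interpret pm: prime_modulus p by unfold_locales (rule p)
    interpret forms_mod_p p Ps
      by unfold_locales (use N[OF pN] p fin Ps in auto)
    have form_prod: "form_prod m' = (\<Prod>P\<in>Ps. P ^ m P)" by (simp add: form_prod_def m'_def)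
    have "degree f = degree (smult (of_int u) f)" using uv by simp
    also have "\<dots> = degree (form_prod m')" unfolding F form_prod using uv by (simp add: int_to_simps)
    finally have "form_degree m' = d" using deg_f
      by (simp add: form_prod_def degree_prod_Ps form_degree_def) (simp add: m'_def)
    have "smult (of_int u) f = smult (of_int v) (int_to (form_prod m'))" unfolding form_prod by (rule F)
    from fpt_reduction[OF this] N[OF pN]
    have fpt: "fpt p (residue_ring (int p)) (reduction p G\<^sub>0) = Inf (thresholds m')"
      by (simp add: \<open>form_degree m' = d\<close> G)
    have image: "m' ` factors = factor_mults d fC"
      unfolding mults by (auto simp: factors_def m'_def image_image)
    have ne: "Inf (thresholds m') \<noteq> min (2 / real (form_degree m')) (1 / real (Max (m' ` factors)))"
      using neq unfolding fpt GC lct_homogenize[OF fC d1] image \<open>form_degree m' = d\<close> .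
    have "1 \<le> form_degree m'" "(form_degree m' + 1) * form_degree m' < p"
      using d1 N[OF pN] unfolding \<open>form_degree m' = d\<close> by blast+
    moreover have "\<And>P. P \<in> Ps \<Longrightarrow> 1 \<le> m' (Some P)" using Ps by (simp add: m'_def)
    ultimately obtain i a b k e where i: "i \<in> factors" "m' i \<ge> 1"
      and ab: "0 < b" "coprime a b" "Inf (thresholds m') = real a / real b"
      and b: "b = k * p ^ e" "1 \<le> e" "k dvd m' i"
      using Inf_thresholds_dichotomy[of m'] ne by blast
    have "\<exists>l. linear_form l \<and> multiplicity l (homogenize d fC) = m' i"
    proof (cases i)
      case None
      thus ?thesis using linear_form_var_y multiplicity_var_y[OF fC] by (auto simp: m'_def deg_fC)
    next
      case (Some P)
      hence "P \<in> Ps" using i(1) by (auto simp: factors_def)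
      from factor_mults_of_factorization(2)[OF fin uv Ps cop F this]
      obtain z where "order z fC = m P" unfolding fC_def by blast
      thus ?thesis using linear_form_root_form[of z] multiplicity_root_form[OF fC, of z] Some
        by (auto simp: m'_def)
    qed
    then obtain l where l: "linear_form l" "multiplicity l (homogenize d fC) = m' i" by blast
    have "l dvd homogenize d fC"
      using l(2) i(2) not_dvd_imp_multiplicity_0 by (metis not_one_le_zero)
    moreover have "p dvd b" using b(1,2) by (simp add: dvd_power)
    ultimately show "\<exists>a b :: nat. 0 < b \<and> coprime a b \<and>
       fpt p (residue_ring (int p)) (reduction p G\<^sub>0) = real a / real b \<and>
       (\<exists>k e l. b = k * p ^ e \<and> 1 \<le> e \<and> linear_form l \<and>
          l dvd (map_poly2 of_rat G\<^sub>0 :: complex poly poly) \<and>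
          k dvd multiplicity l (map_poly2 of_rat G\<^sub>0)) \<and> p dvd b"
      unfolding fpt GC using ab b l by metis
  qed
qed

end
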